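(* Let $X$ be a curve of dividing type. Then both $\mathrm{Sep}(X)$ and $\mathrm{Hyp}(X)$ are semigroups, i.e. they are closed under componentwise addition in $\mathbb{N}^r$, where $r$ is the number of connected components of $X(\mathbb{R})$.
   Context: $\mathbb{N}$ denotes the positive integers ($0\notin\mathbb{N}$). A curve is a non-singular, projective, geometrically irreducible algebraic curve over $\mathbb{R}$; projective spaces, morphisms, embeddings and linear subspaces are defined over $\mathbb{R}$. A curve $X$ is of dividing type if $X(\mathbb{C})\smallsetminus X(\mathbb{R})$ has two connected components (otherwise it has one). Let $X$ be a curve of dividing type and let $X_1,\ldots,X_r$ be the connected components of $X(\mathbb{R})$. A morphism $f\colon X\to\mathbb{P}^1$ is separating if $f^{-1}(\mathbb{P}^1(\mathbb{R}))=X(\mathbb{R})$ (preimage taken in $X(\mathbb{C})$). A separating morphism is unramified at all points of $X(\mathbb{R})$, so it restricts to a covering map $X_i\to\mathbb{P}^1(\mathbb{R})$ for each $i$; $d_i(f)\in\mathbb{N}$ is the degree (number of sheets) of this covering, and $d(f)=(d_1(f),\ldots,d_r(f))\in\mathbb{N}^r$. Define $\mathrm{Sep}(X)=\{d(f) : f\colon X\to\mathbb{P}^1\text{ separating}\}\subset\mathbb{N}^r$. Define $\mathrm{Hyp}(X)$ as the set of all $d\in\mathrm{Sep}(X)$ such that $d=d(f)$ for some separating $f$ which is the composition of an embedding of $X$ into some $\mathbb{P}^n$ with the linear projection to $\mathbb{P}^1$ from a codimension-two linear subspace disjoint from (the image of) $X$ (equivalently, such that $f^*\mathcal{O}_{\mathbb{P}^1}(1)$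 is very ample). *)

theory Defs
  imports
    "HOL-Analysis.Analysis"
    "HOL-Library.Poly_Mapping"
    "HOL-Library.Function_Algebras"
    "HOL-Library.Extended_Nat"
begin

section \<open>Complex projective space\<close>

text \<open>
  A point of the n-dimensional complex projective space is a one-dimensional subspace of
  \<open>cspace n\<close>, the vectors with coordinates \<open>0, \<dots>, n\<close>; functions on \<open>nat\<close> are used so that the
  dimension can be quantified over.
\<close>

type_synonym cvec = "nat \<Rightarrow> complex"
type_synonym cpoint = "cvec set"

definition cspace :: "nat \<Rightarrow> cvec set" where
  "cspace n = {v. \<forall>i>n. v i = 0}"

global_interpretation cvec: vector_space "\<lambda>(c::complex) (v::cvec) i. c * v i"
  by standard (auto simp: fun_eq_iff algebra_simps)

definition line :: "cvec \<Rightarrow> cpoint" where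
  "line v = cvec.span {v}"

definition proj_space :: "nat \<Rightarrow> cpoint set" where
  "proj_space n = line ` (cspace n - {0})"

definition real_proj_space :: "nat \<Rightarrow> cpoint set" where
  "real_proj_space n = line ` {v \<in> cspace n - {0}. \<forall>i. v i \<in> \<real>}"

text \<open>The classical topology: the quotient topology with respect to \<open>line\<close>.\<close>

definition proj_topology :: "nat \<Rightarrow> cpoint topology" where
  "proj_topology n = topology (\<lambda>U. U \<subseteq> proj_space n \<and>
     openin (top_of_set (cspace n - {0})) {v \<in> cspace n - {0}. line v \<in> U})"

lemma openin_proj_topology:
  "openin (proj_topology n) U \<longleftrightarrow> U \<subseteq> proj_space n \<and>
     openin (top_of_set (cspace n - {0})) {v \<in> cspace n - {0}. line v \<in> U}"
proof -
  let ?T = "top_of_set (cspace n - {0})"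
  let ?pre = "\<lambda>U. {v \<in> cspace n - {0}. line v \<in> U}"
  have "istopology (\<lambda>U. U \<subseteq> proj_space n \<and> openin ?T (?pre U))"
  proof (unfold istopology_def, intro conjI allI impI)
    fix S T assume "S \<subseteq> proj_space n \<and> openin ?T (?pre S)"
      and "T \<subseteq> proj_space n \<and> openin ?T (?pre T)"
    moreover have "?pre (S \<inter> T) = ?pre S \<inter> ?pre T" by auto
    ultimately show "S \<inter> T \<subseteq> proj_space n" "openin ?T (?pre (S \<inter> T))"
      by (auto simp del: openin_subtopology)
  next
    fix K assume K: "\<forall>S\<in>K. S \<subseteq> proj_space n \<and> openin ?T (?pre S)"
    have "?pre (\<Union>K) = \<Union>(?pre ` K)" by auto
    moreover have "openin ?T (\<Union>(?pre ` K))"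
      using K by (intro openin_Union) blast
    ultimately show "openin ?T (?pre (\<Union>K))" by (rule ssubst)
    from K show "\<Union>K \<subseteq> proj_space n" by blast
  qed
  then show ?thesis
    unfolding proj_topology_def by (simp add: topology_inverse')
qed

lemma topspace_proj_topology: "topspace (proj_topology n) = proj_space n"
proof -
  have "{v \<in> cspace n - {0}. line v \<in> proj_space n} = cspace n - {0}"
    by (auto simp: proj_space_def)
  then have "openin (proj_topology n) (proj_space n)"
    by (simp add: openin_proj_topology)
  moreover have "topspace (proj_topology n) \<subseteq> proj_space n"
    using openin_topspace[of "proj_topology n"] unfolding openin_proj_topology by (rule conjunct1)
  ultimately show ?thesis
    by (simp add: openin_subset subset_antisym)
qed


section \<open>Homogeneous polynomials and the Zariski topology\<close>

text \<open>A monomial is the finitely supported map of its exponents.\<close>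

type_synonym cmpoly = "(nat \<Rightarrow>\<^sub>0 nat) \<Rightarrow>\<^sub>0 complex"

definition mpoly_eval :: "cmpoly \<Rightarrow> cvec \<Rightarrow> complex" where
  "mpoly_eval P v =
     (\<Sum>m\<in>Poly_Mapping.keys P. Poly_Mapping.lookup P m *
        (\<Prod>i\<in>Poly_Mapping.keys m. v i ^ Poly_Mapping.lookup m i))"

text \<open>Forms of degree d in the variables \<open>0, \<dots>, n\<close>; the zero polynomial has every degree.\<close>

definition hom_poly :: "nat \<Rightarrow> nat \<Rightarrow> cmpoly \<Rightarrow> bool" where
  "hom_poly n d P \<longleftrightarrow>
     (\<forall>m\<in>Poly_Mapping.keys P. Poly_Mapping.keys m \<subseteq> {..n} \<and>
        (\<Sum>i\<in>Poly_Mapping.keys m. Poly_Mapping.lookup m i) = d)"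

definition real_hom_poly :: "nat \<Rightarrow> nat \<Rightarrow> cmpoly \<Rightarrow> bool" where
  "real_hom_poly n d P \<longleftrightarrow> hom_poly n d P \<and> (\<forall>m. Poly_Mapping.lookup P m \<in> \<real>)"

definition vanishes_at :: "cmpoly \<Rightarrow> cpoint \<Rightarrow> bool" where
  "vanishes_at P p \<longleftrightarrow> (\<forall>v\<in>p. mpoly_eval P v = 0)"

definition zero_locus :: "nat \<Rightarrow> cmpoly set \<Rightarrow> cpoint set" where
  "zero_locus n S = {p \<in> proj_space n. \<forall>P\<in>S. vanishes_at P p}"

definition zariski_closed :: "nat \<Rightarrow> cpoint set \<Rightarrow> bool" where
  "zariski_closed n Z \<longleftrightarrow> (\<exists>S. (\<forall>P\<in>S. \<exists>d. hom_poly n d P) \<and> Z = zero_locus n S)"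

text \<open>Closed sets defined by real equations: the projective varieties over the reals,
  given by their sets of complex points.\<close>

definition real_zariski_closed :: "nat \<Rightarrow> cpoint set \<Rightarrow> bool" where
  "real_zariski_closed n Z \<longleftrightarrow>
     (\<exists>S. (\<forall>P\<in>S. \<exists>d. real_hom_poly n d P) \<and> Z = zero_locus n S)"

definition irreducible_closed :: "nat \<Rightarrow> cpoint set \<Rightarrow> bool" where
  "irreducible_closed n Z \<longleftrightarrow> zariski_closed n Z \<and> Z \<noteq> {} \<and>
     (\<forall>A B. zariski_closed n A \<longrightarrow> zariski_closed n B \<longrightarrow> Z \<subseteq> A \<union> B \<longrightarrow> Z \<subseteq> A \<or> Z \<subseteq> B)"

text \<open>Krull dimension (only used for non-empty closed sets).\<close>

definition zariski_dim :: "nat \<Rightarrow> cpoint set \<Rightarrow> enat" where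
  "zariski_dim n Z = (SUP k \<in> {k. \<exists>c :: nat \<Rightarrow> cpoint set.
     (\<forall>i\<le>k. irreducible_closed n (c i) \<and> c i \<subseteq> Z) \<and> (\<forall>i<k. c i \<subset> c (Suc i))}. enat k)"

definition mpoly_partial :: "nat \<Rightarrow> cmpoly \<Rightarrow> cvec \<Rightarrow> complex" where
  "mpoly_partial i P v = deriv (\<lambda>t. mpoly_eval P (v(i := t))) (v i)"

text \<open>
  The tangent space at \<open>v\<close> of the affine cone over \<open>Z\<close>, i.e. the kernel of the Jacobian of all
  forms in the homogeneous ideal of \<open>Z\<close>.
\<close>

definition cone_tangent_space :: "nat \<Rightarrow> cpoint set \<Rightarrow> cvec \<Rightarrow> cvec set" where
  "cone_tangent_space n Z v = {w \<in> cspace n. \<forall>P d. hom_poly n d P \<longrightarrow>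
     (\<forall>p\<in>Z. vanishes_at P p) \<longrightarrow> (\<Sum>i\<le>n. mpoly_partial i P v * w i) = 0}"


section \<open>Real curves\<close>

text \<open>
  A curve is given by its complex points in some projective space.  Irreducibility is over the
  complex numbers, hence geometric.  The cone over a curve is two-dimensional, so the Jacobian
  criterion for non-singularity asks for two-dimensional tangent spaces of the cone.
\<close>

definition real_curve :: "nat \<Rightarrow> cpoint set \<Rightarrow> bool" where
  "real_curve n X \<longleftrightarrow>
     real_zariski_closed n X \<and> irreducible_closed n X \<and> zariski_dim n X = 1 \<and>
     (\<forall>p\<in>X. \<forall>v\<in>p - {0}. cvec.dim (cone_tangent_space n X v) = 2)"

definition real_points :: "nat \<Rightarrow> cpoint set \<Rightarrow> cpoint set" where
  "real_points n X = X \<inter> real_proj_space n"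

definition proj_components :: "nat \<Rightarrow> cpoint set \<Rightarrow> cpoint set set" where
  "proj_components n S = connected_components_of (subtopology (proj_topology n) S)"

definition dividing_type :: "nat \<Rightarrow> cpoint set \<Rightarrow> bool" where
  "dividing_type n X \<longleftrightarrow> card (proj_components n (X - real_points n X)) = 2"


section \<open>Morphisms over the reals\<close>

definition nonvanishing :: "nat \<Rightarrow> (nat \<Rightarrow> cmpoly) \<Rightarrow> cpoint \<Rightarrow> bool" where
  "nonvanishing m F p \<longleftrightarrow> (\<exists>i\<le>m. \<not> vanishes_at (F i) p)"

text \<open>
  Near every point, \<open>f\<close> is given by real forms of equal degree.  The neighbourhood may be taken to
  be the set where the forms do not all vanish: multiply them by a form that vanishes outside a
  smaller neighbourhood.  Only the values of \<open>f\<close> on \<open>X\<close> matter.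
\<close>

definition real_morphism ::
  "nat \<Rightarrow> cpoint set \<Rightarrow> nat \<Rightarrow> (cpoint \<Rightarrow> cpoint) \<Rightarrow> bool" where
  "real_morphism n X m f \<longleftrightarrow>
     (\<forall>p\<in>X. \<exists>d F. (\<forall>i\<le>m. real_hom_poly n d (F i)) \<and> nonvanishing m F p \<and>
        (\<forall>q\<in>X. nonvanishing m F q \<longrightarrow>
          (\<forall>v\<in>q - {0}. f q = line (\<lambda>i. if i \<le> m then mpoly_eval (F i) v else 0))))"

text \<open>An isomorphism onto a closed subvariety.\<close>

definition real_embedding ::
  "nat \<Rightarrow> cpoint set \<Rightarrow> nat \<Rightarrow> (cpoint \<Rightarrow> cpoint) \<Rightarrow> bool" where
  "real_embedding n X m \<phi> \<longleftrightarrow>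
     real_morphism n X m \<phi> \<and> real_zariski_closed m (\<phi> ` X) \<and>
     (\<exists>\<psi>. real_morphism m (\<phi> ` X) n \<psi> \<and> (\<forall>p\<in>X. \<psi> (\<phi> p) = p))"

definition lin_form :: "nat \<Rightarrow> (nat \<Rightarrow> real) \<Rightarrow> cvec \<Rightarrow> complex" where
  "lin_form m a v = (\<Sum>i\<le>m. of_real (a i) * v i)"

definition lin_indep_forms :: "nat \<Rightarrow> (nat \<Rightarrow> real) \<Rightarrow> (nat \<Rightarrow> real) \<Rightarrow> bool" where
  "lin_indep_forms m a b \<longleftrightarrow>
     (\<forall>s t :: real. (\<forall>i\<le>m. s * a i + t * b i = 0) \<longrightarrow> s = 0 \<and> t = 0)"

text \<open>For independent \<open>a\<close> and \<open>b\<close>, a linear subspace of codimension two (empty if \<open>m = 1\<close>).\<close>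

definition proj_center :: "nat \<Rightarrow> (nat \<Rightarrow> real) \<Rightarrow> (nat \<Rightarrow> real) \<Rightarrow> cpoint set" where
  "proj_center m a b = {p \<in> proj_space m. \<forall>v\<in>p. lin_form m a v = 0 \<and> lin_form m b v = 0}"

text \<open>The linear projection to the projective line; meaningful outside the center.\<close>

definition lin_projection ::
  "nat \<Rightarrow> (nat \<Rightarrow> real) \<Rightarrow> (nat \<Rightarrow> real) \<Rightarrow> cpoint \<Rightarrow> cpoint" where
  "lin_projection m a b p = (let v = (SOME v. v \<in> p - {0}) in
     line (\<lambda>i. if i = 0 then lin_form m a v else if i = 1 then lin_form m b v else 0))"


section \<open>Separating morphisms and the two semigroups\<close>

definition separating :: "nat \<Rightarrow> cpoint set \<Rightarrow> (cpoint \<Rightarrow> cpoint) \<Rightarrow> bool" where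
  "separating n X f \<longleftrightarrow> real_morphism n X 1 f \<and>
     {p \<in> X. f p \<in> real_proj_space 1} = real_points n X"

text \<open>The number of sheets over the real projective line of the restriction of \<open>f\<close> to \<open>C\<close>.\<close>

definition sheet_number :: "cpoint set \<Rightarrow> (cpoint \<Rightarrow> cpoint) \<Rightarrow> nat" where
  "sheet_number C f =
     (THE k. \<forall>t\<in>real_proj_space 1. finite {p \<in> C. f p = t} \<and> card {p \<in> C. f p = t} = k)"

text \<open>
  \<open>C 1, \<dots>, C r\<close> are the components of the real points; r-tuples are extensional functions on
  \<open>{1..r}\<close>.
\<close>

definition degree_tuple ::
  "nat \<Rightarrow> (nat \<Rightarrow> cpoint set) \<Rightarrow> (cpoint \<Rightarrow> cpoint) \<Rightarrow> nat \<Rightarrow> nat" where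
  "degree_tuple r C f = (\<lambda>i\<in>{1..r}. sheet_number (C i) f)"

definition Sep ::
  "nat \<Rightarrow> cpoint set \<Rightarrow> nat \<Rightarrow> (nat \<Rightarrow> cpoint set) \<Rightarrow> (nat \<Rightarrow> nat) set" where
  "Sep n X r C = {degree_tuple r C f | f. separating n X f}"

definition Hyp ::
  "nat \<Rightarrow> cpoint set \<Rightarrow> nat \<Rightarrow> (nat \<Rightarrow> cpoint set) \<Rightarrow> (nat \<Rightarrow> nat) set" where
  "Hyp n X r C = {d \<in> Sep n X r C. \<exists>f. separating n X f \<and> d = degree_tuple r C f \<and>
     (\<exists>m \<phi> a b. real_embedding n X m \<phi> \<and> lin_indep_forms m a b \<and>
        proj_center m a b \<inter> \<phi> ` X = {} \<and> (\<forall>p\<in>X. f p = lin_projection m a b (\<phi> p)))}"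

definition pos_tuples :: "nat \<Rightarrow> (nat \<Rightarrow> nat) set" where
  "pos_tuples r = {1..r} \<rightarrow>\<^sub>E {k. 0 < k}"

definition is_subsemigroup :: "nat \<Rightarrow> (nat \<Rightarrow> nat) set \<Rightarrow> bool" where
  "is_subsemigroup r S \<longleftrightarrow>
     S \<subseteq> pos_tuples r \<and> (\<forall>d\<in>S. \<forall>e\<in>S. (\<lambda>i\<in>{1..r}. d i + e i) \<in> S)"

end

(* A separating morphism f is unramified over the real points: at a real point a local
   parameter turns f into a holomorphic function that is real exactly on the real axis, and
   such a function has a simple zero. So the fibres over the real projective line form a
   finite covering of each component. If X is dividing, the sign of the imaginary part of f
   is constant on each half of the complement of the real points and complex conjugation
   exchanges the halves; hence two separating morphisms f and g have equal or opposite signs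
   everywhere. After a real Moebius transformation of g the signs agree and f and g have no
   common pole. Then f + g is separating, and its poles are those of f together with those of
   g, so the degrees add. If f is a linear projection of an embedding phi, then f + g is a
   linear projection of the Segre embedding given by phi and g. *)

theory Submission
  imports Defs "HOL-Complex_Analysis.Complex_Analysis"
begin

text \<open>The delicate point is the local parameter. A curve is given only as a Zariski closed set
  whose cone has two-dimensional tangent spaces, so the analysis has to be built from algebra:
  polynomials vanishing on the cone are chosen whose Jacobian at the point is the identity, and
  Newton's iteration solves them by a holomorphic arc. These equations may cut out more than
  \<open>X\<close>, so it has to be proved that the arc lies on \<open>X\<close>: a polynomial
  vanishing on \<open>X\<close> but not on the arc would, after division by its order along the arc,
  force the local parameter to be constant on the irreducible \<open>X\<close>, leaving a single
  point, which has dimension 0. As the fibres over real points are unramified, a degree is a number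
  of poles, and adding degrees is counting a disjoint union. Common poles can be avoided because
  \<open>f\<close> has only finitely many poles, all of them real. They are also the only points
  where the homogeneous formula for a sum breaks down, and where the linear projection of the Segre
  embedding would meet its center.\<close>

declare cvec.scale_scale [simp del]

section \<open>Forms as functions\<close>

text \<open>Forms are kept as functions built from constants, variables, sums and products, so that
  closure properties and homogeneity follow by induction. The set \<open>K\<close> of admissible
  constants is \<open>UNIV\<close> for complex forms and \<open>\<real>\<close> for real
  ones.\<close>

inductive hform :: "complex set \<Rightarrow> nat \<Rightarrow> nat \<Rightarrow> (cvec \<Rightarrow> complex) \<Rightarrow> bool" for K n where
  hform_const: "c \<in> K \<Longrightarrow> hform K n 0 (\<lambda>_. c)"
| hform_var: "i \<le> n \<Longrightarrow> hform K n 1 (\<lambda>v. v i)"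
| hform_add: "hform K n d f \<Longrightarrow> hform K n d g \<Longrightarrow> hform K n d (\<lambda>v. f v + g v)"
| hform_mult: "hform K n d f \<Longrightarrow> hform K n e g \<Longrightarrow> hform K n (d + e) (\<lambda>v. f v * g v)"

definition coeff_ring :: "complex set \<Rightarrow> bool" where
  "coeff_ring K \<longleftrightarrow> 0 \<in> K \<and> 1 \<in> K \<and> -1 \<in> K \<and> (\<forall>x\<in>K. \<forall>y\<in>K. x + y \<in> K \<and> x * y \<in> K)"

lemma coeff_ring_UNIV [simp]: "coeff_ring UNIV" and coeff_ring_Reals [simp]: "coeff_ring \<real>"
  by (auto simp: coeff_ring_def)

lemma coeff_ring_sum: "coeff_ring K \<Longrightarrow> (\<And>x. x \<in> A \<Longrightarrow> f x \<in> K) \<Longrightarrow> sum f A \<in> K"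
  by (induction A rule: infinite_finite_induct) (auto simp: coeff_ring_def)

lemma hform_scaleI: "c \<in> K \<Longrightarrow> hform K n d f \<Longrightarrow> hform K n d (\<lambda>v. c * f v)"
  using hform_mult[OF hform_const, of c K n d f] by simp

lemma hform_diff:
  assumes "coeff_ring K" "hform K n d f" "hform K n d g"
  shows "hform K n d (\<lambda>v. f v - g v)"
proof -
  have "hform K n d (\<lambda>v. f v + (-1) * g v)"
    using assms by (intro hform_add hform_scaleI) (auto simp: coeff_ring_def)
  then show ?thesis by simp
qed

lemma hform_power: "coeff_ring K \<Longrightarrow> hform K n d f \<Longrightarrow> hform K n (k * d) (\<lambda>v. f v ^ k)"
proof (induction k)
  case 0
  then show ?case using hform_const[of 1 K n] by (auto simp: coeff_ring_def)
next
  case (Suc k)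
  then show ?case using hform_mult[of K n d f "k * d" "\<lambda>v. f v ^ k"] by simp
qed

text \<open>The zero form exists in every degree as \<open>0\<close> times the \<open>d\<close>-th
  power of the variable with index 0, which is available for every \<open>n\<close>.\<close>

lemma hform_zero: "coeff_ring K \<Longrightarrow> hform K n d (\<lambda>_. 0)"
  using hform_scaleI[OF _ hform_power[OF _ hform_var[of 0]], of 0 K n d] by (auto simp: coeff_ring_def)

lemma hform_sum:
  "coeff_ring K \<Longrightarrow> (\<And>x. x \<in> A \<Longrightarrow> hform K n d (f x)) \<Longrightarrow> hform K n d (\<lambda>v. \<Sum>x\<in>A. f x v)"
  by (induction A rule: infinite_finite_induct) (auto intro: hform_zero hform_add)

lemma hform_prod:
  assumes "coeff_ring K"
  shows "(\<And>x. x \<in> A \<Longrightarrow> hform K n (d x) (f x)) \<Longrightarrow> hform K n (sum d A) (\<lambda>v. \<Prod>x\<in>A. f x v)"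
  by (induction A rule: infinite_finite_induct)
     (use assms in \<open>auto intro: hform_mult intro!: hform_const simp: coeff_ring_def\<close>)

lemma hform_scale: "hform K n d f \<Longrightarrow> f (\<lambda>i. c * v i) = c ^ d * f v"
  by (induction rule: hform.induct) (auto simp: algebra_simps power_add)

lemma hform_cnj: "hform \<real> n d f \<Longrightarrow> f (\<lambda>i. cnj (v i)) = cnj (f v)"
  by (induction rule: hform.induct) (auto simp: Reals_cnj_iff)

lemma hform_continuous: "hform K n d f \<Longrightarrow> continuous_on UNIV f"
  by (induction rule: hform.induct) (auto intro!: continuous_intros)

text \<open>Coordinates beyond \<open>m\<close> are set to 0 because vectors of local forms and the
  columns of a Segre point have this shape.\<close>

lemma hform_subst:
  assumes "hform K m d f" "\<And>i. i \<le> m \<Longrightarrow> hform K n e (L i)" "coeff_ring K"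
  shows "hform K n (d * e) (\<lambda>v. f (\<lambda>i. if i \<le> m then L i v else 0))"
  using assms
proof (induction rule: hform.induct)
  case (hform_mult d f e' g)
  then show ?case using hform.hform_mult[of K n "d * e" _ "e' * e"] by (simp add: distrib_right)
qed (auto intro: hform.intros)

section \<open>Comparison with polynomials given by their coefficients\<close>

abbreviation monom_fun :: "(nat \<Rightarrow>\<^sub>0 nat) \<Rightarrow> cvec \<Rightarrow> complex" where
  "monom_fun m v \<equiv> (\<Prod>i\<in>Poly_Mapping.keys m. v i ^ Poly_Mapping.lookup m i)"

abbreviation monom_deg :: "(nat \<Rightarrow>\<^sub>0 nat) \<Rightarrow> nat" where
  "monom_deg m \<equiv> (\<Sum>i\<in>Poly_Mapping.keys m. Poly_Mapping.lookup m i)"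

lemma monom_fun_superset:
  "finite A \<Longrightarrow> Poly_Mapping.keys m \<subseteq> A \<Longrightarrow> monom_fun m v = (\<Prod>i\<in>A. v i ^ Poly_Mapping.lookup m i)"
  by (rule prod.mono_neutral_left) (auto simp: in_keys_iff)

lemma monom_deg_superset:
  "finite A \<Longrightarrow> Poly_Mapping.keys m \<subseteq> A \<Longrightarrow> monom_deg m = (\<Sum>i\<in>A. Poly_Mapping.lookup m i)"
  by (rule sum.mono_neutral_left) (auto simp: in_keys_iff)

lemma monom_fun_add: "monom_fun (m + m') v = monom_fun m v * monom_fun m' v"
proof -
  let ?A = "Poly_Mapping.keys m \<union> Poly_Mapping.keys m'"
  have "Poly_Mapping.keys (m + m') \<subseteq> ?A" by (rule keys_add)
  then show ?thesis
    using monom_fun_superset[of ?A "m + m'" v] monom_fun_superset[of ?A m v] monom_fun_superset[of ?A m' v]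
    by (simp add: lookup_add power_add prod.distrib)
qed

lemma monom_deg_add: "monom_deg (m + m') = monom_deg m + monom_deg m'"
proof -
  let ?A = "Poly_Mapping.keys m \<union> Poly_Mapping.keys m'"
  have "Poly_Mapping.keys (m + m') \<subseteq> ?A" by (rule keys_add)
  then show ?thesis
    using monom_deg_superset[of ?A "m + m'"] monom_deg_superset[of ?A m] monom_deg_superset[of ?A m']
    by (simp add: lookup_add sum.distrib)
qed

lemma mpoly_eval_superset:
  assumes "finite A" "Poly_Mapping.keys P \<subseteq> A"
  shows "mpoly_eval P v = (\<Sum>m\<in>A. Poly_Mapping.lookup P m * monom_fun m v)"
  unfolding mpoly_eval_def using assms by (intro sum.mono_neutral_left) (auto simp: in_keys_iff)

lemma mpoly_eval_add: "mpoly_eval (P + Q) v = mpoly_eval P v + mpoly_eval Q v"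
proof -
  let ?A = "Poly_Mapping.keys P \<union> Poly_Mapping.keys Q"
  have "Poly_Mapping.keys (P + Q) \<subseteq> ?A" by (rule keys_add)
  then show ?thesis
    using mpoly_eval_superset[of ?A "P + Q" v] mpoly_eval_superset[of ?A P v] mpoly_eval_superset[of ?A Q v]
    by (simp add: lookup_add algebra_simps sum.distrib)
qed

lemma mpoly_eval_zero: "mpoly_eval 0 v = 0"
  by (simp add: mpoly_eval_def)

lemma mpoly_eval_sum: "mpoly_eval (sum f A) v = (\<Sum>x\<in>A. mpoly_eval (f x) v)"
  by (induction A rule: infinite_finite_induct) (auto simp: mpoly_eval_add mpoly_eval_zero)

lemma mpoly_eval_single: "mpoly_eval (Poly_Mapping.single m c) v = c * monom_fun m v"
  by (cases "c = 0") (auto simp: mpoly_eval_def mpoly_eval_zero)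

lemma poly_mapping_sum_single: "P = (\<Sum>m\<in>Poly_Mapping.keys P. Poly_Mapping.single m (Poly_Mapping.lookup P m))"
proof (rule poly_mapping_eqI)
  fix k
  show "Poly_Mapping.lookup P k =
    Poly_Mapping.lookup (\<Sum>m\<in>Poly_Mapping.keys P. Poly_Mapping.single m (Poly_Mapping.lookup P m)) k"
    by (cases "k \<in> Poly_Mapping.keys P")
       (auto simp: lookup_sum lookup_single when_def in_keys_iff)
qed

text \<open>Expanding over pairs of monomials gives access to values and coefficients alike: a
  coefficient of \<open>P * Q\<close> is a sum of products of coefficients and therefore stays in
  \<open>K\<close>.\<close>

lemma mult_sum_single:
  fixes P Q :: cmpoly
  shows "P * Q = (\<Sum>m\<in>Poly_Mapping.keys P. \<Sum>m'\<in>Poly_Mapping.keys Q.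
     Poly_Mapping.single (m + m') (Poly_Mapping.lookup P m * Poly_Mapping.lookup Q m'))"
  by (subst poly_mapping_sum_single[of P], subst poly_mapping_sum_single[of Q])
     (simp add: sum_product mult_single)

lemma mpoly_eval_mult: "mpoly_eval (P * Q) v = mpoly_eval P v * mpoly_eval Q v"
proof -
  have "mpoly_eval (P * Q) v = (\<Sum>m\<in>Poly_Mapping.keys P. \<Sum>m'\<in>Poly_Mapping.keys Q.
     Poly_Mapping.lookup P m * Poly_Mapping.lookup Q m' * (monom_fun m v * monom_fun m' v))"
    unfolding mult_sum_single[of P Q] mpoly_eval_sum mpoly_eval_single monom_fun_add ..
  then show ?thesis
    unfolding mpoly_eval_def[of P] mpoly_eval_def[of Q] sum_product by (simp add: mult_ac)
qed

lemma hform_imp_hom_poly: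
  assumes "hform K n d f" "coeff_ring K"
  shows "\<exists>P. hom_poly n d P \<and> (\<forall>m. Poly_Mapping.lookup P m \<in> K) \<and> mpoly_eval P = f"
  using assms
proof (induction rule: hform.induct)
  case (hform_const c)
  then show ?case
    by (intro exI[of _ "Poly_Mapping.single 0 c"])
       (auto simp: hom_poly_def mpoly_eval_single lookup_single when_def coeff_ring_def split: if_splits)
next
  case (hform_var i)
  then show ?case
    by (intro exI[of _ "Poly_Mapping.single (Poly_Mapping.single i 1) 1"])
       (auto simp: hom_poly_def mpoly_eval_single lookup_single when_def coeff_ring_def)
next
  case (hform_add d f g)
  then obtain P Q where P: "hom_poly n d P" "\<forall>m. Poly_Mapping.lookup P m \<in> K" "mpoly_eval P = f"
    and Q: "hom_poly n d Q" "\<forall>m. Poly_Mapping.lookup Q m \<in> K" "mpoly_eval Q = g" by blast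
  have "hom_poly n d (P + Q)"
    using P(1) Q(1) keys_add[of P Q] unfolding hom_poly_def by blast
  then show ?case
    using P Q hform_add.prems
    by (intro exI[of _ "P + Q"]) (auto simp: fun_eq_iff mpoly_eval_add lookup_add coeff_ring_def)
next
  case (hform_mult d f e g)
  then obtain P Q where P: "hom_poly n d P" "\<forall>m. Poly_Mapping.lookup P m \<in> K" "mpoly_eval P = f"
    and Q: "hom_poly n e Q" "\<forall>m. Poly_Mapping.lookup Q m \<in> K" "mpoly_eval Q = g" by blast
  have "Poly_Mapping.keys m \<subseteq> {..n} \<and> monom_deg m = d + e" if m: "m \<in> Poly_Mapping.keys (P * Q)" for m
  proof -
    obtain a b where ab: "m = a + b" "a \<in> Poly_Mapping.keys P" "b \<in> Poly_Mapping.keys Q"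
      using m keys_mult[of P Q] by blast
    then show ?thesis
      using P(1) Q(1) monom_deg_add[of a b] keys_add[of a b] unfolding hom_poly_def by fastforce
  qed
  moreover have "Poly_Mapping.lookup (P * Q) m \<in> K" for m
    using P(2) Q(2) hform_mult.prems
    by (subst mult_sum_single)
       (auto simp: lookup_sum lookup_single when_def coeff_ring_def intro!: coeff_ring_sum[OF hform_mult.prems])
  ultimately show ?case
    using P(3) Q(3) by (intro exI[of _ "P * Q"]) (auto simp: fun_eq_iff mpoly_eval_mult hom_poly_def)
qed

lemma hom_poly_imp_hform:
  assumes "hom_poly n d P" "\<forall>m. Poly_Mapping.lookup P m \<in> K" "coeff_ring K"
  shows "hform K n d (mpoly_eval P)"
proof -
  have "hform K n d (\<lambda>v. Poly_Mapping.lookup P m * monom_fun m v)" if m: "m \<in> Poly_Mapping.keys P" for m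
  proof -
    have "hform K n (monom_deg m) (monom_fun m)"
      using m assms(1) hform_power[OF assms(3) hform_var]
      by (intro hform_prod[OF assms(3)]) (auto simp: hom_poly_def subset_iff)
    moreover have "monom_deg m = d"
      using m assms(1) by (auto simp: hom_poly_def)
    ultimately show ?thesis
      using assms by (intro hform_scaleI) auto
  qed
  then have "hform K n d (\<lambda>v. \<Sum>m\<in>Poly_Mapping.keys P. Poly_Mapping.lookup P m * monom_fun m v)"
    by (intro hform_sum[OF assms(3)])
  then show ?thesis
    by (simp add: mpoly_eval_def[abs_def])
qed

lemma hform_iff_hom_poly: "hform UNIV n d f \<longleftrightarrow> (\<exists>P. hom_poly n d P \<and> mpoly_eval P = f)"
  using hform_imp_hom_poly[of UNIV n d f] hom_poly_imp_hform[of n d _ UNIV] by auto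

lemma hform_iff_real_hom_poly: "hform \<real> n d f \<longleftrightarrow> (\<exists>P. real_hom_poly n d P \<and> mpoly_eval P = f)"
  using hform_imp_hom_poly[of \<real> n d f] hom_poly_imp_hform[of n d _ \<real>]
  by (auto simp: real_hom_poly_def)

section \<open>Points and cones\<close>

lemma line_eq_range: "line v = range (\<lambda>c i. c * v i)"
  unfolding line_def by (simp add: cvec.span_singleton)

lemma self_in_line [simp]: "v \<in> line v"
  unfolding line_def by (simp add: cvec.span_base)

lemma in_line_iff:
  "w \<noteq> 0 \<Longrightarrow> w \<in> line v \<longleftrightarrow> (\<exists>c. c \<noteq> 0 \<and> w = (\<lambda>i. c * v i))"
  by (auto simp: line_eq_range fun_eq_iff)

lemma in_line: "w \<in> line v \<longleftrightarrow> (\<exists>c. w = (\<lambda>i. c * v i))"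
  by (auto simp: line_eq_range)

lemma line_scale: assumes "c \<noteq> 0" shows "line (\<lambda>i. c * v i) = line v"
proof -
  have sub: "line (\<lambda>i. c * v i) \<subseteq> line v" for c v
  proof
    fix w assume "w \<in> line (\<lambda>i. c * v i)"
    then obtain a where "w = (\<lambda>i. a * (c * v i))" unfolding in_line by (elim exE)
    then have "w = (\<lambda>i. (a * c) * v i)" by (simp only: mult.assoc)
    then show "w \<in> line v" unfolding in_line by (rule exI)
  qed
  have "line v = line (\<lambda>i. (1 / c) * (c * v i))" using assms by simp
  also have "\<dots> \<subseteq> line (\<lambda>i. c * v i)" by (rule sub)
  finally show ?thesis using sub by (rule subset_antisym[rotated])
qed

lemma line_eqD: "w \<in> line v \<Longrightarrow> w \<noteq> 0 \<Longrightarrow> line w = line v"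
  using in_line_iff[of w v] line_scale[of _ v] by auto

lemma line_eq_iff:
  assumes "v \<noteq> 0" "w \<noteq> 0"
  shows "line v = line w \<longleftrightarrow> (\<exists>c. c \<noteq> 0 \<and> w = (\<lambda>i. c * v i))"
proof
  assume "line v = line w"
  then show "\<exists>c. c \<noteq> 0 \<and> w = (\<lambda>i. c * v i)"
    using in_line_iff[OF assms(2), of v] self_in_line[of w] by simp
qed (auto simp: line_scale)

lemma scale_nonzero: "c \<noteq> 0 \<Longrightarrow> v \<noteq> 0 \<Longrightarrow> (\<lambda>i. (c::complex) * v i) \<noteq> 0"
  by (auto simp: fun_eq_iff)

lemma cspace_scale: "v \<in> cspace n \<Longrightarrow> (\<lambda>i. c * v i) \<in> cspace n"
  by (auto simp: cspace_def)

text \<open>The cone over \<open>X\<close> without its vertex. Forms are functions of vectors, so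
  statements about points are proved for representatives in this set and transferred by
  homogeneity.\<close>

definition cone_pts :: "nat \<Rightarrow> cpoint set \<Rightarrow> cvec set" where
  "cone_pts n X = {v \<in> cspace n - {0}. line v \<in> X}"

lemma cone_scale: "v \<in> cone_pts n X \<Longrightarrow> c \<noteq> 0 \<Longrightarrow> (\<lambda>i. c * v i) \<in> cone_pts n X"
  by (auto simp: cone_pts_def line_scale cspace_scale fun_eq_iff)

lemma cone_nonzero: "v \<in> cone_pts n X \<Longrightarrow> v \<noteq> 0"
  by (auto simp: cone_pts_def)

lemma cone_line: "v \<in> cone_pts n X \<Longrightarrow> line v \<in> X"
  by (auto simp: cone_pts_def)

lemma cone_cspace: "v \<in> cone_pts n X \<Longrightarrow> v \<in> cspace n"
  by (auto simp: cone_pts_def)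

lemma exists_nonzero_coord: "v \<in> cspace n \<Longrightarrow> v \<noteq> 0 \<Longrightarrow> \<exists>i\<le>n. v i \<noteq> 0"
  by (auto simp: cspace_def fun_eq_iff) (metis not_le)

lemma in_points_cone: "X \<subseteq> proj_space n \<Longrightarrow> p \<in> X \<Longrightarrow> \<exists>v\<in>cone_pts n X. p = line v"
  by (auto simp: proj_space_def cone_pts_def)

lemma cone_of_point:
  assumes "X \<subseteq> proj_space n" "p \<in> X" "v \<in> p - {0}"
  shows "v \<in> cone_pts n X \<and> line v = p"
proof -
  obtain w where w: "w \<in> cone_pts n X" "p = line w"
    using in_points_cone assms by blast
  then obtain c where "c \<noteq> 0" "v = (\<lambda>i. c * w i)"
    using assms in_line_iff[of v w] by auto
  then show ?thesis
    using w cone_scale[OF w(1)] line_scale by auto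
qed

text \<open>Rescaling a vector multiplies the value by a power of the factor, so one representative
  decides.\<close>

lemma vanishes_at_line:
  assumes "hform K n d (mpoly_eval P)"
  shows "vanishes_at P (line v) \<longleftrightarrow> mpoly_eval P v = 0"
proof
  assume "vanishes_at P (line v)"
  then show "mpoly_eval P v = 0" by (simp add: vanishes_at_def)
next
  assume "mpoly_eval P v = 0"
  then show "vanishes_at P (line v)"
    using hform_scale[OF assms] by (auto simp: vanishes_at_def line_eq_range)
qed

definition form_locus :: "nat \<Rightarrow> (cvec \<Rightarrow> complex) set \<Rightarrow> cpoint set" where
  "form_locus n S = line ` {v \<in> cspace n - {0}. \<forall>g\<in>S. g v = 0}"

lemma form_locus_subset: "form_locus n S \<subseteq> proj_space n"
  by (auto simp: form_locus_def proj_space_def)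

lemma line_in_form_locus:
  assumes "\<forall>g\<in>S. \<exists>K d. hform K n d g" "v \<in> cspace n" "v \<noteq> 0"
  shows "line v \<in> form_locus n S \<longleftrightarrow> (\<forall>g\<in>S. g v = 0)"
proof
  assume "line v \<in> form_locus n S"
  then obtain w where w: "line v = line w" "w \<in> cspace n - {0}" "\<forall>g\<in>S. g w = 0"
    by (auto simp: form_locus_def)
  then obtain c where "v = (\<lambda>i. c * w i)"
    using line_eq_iff[of w v] assms by auto
  then show "\<forall>g\<in>S. g v = 0"
    using w(3) assms(1) hform_scale by fastforce
qed (use assms in \<open>auto simp: form_locus_def\<close>)

lemma zero_locus_eq_form_locus:
  assumes "\<forall>P\<in>S. \<exists>K d. hform K n d (mpoly_eval P)"
  shows "zero_locus n S = form_locus n (mpoly_eval ` S)"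
proof -
  have "vanishes_at P (line v) \<longleftrightarrow> mpoly_eval P v = 0" if "P \<in> S" for P v
    using assms that vanishes_at_line by blast
  then show ?thesis
    by (auto simp: zero_locus_def form_locus_def proj_space_def)
qed

lemma real_zariski_closed_iff:
  "real_zariski_closed n X \<longleftrightarrow> (\<exists>S. (\<forall>g\<in>S. \<exists>d. hform \<real> n d g) \<and> X = form_locus n S)"
proof
  assume "real_zariski_closed n X"
  then obtain S where S: "\<forall>P\<in>S. \<exists>d. real_hom_poly n d P" "X = zero_locus n S"
    by (auto simp: real_zariski_closed_def)
  then have "\<forall>g\<in>mpoly_eval ` S. \<exists>d. hform \<real> n d g"
    using hform_iff_real_hom_poly by blast
  then show "\<exists>S. (\<forall>g\<in>S. \<exists>d. hform \<real> n d g) \<and> X = form_locus n S"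
    using S zero_locus_eq_form_locus[of S n] by blast
next
  assume "\<exists>S. (\<forall>g\<in>S. \<exists>d. hform \<real> n d g) \<and> X = form_locus n S"
  then obtain S where S: "\<forall>g\<in>S. \<exists>d. hform \<real> n d g" "X = form_locus n S" by blast
  define T where "T = {P. (\<exists>d. real_hom_poly n d P) \<and> mpoly_eval P \<in> S}"
  have "mpoly_eval ` T = S"
    using S(1) hform_iff_real_hom_poly by (force simp: T_def)
  moreover have "\<forall>P\<in>T. \<exists>K d. hform K n d (mpoly_eval P)"
    using S(1) unfolding T_def by blast
  ultimately show "real_zariski_closed n X"
    unfolding real_zariski_closed_def S(2)
    using zero_locus_eq_form_locus[of T n] by (intro exI[of _ T]) (auto simp: T_def)
qed

lemma zariski_closed_form_locus:
  assumes "\<forall>g\<in>S. \<exists>d. hform UNIV n d g" shows "zariski_closed n (form_locus n S)"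
proof -
  define T where "T = {P. (\<exists>d. hom_poly n d P) \<and> mpoly_eval P \<in> S}"
  have "mpoly_eval ` T = S"
    using assms hform_iff_hom_poly by (force simp: T_def)
  moreover have "\<forall>P\<in>T. \<exists>K d. hform K n d (mpoly_eval P)"
    using assms unfolding T_def by blast
  ultimately show ?thesis
    unfolding zariski_closed_def
    using zero_locus_eq_form_locus[of T n] by (intro exI[of _ T]) (auto simp: T_def)
qed

section \<open>Morphisms in homogeneous coordinates\<close>

abbreviation vec_upto :: "nat \<Rightarrow> (nat \<Rightarrow> cvec \<Rightarrow> complex) \<Rightarrow> cvec \<Rightarrow> cvec" where
  "vec_upto m F v \<equiv> (\<lambda>i. if i \<le> m then F i v else 0)"

text \<open>One local description from \<open>real_morphism\<close>, read on the cone. Where all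
  forms vanish nothing is claimed, so the same forms may be used on the whole of
  \<open>X\<close>.\<close>

definition local_forms ::
  "nat \<Rightarrow> cpoint set \<Rightarrow> nat \<Rightarrow> (cpoint \<Rightarrow> cpoint) \<Rightarrow> nat \<Rightarrow> (nat \<Rightarrow> cvec \<Rightarrow> complex) \<Rightarrow> bool" where
  "local_forms n X m f d F \<longleftrightarrow> (\<forall>i\<le>m. hform \<real> n d (F i)) \<and>
     (\<forall>v\<in>cone_pts n X. (\<exists>i\<le>m. F i v \<noteq> 0) \<longrightarrow> f (line v) = line (vec_upto m F v))"

lemma real_morphism_iff:
  assumes X: "X \<subseteq> proj_space n"
  shows "real_morphism n X m f \<longleftrightarrow>
    (\<forall>v\<in>cone_pts n X. \<exists>d F. local_forms n X m f d F \<and> (\<exists>i\<le>m. F i v \<noteq> 0))"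
proof -
  have nv: "nonvanishing m F (line v) \<longleftrightarrow> (\<exists>i\<le>m. mpoly_eval (F i) v \<noteq> 0)"
    if "\<forall>i\<le>m. real_hom_poly n d (F i)" for F d v
  proof -
    have "vanishes_at (F i) (line v) \<longleftrightarrow> mpoly_eval (F i) v = 0" if i: "i \<le> m" for i
    proof (rule vanishes_at_line)
      show "hform \<real> n d (mpoly_eval (F i))"
        using \<open>\<forall>i\<le>m. real_hom_poly n d (F i)\<close> i hform_iff_real_hom_poly by blast
    qed
    then show ?thesis unfolding nonvanishing_def by blast
  qed
  show ?thesis
  proof
    assume L: "real_morphism n X m f"
    show "\<forall>v\<in>cone_pts n X. \<exists>d F. local_forms n X m f d F \<and> (\<exists>i\<le>m. F i v \<noteq> 0)"
    proof
      fix v assume v: "v \<in> cone_pts n X"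
      then obtain d F where F: "\<forall>i\<le>m. real_hom_poly n d (F i)" "nonvanishing m F (line v)"
        "\<forall>q\<in>X. nonvanishing m F q \<longrightarrow>
          (\<forall>v\<in>q - {0}. f q = line (\<lambda>i. if i \<le> m then mpoly_eval (F i) v else 0))"
        using L[unfolded real_morphism_def, THEN bspec, OF cone_line[OF v]] by (elim exE conjE)
      have "local_forms n X m f d (\<lambda>i. mpoly_eval (F i))"
        unfolding local_forms_def
      proof (intro conjI allI ballI impI)
        fix i assume "i \<le> m" then show "hform \<real> n d (mpoly_eval (F i))"
          using F(1) hform_iff_real_hom_poly by blast
      next
        fix w assume w: "w \<in> cone_pts n X" "\<exists>i\<le>m. mpoly_eval (F i) w \<noteq> 0"
        then have "nonvanishing m F (line w)" using nv[OF F(1)] by blast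
        moreover have "w \<in> line w - {0}" "line w \<in> X"
          using cone_nonzero[OF w(1)] cone_line[OF w(1)] self_in_line by blast+
        ultimately show "f (line w) = line (vec_upto m (\<lambda>i. mpoly_eval (F i)) w)"
          using F(3) by (elim ballE[of _ _ "line w"] impE ballE[of _ _ w]) auto
      qed
      then show "\<exists>d F. local_forms n X m f d F \<and> (\<exists>i\<le>m. F i v \<noteq> 0)"
        using F(2) nv[OF F(1)] by blast
    qed
  next
    assume R: "\<forall>v\<in>cone_pts n X. \<exists>d F. local_forms n X m f d F \<and> (\<exists>i\<le>m. F i v \<noteq> 0)"
    show "real_morphism n X m f"
      unfolding real_morphism_def
    proof
      fix p assume "p \<in> X"
      then obtain v where v: "v \<in> cone_pts n X" "p = line v" using in_points_cone[OF X] by blast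
      obtain d F where lF: "local_forms n X m f d F" and F2: "\<exists>i\<le>m. F i v \<noteq> 0"
        using R[THEN bspec, OF v(1)] by blast
      have F: "\<forall>i\<le>m. hform \<real> n d (F i)" "\<exists>i\<le>m. F i v \<noteq> 0"
        "\<forall>v\<in>cone_pts n X. (\<exists>i\<le>m. F i v \<noteq> 0) \<longrightarrow> f (line v) = line (vec_upto m F v)"
        using lF F2 unfolding local_forms_def by simp_all
      have "\<forall>i. \<exists>P. i \<le> m \<longrightarrow> real_hom_poly n d P \<and> mpoly_eval P = F i"
        using F(1) hform_iff_real_hom_poly by metis
      then obtain P where P: "\<And>i. i \<le> m \<Longrightarrow> real_hom_poly n d (P i) \<and> mpoly_eval (P i) = F i"
        by metis
      have rP: "\<forall>i\<le>m. real_hom_poly n d (P i)" using P by blast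
      show "\<exists>d F. (\<forall>i\<le>m. real_hom_poly n d (F i)) \<and> nonvanishing m F p \<and>
        (\<forall>q\<in>X. nonvanishing m F q \<longrightarrow>
          (\<forall>v\<in>q - {0}. f q = line (\<lambda>i. if i \<le> m then mpoly_eval (F i) v else 0)))"
      proof (intro exI conjI ballI impI)
        show "\<forall>i\<le>m. real_hom_poly n d (P i)" by (rule rP)
        show "nonvanishing m P p"
          using nv[OF rP] v F(2) P by metis
        fix q w assume q: "q \<in> X" "nonvanishing m P q" "w \<in> q - {0}"
        then have w: "w \<in> cone_pts n X" "line w = q" using cone_of_point[OF X] by auto
        then have "\<exists>i\<le>m. F i w \<noteq> 0" using nv[OF rP] q(2) P by metis
        then have "f q = line (vec_upto m F w)" using F(3) w by auto
        moreover have "vec_upto m F w = (\<lambda>i. if i \<le> m then mpoly_eval (P i) w else 0)"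
          using P by auto
        ultimately show "f q = line (\<lambda>i. if i \<le> m then mpoly_eval (P i) w else 0)" by simp
      qed
    qed
  qed
qed

section \<open>Polynomial functions and their difference quotients\<close>

text \<open>Homogeneity is lost in the affine chart \<open>x a = 1\<close> and in difference
  quotients with one argument fixed; this is the ring in which those computations take
  place.\<close>

inductive pfun :: "nat \<Rightarrow> (cvec \<Rightarrow> complex) \<Rightarrow> bool" for n where
  pfun_const: "pfun n (\<lambda>_. c)"
| pfun_var: "i \<le> n \<Longrightarrow> pfun n (\<lambda>v. v i)"
| pfun_add: "pfun n f \<Longrightarrow> pfun n g \<Longrightarrow> pfun n (\<lambda>v. f v + g v)"
| pfun_mult: "pfun n f \<Longrightarrow> pfun n g \<Longrightarrow> pfun n (\<lambda>v. f v * g v)"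

lemma hform_imp_pfun: "hform K n d f \<Longrightarrow> pfun n f"
  by (induction rule: hform.induct) (auto intro: pfun.intros)

lemma pfun_diff: assumes "pfun n f" "pfun n g" shows "pfun n (\<lambda>v. f v - g v)"
proof -
  have "pfun n (\<lambda>v. f v + (-1) * g v)" by (intro pfun.intros assms)
  then show ?thesis by simp
qed

lemma pfun_sum: "(\<And>x. x \<in> A \<Longrightarrow> pfun n (f x)) \<Longrightarrow> pfun n (\<lambda>v. \<Sum>x\<in>A. f x v)"
  by (induction A rule: infinite_finite_induct) (auto intro: pfun.intros)

lemma pfun_power: "pfun n f \<Longrightarrow> pfun n (\<lambda>v. f v ^ k)"
  by (induction k) (auto intro: pfun.intros)

lemma pfun_continuous: "pfun n f \<Longrightarrow> continuous_on UNIV f"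
  by (induction rule: pfun.induct) (auto intro!: continuous_intros)

lemma pfun_holomorphic:
  "pfun n f \<Longrightarrow> (\<And>j. (\<lambda>z. \<phi> z j) holomorphic_on S) \<Longrightarrow> (\<lambda>z. f (\<phi> z)) holomorphic_on S"
  by (induction rule: pfun.induct) (auto intro!: holomorphic_intros)

text \<open>Powers of \<open>x a\<close> equal 1 on the chart, so two summands are brought to a
  common degree by multiplying each with the power of \<open>x a\<close> given by the degree of the
  other.\<close>

lemma pfun_homogenize:
  assumes "pfun n f" "a \<le> n"
  shows "\<exists>d g. hform UNIV n d g \<and> (\<forall>x. x a = 1 \<longrightarrow> g x = f x)"
  using assms
proof (induction rule: pfun.induct)
  case (pfun_const c)
  then show ?case using hform_const[of c UNIV n] by blast
next
  case (pfun_var i)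
  then show ?case using hform_var[of i n UNIV] by blast
next
  case (pfun_add f f')
  then obtain d g d' g' where g: "hform UNIV n d g" "\<forall>x. x a = 1 \<longrightarrow> g x = f x"
    "hform UNIV n d' g'" "\<forall>x. x a = 1 \<longrightarrow> g' x = f' x" by blast
  have "hform UNIV n (d' * 1 + d) (\<lambda>x. x a ^ d' * g x + x a ^ d * g' x)"
    using hform_mult[OF hform_power[OF _ hform_var[OF assms(2), of UNIV], of d'] g(1)]
      hform_mult[OF hform_power[OF _ hform_var[OF assms(2), of UNIV], of d] g(3)]
    by (intro hform_add) (auto simp: add.commute)
  then show ?case
    using g(2,4) by (intro exI[of _ "d' * 1 + d"] exI[of _ "\<lambda>x. x a ^ d' * g x + x a ^ d * g' x"]) simp
next
  case (pfun_mult f f')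
  then obtain d g d' g' where g: "hform UNIV n d g" "\<forall>x. x a = 1 \<longrightarrow> g x = f x"
    "hform UNIV n d' g'" "\<forall>x. x a = 1 \<longrightarrow> g' x = f' x" by blast
  then show ?case
    by (intro exI[of _ "d + d'"] exI[of _ "\<lambda>x. g x * g' x"]) (auto intro: hform_mult)
qed

text \<open>The diagonal values \<open>c j v v\<close> are the partial derivatives of \<open>P\<close> at \<open>v\<close>.\<close>

definition diff_quot :: "nat \<Rightarrow> (cvec \<Rightarrow> complex) \<Rightarrow> (nat \<Rightarrow> cvec \<Rightarrow> cvec \<Rightarrow> complex) \<Rightarrow> bool" where
  "diff_quot n P c \<longleftrightarrow> (\<forall>x y. P x - P y = (\<Sum>j\<le>n. (x j - y j) * c j x y)) \<and>
     (\<forall>j. continuous_on UNIV (\<lambda>(x, y). c j x y)) \<and> (\<forall>j y. pfun n (\<lambda>x. c j x y))"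

lemma continuous_on_fst_pfun: "pfun n f \<Longrightarrow> continuous_on UNIV (\<lambda>z. f (fst z))"
  and continuous_on_snd_pfun: "pfun n f \<Longrightarrow> continuous_on UNIV (\<lambda>z. f (snd z))"
  using continuous_on_compose2[OF pfun_continuous _ subset_UNIV, of n f, OF _ continuous_on_fst[OF continuous_on_id]]
    continuous_on_compose2[OF pfun_continuous _ subset_UNIV, of n f, OF _ continuous_on_snd[OF continuous_on_id]]
  by auto

text \<open>By induction on the polynomial; for products this is the discrete Leibniz rule \<open>f
  x * g x - f y * g y = (f x - f y) * g x + f y * (g x - g y)\<close>.\<close>

lemma exists_diff_quot: "pfun n P \<Longrightarrow> \<exists>c. diff_quot n P c"
proof (induction rule: pfun.induct)
  case (pfun_const c)
  show ?case
    by (intro exI[of _ "\<lambda>_ _ _. 0"]) (auto simp: diff_quot_def intro: pfun.intros)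
next
  case (pfun_var i)
  have "(\<Sum>j\<le>n. (x j - y j) * (if j = i then 1 else 0)) = x i - y i" for x y :: cvec
    using pfun_var by (simp add: if_distrib cong: if_cong)
  then show ?case
    by (intro exI[of _ "\<lambda>j _ _. if j = i then 1 else 0"]) (auto simp: diff_quot_def intro: pfun.intros)
next
  case (pfun_add f g)
  then obtain c e where c: "diff_quot n f c" "diff_quot n g e" by blast
  have "f x + g x - (f y + g y) = (\<Sum>j\<le>n. (x j - y j) * (c j x y + e j x y))" for x y
    using c by (simp add: diff_quot_def distrib_left sum.distrib add_diff_add)
  then show ?case
    using c by (intro exI[of _ "\<lambda>j x y. c j x y + e j x y"])
      (auto simp: diff_quot_def case_prod_unfold intro: pfun.intros continuous_intros)
next
  case (pfun_mult f g)
  then obtain c e where c: "diff_quot n f c" "diff_quot n g e" by blast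
  have "f x * g x - f y * g y = (f x - f y) * g x + f y * (g x - g y)" for x y
    by (simp add: algebra_simps)
  also have "\<dots> x y = (\<Sum>j\<le>n. (x j - y j) * (c j x y * g x + f y * e j x y))" for x y
    using c by (simp add: diff_quot_def distrib_left sum.distrib sum_distrib_left sum_distrib_right mult_ac)
  finally show ?case
    using c pfun_mult
    by (intro exI[of _ "\<lambda>j x y. c j x y * g x + f y * e j x y"])
      (auto simp: diff_quot_def case_prod_unfold
        intro!: pfun.intros continuous_intros continuous_on_fst_pfun continuous_on_snd_pfun)
qed

lemma diff_quot_continuous:
  assumes "diff_quot n P c" "continuous_on S f" "continuous_on S g"
  shows "continuous_on S (\<lambda>z. c j (f z) (g z))"
proof -
  have "continuous_on UNIV (\<lambda>(x, y). c j x y)" using assms(1) by (simp add: diff_quot_def)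
  from continuous_on_compose2[OF this continuous_on_Pair[OF assms(2,3)]] show ?thesis by simp
qed

text \<open>Caratheodory's characterisation of the derivative: along the \<open>i\<close>-th
  coordinate line only one summand survives, and its coefficient is continuous.\<close>

lemma diff_quot_deriv:
  assumes c: "diff_quot n P c" and i: "i \<le> n"
  shows "deriv (\<lambda>t. P (v(i := t))) (v i) = c i v v"
proof (rule DERIV_imp_deriv, unfold CARAT_DERIV, intro exI conjI allI)
  fix t
  have "P (v(i := t)) - P v = (\<Sum>j\<le>n. ((v(i := t)) j - v j) * c j (v(i := t)) v)"
    using c by (simp only: diff_quot_def)
  also have "\<dots> = (\<Sum>j\<le>n. if j = i then (t - v i) * c i (v(i := t)) v else 0)"
    by (intro sum.cong) auto
  also have "\<dots> = c i (v(i := t)) v * (t - v i)"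
    using i by simp
  finally show "P (v(i := t)) - P (v(i := v i)) = c i (v(i := t)) v * (t - v i)"
    by simp
next
  have "continuous_on UNIV (\<lambda>t. v(i := t))"
  proof (rule continuous_on_coordinatewise_then_product)
    fix j show "continuous_on UNIV (\<lambda>t. (v(i := t)) j)" by (cases "j = i") auto
  qed
  then have "continuous_on UNIV (\<lambda>t. c i (v(i := t)) v)"
    by (intro diff_quot_continuous[OF c]) auto
  then show "isCont (\<lambda>t. c i (v(i := t)) v) (v i)"
    by (simp add: continuous_on_eq_continuous_at)
qed simp

text \<open>Euler's identity at a zero of \<open>g\<close>. Since \<open>g\<close> vanishes on the
  whole ray through \<open>v\<close>, the quotient \<open>H s\<close> is 0 for every
  \<open>s\<close> other than 1, and continuity extends this to \<open>s = 1\<close>.\<close>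

lemma diff_quot_euler:
  assumes c: "diff_quot n g c" and g: "hform K n d g" "g v = 0"
  shows "(\<Sum>j\<le>n. v j * c j v v) = 0"
proof -
  define H where "H s = (\<Sum>j\<le>n. v j * c j (\<lambda>i. s * v i) v)" for s
  have "H s = 0" if "s \<noteq> 1" for s
  proof -
    have "g (\<lambda>i. s * v i) - g v = (\<Sum>j\<le>n. (s * v j - v j) * c j (\<lambda>i. s * v i) v)"
      using c by (simp only: diff_quot_def)
    also have "\<dots> = (s - 1) * H s"
      unfolding H_def sum_distrib_left by (intro sum.cong) (auto simp: algebra_simps)
    finally show ?thesis using hform_scale[OF g(1), of s v] g(2) that by simp
  qed
  then have "(H \<longlongrightarrow> 0) (at 1)"
    by (intro tendsto_eventually) (simp add: eventually_at_filter)
  moreover have "continuous_on UNIV (\<lambda>s i. s * v i)"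
    by (intro continuous_on_coordinatewise_then_product continuous_intros)
  then have "continuous_on UNIV H"
    unfolding H_def by (intro continuous_intros diff_quot_continuous[OF c])
  then have "(H \<longlongrightarrow> H 1) (at 1)"
    by (simp add: continuous_on_eq_continuous_at isCont_def)
  ultimately have "H 1 = 0" using tendsto_unique[of "at (1::complex)"] by auto
  then show ?thesis by (simp add: H_def)
qed

section \<open>Linear algebra of tangent spaces\<close>

lemma sum_fun_apply: "(sum f A) x = (\<Sum>i\<in>A. f i x)"
  by (induction A rule: infinite_finite_induct) auto

text \<open>If \<open>\<xi>\<close> were outside \<open>L\<close>, some linear functional would be 1
  at \<open>\<xi>\<close> and 0 on \<open>L\<close>; on \<open>cspace n\<close> it is the dot
  product with a vector \<open>w\<close>, against the assumption. This is what turns vectors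
  orthogonal to a tangent space into gradients.\<close>

lemma double_annihilator:
  assumes L: "cvec.subspace L" "L \<subseteq> cspace n" and \<xi>: "\<xi> \<in> cspace n"
    and ann: "\<And>w. w \<in> cspace n \<Longrightarrow> (\<And>x. x \<in> L \<Longrightarrow> (\<Sum>i\<le>n. x i * w i) = 0) \<Longrightarrow> (\<Sum>i\<le>n. \<xi> i * w i) = 0"
  shows "\<xi> \<in> L"
proof (rule ccontr)
  assume "\<xi> \<notin> L"
  obtain B where B: "B \<subseteq> L" "cvec.independent B" "L \<subseteq> cvec.span B"
    using cvec.basis_exists[of L] by metis
  have "cvec.span B \<subseteq> L" using B(1) L(1) by (rule cvec.span_minimal)
  then have "\<xi> \<notin> cvec.span B" using \<open>\<xi> \<notin> L\<close> by blast
  then have ind: "cvec.independent (insert \<xi> B)" using B(2) by (rule cvec.independent_insertI)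
  interpret P: vector_space_pair "\<lambda>(c::complex) (v::cvec) i. c * v i" "\<lambda>(c::complex) (z::complex). c * z"
    by standard (auto simp: algebra_simps)
  obtain \<phi> where lin: "Vector_Spaces.linear (\<lambda>(c::complex) (v::cvec) i. c * v i) (*) \<phi>"
    and \<phi>: "\<forall>x\<in>insert \<xi> B. \<phi> x = (if x = \<xi> then 1 else 0)"
    using P.linear_independent_extend[OF ind, of "\<lambda>x. if x = \<xi> then 1 else 0"] by blast
  have "\<xi> \<notin> B" using B(1) \<open>\<xi> \<notin> L\<close> by blast
  then have "\<phi> x = 0" if "x \<in> B" for x using \<phi> that by auto
  then have zero: "\<phi> x = 0" if "x \<in> L" for x
    using P.linear_eq_0_on_span[OF lin, of B x] that B(3) by blast
  define e where "e i = (\<lambda>j. if j = i then 1 else 0 :: complex)" for i :: nat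
  define w where "w = (\<lambda>i. if i \<le> n then \<phi> (e i) else 0)"
  have \<phi>_eq: "\<phi> x = (\<Sum>i\<le>n. x i * w i)" if x: "x \<in> cspace n" for x
  proof -
    have "x = (\<Sum>i\<le>n. (\<lambda>j. x i * e i j))"
    proof
      fix j
      have "(\<Sum>i\<le>n. x i * e i j) = (\<Sum>i\<le>n. if i = j then x i else 0)"
        by (intro sum.cong) (auto simp: e_def)
      also have "\<dots> = x j" using x by (auto simp: cspace_def)
      finally show "x j = (\<Sum>i\<le>n. (\<lambda>j. x i * e i j)) j" by (simp only: sum_fun_apply)
    qed
    then have "\<phi> x = \<phi> (\<Sum>i\<le>n. (\<lambda>j. x i * e i j))" by (rule arg_cong)
    also have "\<dots> = (\<Sum>i\<le>n. \<phi> (\<lambda>j. x i * e i j))" by (rule P.linear_sum[OF lin])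
    also have "\<dots> = (\<Sum>i\<le>n. x i * \<phi> (e i))"
      using P.linear_scale[OF lin] by simp
    also have "\<dots> = (\<Sum>i\<le>n. x i * w i)"
      by (intro sum.cong) (auto simp: w_def)
    finally show ?thesis .
  qed
  have "w \<in> cspace n" by (auto simp: w_def cspace_def)
  then have "(\<Sum>i\<le>n. \<xi> i * w i) = 0"
    using ann zero \<phi>_eq L(2) by (metis subsetD)
  then show False using \<phi>_eq[OF \<xi>] \<phi> by simp
qed

text \<open>A second basis vector is normalised to have \<open>a\<close>-coordinate 0 and
  \<open>b\<close>-coordinate 1, so that the coordinates \<open>a\<close> and \<open>b\<close>
  determine a vector of the plane. In the chart where coordinate \<open>a\<close> is 1, coordinate
  \<open>b\<close> becomes the local parameter.\<close>

lemma plane_basis: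
  assumes dim: "cvec.dim W = 2" and W: "cvec.subspace W" "W \<subseteq> cspace n"
    and v: "v \<in> W" "v a = 1"
  obtains b w where "b \<le> n" "b \<noteq> a" "w \<in> W" "w a = 0" "w b = 1"
    "\<And>x i. x \<in> W \<Longrightarrow> x i = x a * v i + (x b - x a * v b) * w i"
proof -
  obtain B where B: "B \<subseteq> W" "cvec.independent B" "W \<subseteq> cvec.span B" "card B = 2"
    using cvec.basis_exists[of W] dim by metis
  then have "finite B" by (metis card.infinite zero_neq_numeral)
  have "v \<noteq> 0" using v(2) by auto
  then have indv: "cvec.independent {v}" by (simp add: cvec.dependent_single)
  have "\<exists>w\<in>B. w \<notin> cvec.span {v}"
  proof (rule ccontr)
    assume "\<not> ?thesis"
    then have "B \<subseteq> cvec.span {v}" by blast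
    from cvec.independent_span_bound[OF _ B(2) this] B(4) show False by simp
  qed
  then obtain w where w: "w \<in> W" "w \<notin> cvec.span {v}" using B(1) by blast
  have indw: "cvec.independent {w, v}" using w(2) indv by (rule cvec.independent_insertI)
  have "w \<noteq> v" using w(2) cvec.span_base[of v "{v}"] by auto
  have sp: "x \<in> cvec.span {w, v}" if x: "x \<in> W" for x
  proof (rule ccontr)
    assume "x \<notin> cvec.span {w, v}"
    then have "cvec.independent {x, w, v}" "x \<notin> {w, v}"
      using cvec.independent_insertI[OF _ indw] cvec.span_base[of x "{w, v}"] by auto
    moreover have "{x, w, v} \<subseteq> cvec.span B" using x w(1) v(1) B(3) by blast
    ultimately have "card {x, w, v} \<le> 2"
      using cvec.independent_span_bound[OF \<open>finite B\<close>] B(4) by metis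
    then show False using \<open>w \<noteq> v\<close> \<open>x \<notin> {w, v}\<close> by simp
  qed
  have sp2: "\<exists>s t. x = (\<lambda>i. s * v i + t * w i)" if xW: "x \<in> W" for x
  proof -
    obtain t where "x - (\<lambda>i. t * w i) \<in> cvec.span {v}"
      using sp[OF xW] unfolding cvec.span_insert[of w "{v}"] by blast
    then obtain s where "x - (\<lambda>i. t * w i) = (\<lambda>i. s * v i)"
      unfolding line_def[symmetric] in_line by blast
    then have "x i - t * w i = s * v i" for i by (metis minus_apply)
    then have "x i = s * v i + t * w i" for i by (simp add: diff_eq_eq)
    then show ?thesis by blast
  qed
  \<comment> \<open>Subtracting a multiple of \<open>v\<close> removes the
    \<open>a\<close>-coordinate; \<open>b\<close> will be any coordinate in which the remainder is
    nonzero.\<close>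
  define u where "u = w - (\<lambda>i. w a * v i)"
  have u: "u \<in> W" unfolding u_def
    using w(1) v(1) W(1) cvec.subspace_diff cvec.subspace_scale by blast
  have "u a = 0" using v(2) by (simp add: u_def)
  have "u \<noteq> 0"
  proof
    assume "u = 0"
    then have "w = (\<lambda>i. w a * v i)" by (simp add: u_def)
    then show False using w(2) unfolding line_def[symmetric] in_line by blast
  qed
  then obtain b where b: "b \<le> n" "u b \<noteq> 0"
    using exists_nonzero_coord[of u n] u W(2) by blast
  have "b \<noteq> a" using b(2) \<open>u a = 0\<close> by auto
  have "(\<lambda>i. (1 / u b) * u i) \<in> W"
    using u W(1) by (rule cvec.subspace_scale[rotated])
  moreover have "x i = x a * v i + (x b - x a * v b) * ((1 / u b) * u i)" if x: "x \<in> W" for x i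
  proof -
    obtain s t where st: "x = (\<lambda>i. s * v i + t * w i)" using sp2[OF x] by blast
    have xi: "x i = (s + t * w a) * v i + t * u i" for i
      unfolding st u_def by (simp add: algebra_simps)
    have xa: "x a = s + t * w a" using xi[of a] v(2) \<open>u a = 0\<close> by simp
    have "x b - x a * v b = t * u b" unfolding xi[of b] xa by simp
    then show ?thesis unfolding xi[of i] xa using b(2) by simp
  qed
  ultimately show thesis
    using that[OF b(1) \<open>b \<noteq> a\<close>, of "\<lambda>i. (1 / u b) * u i"] b(2) \<open>u a = 0\<close> by simp
qed

text \<open>Gaussian elimination without division for a system \<open>M y = t B\<close> whose matrix
  is the identity at \<open>v\<close>. The common denominator \<open>Q\<close> is 1 at
  \<open>v\<close>, hence a unit of the local ring there.\<close>

lemma elimination: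
  assumes "finite J"
    and "\<And>i. i \<in> J \<Longrightarrow> pfun n (B i)" "\<And>i j. i \<in> J \<Longrightarrow> j \<in> J \<Longrightarrow> pfun n (M i j)"
    and "\<And>i j. i \<in> J \<Longrightarrow> j \<in> J \<Longrightarrow> M i j v = (if i = j then 1 else 0)"
    and "\<And>i x. i \<in> J \<Longrightarrow> x \<in> Z \<Longrightarrow> (\<Sum>j\<in>J. M i j x * y j x) = t x * B i x"
  shows "\<exists>Q e. pfun n Q \<and> Q v = 1 \<and>
    (\<forall>j\<in>J. pfun n (e j) \<and> (\<forall>x\<in>Z. Q x * y j x = t x * e j x))"
  using assms
proof (induction J arbitrary: B M rule: finite_induct)
  case empty
  then show ?case by (intro exI[of _ "\<lambda>_. 1"]) (auto intro: pfun.intros)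
next
  case (insert k J)
  \<comment> \<open>Cross-multiplication with row \<open>k\<close> eliminates \<open>y k\<close>
    from the other rows. The off-diagonal entries vanish at \<open>v\<close>, so the reduced matrix
    is again the identity there.\<close>
  define B' where "B' i = (\<lambda>x. M k k x * B i x - M i k x * B k x)" for i
  define M' where "M' i j = (\<lambda>x. M k k x * M i j x - M i k x * M k j x)" for i j
  have "\<exists>Q e. pfun n Q \<and> Q v = 1 \<and>
    (\<forall>j\<in>J. pfun n (e j) \<and> (\<forall>x\<in>Z. Q x * y j x = t x * e j x))"
  proof (rule insert.IH[of B' M'])
    show "pfun n (B' i)" "\<And>j. j \<in> J \<Longrightarrow> pfun n (M' i j)" if "i \<in> J" for i
      using that insert.prems(1,2) unfolding B'_def M'_def by (auto intro!: pfun_diff pfun.intros)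
    show "M' i j v = (if i = j then 1 else 0)" if "i \<in> J" "j \<in> J" for i j
    proof -
      have "i \<noteq> k" using that insert.hyps by auto
      then show ?thesis using that insert.prems(3) by (simp add: M'_def)
    qed
    show "(\<Sum>j\<in>J. M' i j x * y j x) = t x * B' i x" if "i \<in> J" "x \<in> Z" for i x
    proof -
      have i: "M i k x * y k x + (\<Sum>j\<in>J. M i j x * y j x) = t x * B i x"
        and k: "M k k x * y k x + (\<Sum>j\<in>J. M k j x * y j x) = t x * B k x"
        using insert.prems(4)[of i x] insert.prems(4)[of k x] that insert.hyps by simp_all
      have "(\<Sum>j\<in>J. M' i j x * y j x) =
          M k k x * (\<Sum>j\<in>J. M i j x * y j x) - M i k x * (\<Sum>j\<in>J. M k j x * y j x)"
        unfolding M'_def sum_distrib_left sum_subtractf[symmetric]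
        by (intro sum.cong) (auto simp: algebra_simps)
      also have "\<dots> = M k k x * (t x * B i x - M i k x * y k x) - M i k x * (t x * B k x - M k k x * y k x)"
      proof -
        have "(\<Sum>j\<in>J. M i j x * y j x) = t x * B i x - M i k x * y k x"
          "(\<Sum>j\<in>J. M k j x * y j x) = t x * B k x - M k k x * y k x"
          using i k by (simp_all add: eq_diff_eq add.commute)
        then show ?thesis by simp
      qed
      also have "\<dots> = t x * B' i x" by (simp add: B'_def algebra_simps)
      finally show ?thesis .
    qed
  qed
  then obtain Q e where Q: "pfun n Q" "Q v = 1"
    and e: "\<And>j. j \<in> J \<Longrightarrow> pfun n (e j)" "\<And>j x. j \<in> J \<Longrightarrow> x \<in> Z \<Longrightarrow> Q x * y j x = t x * e j x"
    by blast
  \<comment> \<open>Back substitution into row \<open>k\<close>; the factor \<open>M k k\<close>,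
    also 1 at \<open>v\<close>, joins the denominator.\<close>
  define e' where "e' = (\<lambda>j x. if j = k then Q x * B k x - (\<Sum>i\<in>J. M k i x * e i x) else M k k x * e j x)"
  have "pfun n (e' j)" if "j \<in> insert k J" for j
    using that insert.prems(1,2) insert.hyps e(1) Q(1) unfolding e'_def
    by (cases "j = k") (auto intro!: pfun_diff pfun_sum pfun.intros)
  moreover have "(M k k x * Q x) * y j x = t x * e' j x" if "j \<in> insert k J" "x \<in> Z" for j x
  proof (cases "j = k")
    case True
    have k: "M k k x * y k x + (\<Sum>j\<in>J. M k j x * y j x) = t x * B k x"
      using insert.prems(4)[of k x] that insert.hyps by simp
    have "Q x * (\<Sum>j\<in>J. M k j x * y j x) = t x * (\<Sum>j\<in>J. M k j x * e j x)"
      unfolding sum_distrib_left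
    proof (rule sum.cong)
      fix i assume "i \<in> J"
      then have "M k i x * (Q x * y i x) = M k i x * (t x * e i x)" using e(2) that by simp
      then show "Q x * (M k i x * y i x) = t x * (M k i x * e i x)" by (simp add: mult_ac)
    qed simp
    then have "t x * (Q x * B k x - (\<Sum>i\<in>J. M k i x * e i x))
        = Q x * (t x * B k x) - Q x * (\<Sum>j\<in>J. M k j x * y j x)"
      by (simp add: algebra_simps)
    also have "\<dots> = Q x * (M k k x * y k x)" unfolding k[symmetric] by (simp add: algebra_simps)
    finally show ?thesis using True by (simp add: e'_def mult_ac)
  next
    case False
    then have "M k k x * (Q x * y j x) = M k k x * (t x * e j x)" using e(2) that by simp
    then show ?thesis using False by (simp add: e'_def mult_ac)
  qed
  moreover have "pfun n (\<lambda>x. M k k x * Q x)" "M k k v * Q v = 1"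
    using insert.prems(2,3) Q by (auto intro: pfun.intros)
  ultimately show ?case by (intro exI[of _ "\<lambda>x. M k k x * Q x"] exI[of _ e']) auto
qed

section \<open>Local parametrization of a curve\<close>

text \<open>In the product topology these boxes, which control only the coordinates up to
  \<open>n\<close>, form a neighbourhood base within \<open>cspace n\<close>. One
  \<open>\<eta>\<close> for all coordinates suits estimates in the maximum norm.\<close>

definition box_around :: "nat \<Rightarrow> cvec \<Rightarrow> real \<Rightarrow> cvec set" where
  "box_around n v \<eta> = {x \<in> cspace n. \<forall>j\<le>n. norm (x j - v j) < \<eta>}"

lemma open_contains_box:
  assumes "open U" "v \<in> U" "v \<in> cspace n"
  shows "\<exists>\<eta>>0. box_around n v \<eta> \<subseteq> U"
proof -
  have "openin (product_topology (\<lambda>i. euclidean) UNIV) U"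
    using assms(1) by (simp add: euclidean_product_topology)
  then obtain B where B: "v \<in> (\<Pi>\<^sub>E i\<in>UNIV. B i)" "\<And>i. open (B i)" "(\<Pi>\<^sub>E i\<in>UNIV. B i) \<subseteq> U"
    using product_topology_open_contains_basis[OF _ assms(2), of "\<lambda>i. euclidean" UNIV] by auto
  have "\<forall>i. \<exists>e>0. ball (v i) e \<subseteq> B i"
    using B(1,2) open_contains_ball by (metis PiE_mem UNIV_I)
  then obtain e where e: "\<And>i. e i > 0" "\<And>i. ball (v i) (e i) \<subseteq> B i" by metis
  define \<eta> where "\<eta> = Min (e ` {..n})"
  have "\<eta> > 0" unfolding \<eta>_def using e(1) by (subst Min_gr_iff) auto
  have \<eta>: "\<eta> \<le> e j" if "j \<le> n" for j unfolding \<eta>_def using that by (intro Min_le) auto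
  have "x \<in> U" if x: "x \<in> box_around n v \<eta>" for x
  proof -
    have "x i \<in> B i" for i
    proof (cases "i \<le> n")
      case True
      then have "norm (x i - v i) < e i" using x \<eta>[OF True] by (force simp: box_around_def)
      then show ?thesis using e(2)[of i] by (auto simp: dist_norm norm_minus_commute)
    next
      case False
      then have "x i = v i" using x assms(3) by (auto simp: box_around_def cspace_def)
      then show ?thesis using B(1) by auto
    qed
    then show ?thesis using B(3) by auto
  qed
  then show ?thesis using \<open>\<eta> > 0\<close> by blast
qed

lemma open_contains_box2:
  assumes "open U" "(v, v) \<in> U" "v \<in> cspace n"
  shows "\<exists>\<eta>>0. \<forall>x\<in>box_around n v \<eta>. \<forall>y\<in>box_around n v \<eta>. (x, y) \<in> U"
proof -
  obtain A B where AB: "open A" "open B" "v \<in> A" "v \<in> B" "A \<times> B \<subseteq> U"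
    using open_prod_elim[OF assms(1,2)] by (metis mem_Sigma_iff)
  then obtain \<eta> where "\<eta> > 0" "box_around n v \<eta> \<subseteq> A \<inter> B"
    using open_contains_box[of "A \<inter> B" v n] assms(3) by auto
  then show ?thesis using AB(5) by blast
qed

lemma pfun_tendsto:
  "pfun n f \<Longrightarrow> (\<And>i. ((\<lambda>k. x k i) \<longlongrightarrow> y i) F) \<Longrightarrow> ((\<lambda>k. f (x k)) \<longlongrightarrow> f y) F"
  by (induction rule: pfun.induct) (auto intro: tendsto_intros)

lemma real_curve_subset: "real_curve n X \<Longrightarrow> X \<subseteq> proj_space n"
  unfolding real_curve_def real_zariski_closed_iff using form_locus_subset by auto

lemma in_cone_tangent_space:
  assumes X: "X \<subseteq> proj_space n"
  shows "w \<in> cone_tangent_space n X v \<longleftrightarrow> w \<in> cspace n \<and>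
    (\<forall>g d. hform UNIV n d g \<longrightarrow> (\<forall>x\<in>cone_pts n X. g x = 0) \<longrightarrow>
       (\<Sum>i\<le>n. deriv (\<lambda>t. g (v(i := t))) (v i) * w i) = 0)"
proof -
  have van: "(\<forall>p\<in>X. vanishes_at P p) \<longleftrightarrow> (\<forall>x\<in>cone_pts n X. mpoly_eval P x = 0)"
    if "hom_poly n d P" for P d
  proof -
    have "hform UNIV n d (mpoly_eval P)" using that hform_iff_hom_poly by blast
    note v = vanishes_at_line[OF this]
    show ?thesis
    proof
      assume "\<forall>p\<in>X. vanishes_at P p"
      then show "\<forall>x\<in>cone_pts n X. mpoly_eval P x = 0" using v cone_line by blast
    next
      assume "\<forall>x\<in>cone_pts n X. mpoly_eval P x = 0"
      then show "\<forall>p\<in>X. vanishes_at P p" using v in_points_cone[OF X] by metis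
    qed
  qed
  show ?thesis
    unfolding cone_tangent_space_def mpoly_partial_def hform_iff_hom_poly using van by blast
qed

text \<open>By duality every vector orthogonal to the tangent plane of the cone is the gradient of a
  polynomial function vanishing on the cone. The relations that express coordinate \<open>i\<close>
  of the plane through the coordinates \<open>a\<close> and \<open>b\<close> are such vectors, so
  the Jacobian in the remaining coordinates is the identity at once, without selecting an invertible
  minor.\<close>

lemma defining_equations:
  assumes X: "real_curve n X" and v: "v \<in> cone_pts n X" "a \<le> n" "v a = 1"
  obtains b P c where "b \<le> n" "b \<noteq> a"
    "\<And>i. i \<in> {..n} - {a, b} \<Longrightarrow> diff_quot n (P i) (c i)"
    "\<And>i. i \<in> {..n} - {a, b} \<Longrightarrow> pfun n (P i)"
    "\<And>i x. i \<in> {..n} - {a, b} \<Longrightarrow> x \<in> cone_pts n X \<Longrightarrow> P i x = 0"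
    "\<And>i j. i \<in> {..n} - {a, b} \<Longrightarrow> j \<in> {..n} - {a, b} \<Longrightarrow> c i j v v = (if i = j then 1 else 0)"
proof -
  note XP = real_curve_subset[OF X]
  define W where "W = cone_tangent_space n X v"
  have dim: "cvec.dim W = 2"
    using X cone_line[OF v(1)] cone_nonzero[OF v(1)] self_in_line[of v]
    unfolding W_def real_curve_def by blast
  note W_iff = in_cone_tangent_space[OF XP, of _ v, folded W_def]
  have sub: "W \<subseteq> cspace n" using W_iff by blast
  have subsp: "cvec.subspace W"
  proof (rule cvec.subspaceI)
    show "0 \<in> W" unfolding W_iff by (simp add: cspace_def)
    fix x y assume "x \<in> W" "y \<in> W"
    then show "x + y \<in> W"
      unfolding W_iff by (auto simp: cspace_def distrib_left sum.distrib)
  next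
    fix c x assume "x \<in> W"
    moreover have "(\<Sum>i\<le>n. D i * (c * x i)) = c * (\<Sum>i\<le>n. D i * x i)" for D :: "nat \<Rightarrow> complex"
      unfolding sum_distrib_left by (intro sum.cong) auto
    ultimately show "(\<lambda>i. c * x i) \<in> W"
      unfolding W_iff by (auto simp: cspace_def)
  qed
  have "v \<in> W"
    unfolding W_iff
  proof (intro conjI allI impI)
    show "v \<in> cspace n" using v(1) by (rule cone_cspace)
    fix g d assume g: "hform UNIV n d g" "\<forall>x\<in>cone_pts n X. g x = 0"
    obtain c where c: "diff_quot n g c" using exists_diff_quot hform_imp_pfun g(1) by blast
    have "(\<Sum>i\<le>n. v i * c i v v) = 0" using diff_quot_euler[OF c g(1)] g(2) v(1) by blast
    then show "(\<Sum>i\<le>n. deriv (\<lambda>t. g (v(i := t))) (v i) * v i) = 0"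
      using diff_quot_deriv[OF c] by (simp add: mult.commute)
  qed
  from plane_basis[OF dim subsp sub this v(3)]
  obtain b w where b: "b \<le> n" "b \<noteq> a" and w: "w \<in> W" "w a = 0" "w b = 1"
    and span: "\<And>x i. x \<in> W \<Longrightarrow> x i = x a * v i + (x b - x a * v b) * w i" by blast
  \<comment> \<open>Gradients at \<open>v\<close> of all polynomial functions vanishing on the cone.
    Homogeneity is dropped so that sums of forms of different degrees stay inside and
    \<open>G\<close> is a subspace.\<close>
  define G where "G = {\<xi> \<in> cspace n. \<exists>P c. diff_quot n P c \<and> pfun n P \<and> (\<forall>x\<in>cone_pts n X. P x = 0) \<and>
    (\<forall>j\<le>n. \<xi> j = c j v v)}"
  have subspG: "cvec.subspace G"
  proof (rule cvec.subspaceI)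
    have "diff_quot n (\<lambda>_. 0) (\<lambda>_ _ _. 0)" by (auto simp: diff_quot_def intro: pfun.intros)
    then show "0 \<in> G"
      unfolding G_def
      by (auto simp: cspace_def intro!: exI[of _ "\<lambda>_. 0"] exI[of _ "\<lambda>_ _ _. 0"] pfun.intros)
    fix x y assume "x \<in> G" "y \<in> G"
    then obtain P c P' c' where P: "diff_quot n P c" "pfun n P" "\<forall>x\<in>cone_pts n X. P x = 0" "\<forall>j\<le>n. x j = c j v v"
      and P': "diff_quot n P' c'" "pfun n P'" "\<forall>x\<in>cone_pts n X. P' x = 0" "\<forall>j\<le>n. y j = c' j v v"
      and xy: "x \<in> cspace n" "y \<in> cspace n"
      unfolding G_def by blast
    have "diff_quot n (\<lambda>x. P x + P' x) (\<lambda>j x y. c j x y + c' j x y)"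
      using P(1) P'(1)
      by (auto simp: diff_quot_def case_prod_unfold distrib_left sum.distrib add_diff_add
          intro: pfun.intros continuous_intros)
    moreover have "pfun n (\<lambda>x. P x + P' x)" using P(2) P'(2) by (rule pfun.intros)
    moreover have "x + y \<in> cspace n" using xy by (auto simp: cspace_def)
    ultimately show "x + y \<in> G"
      unfolding G_def using P(3,4) P'(3,4)
      by (intro CollectI conjI exI[of _ "\<lambda>x. P x + P' x"] exI[of _ "\<lambda>j x y. c j x y + c' j x y"]) auto
  next
    fix s x assume "x \<in> G"
    then obtain P c where P: "diff_quot n P c" "pfun n P" "\<forall>x\<in>cone_pts n X. P x = 0" "\<forall>j\<le>n. x j = c j v v"
      and x: "x \<in> cspace n" unfolding G_def by blast
    have "s * P x - s * P y = (\<Sum>j\<le>n. (x j - y j) * (s * c j x y))" for x y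
    proof -
      have "s * P x - s * P y = s * (P x - P y)" by (simp add: right_diff_distrib)
      also have "\<dots> = s * (\<Sum>j\<le>n. (x j - y j) * c j x y)" using P(1) by (simp add: diff_quot_def)
      finally show ?thesis by (simp add: sum_distrib_left mult.left_commute)
    qed
    then have "diff_quot n (\<lambda>x. s * P x) (\<lambda>j x y. s * c j x y)"
      using P(1) by (auto simp: diff_quot_def case_prod_unfold intro!: pfun.intros continuous_intros)
    moreover have "pfun n (\<lambda>x. s * P x)" using P(2) by (intro pfun.intros)
    ultimately show "(\<lambda>i. s * x i) \<in> G"
      unfolding G_def using P(3,4) cspace_scale[OF x]
      by (intro CollectI conjI exI[of _ "\<lambda>x. s * P x"] exI[of _ "\<lambda>j x y. s * c j x y"]) auto
  qed
  have annG: "x \<in> W" if x: "x \<in> cspace n" "\<And>\<xi>. \<xi> \<in> G \<Longrightarrow> (\<Sum>i\<le>n. \<xi> i * x i) = 0" for x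
    unfolding W_iff
  proof (intro conjI allI impI)
    fix g d assume g: "hform UNIV n d g" "\<forall>x\<in>cone_pts n X. g x = 0"
    have pg: "pfun n g" using g(1) by (rule hform_imp_pfun)
    then obtain c where c: "diff_quot n g c" using exists_diff_quot by blast
    have "(\<lambda>j. if j \<le> n then c j v v else 0) \<in> G"
      unfolding G_def using c pg g(2) by (auto simp: cspace_def intro!: exI[of _ g] exI[of _ c])
    from x(2)[OF this] show "(\<Sum>i\<le>n. deriv (\<lambda>t. g (v(i := t))) (v i) * x i) = 0"
      using diff_quot_deriv[OF c] by simp
  qed (rule x(1))
  \<comment> \<open>The coefficients of \<open>x i - (v i - w i * v b) * x a - w i * x b\<close>,
    which is 0 on \<open>W\<close> by the description of the plane.\<close>
  define \<xi> where "\<xi> i = (\<lambda>j. (if j = i then 1 else 0) - (v i - w i * v b) * (if j = a then 1 else 0)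
      - w i * (if j = b then 1 else 0))" for i
  have \<xi>G: "\<xi> i \<in> G" if i: "i \<le> n" for i
  proof (rule double_annihilator[OF subspG])
    show "G \<subseteq> cspace n" by (auto simp: G_def)
    show "\<xi> i \<in> cspace n" using i b v(2) by (auto simp: \<xi>_def cspace_def)
    fix x assume "x \<in> cspace n" "\<And>\<xi>. \<xi> \<in> G \<Longrightarrow> (\<Sum>i\<le>n. \<xi> i * x i) = 0"
    then have xW: "x \<in> W" by (rule annG)
    have "(\<Sum>j\<le>n. \<xi> i j * x j) = (\<Sum>j\<le>n. (if j = i then x j else 0)
        - (v i - w i * v b) * (if j = a then x j else 0) - w i * (if j = b then x j else 0))"
      by (intro sum.cong) (auto simp: \<xi>_def left_diff_distrib)
    also have "\<dots> = x i - (v i - w i * v b) * x a - w i * x b"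
      using i b(1) v(2) by (simp add: sum_subtractf sum_distrib_left[symmetric])
    also have "\<dots> = 0" using span[OF xW, of i] by (simp add: algebra_simps)
    finally show "(\<Sum>j\<le>n. \<xi> i j * x j) = 0" .
  qed
  have "\<forall>i. \<exists>P c. i \<le> n \<longrightarrow> diff_quot n P c \<and> pfun n P \<and> (\<forall>x\<in>cone_pts n X. P x = 0) \<and>
    (\<forall>j\<le>n. \<xi> i j = c j v v)"
    using \<xi>G unfolding G_def by blast
  then obtain P c where Pc: "\<And>i. i \<le> n \<Longrightarrow> diff_quot n (P i) (c i) \<and> pfun n (P i) \<and>
    (\<forall>x\<in>cone_pts n X. P i x = 0) \<and> (\<forall>j\<le>n. \<xi> i j = c i j v v)"
    by metis
  show thesis
  proof (rule that[OF b, of P c])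
    fix i j assume "i \<in> {..n} - {a, b}" "j \<in> {..n} - {a, b}"
    then have "c i j v v = \<xi> i j" "j \<noteq> a" "j \<noteq> b" using Pc[of i] by auto
    then show "c i j v v = (if i = j then 1 else 0)" by (auto simp: \<xi>_def)
  qed (use Pc in auto)
qed

lemma real_curve_irreducible:
  assumes "real_curve n X" "zariski_closed n A" "zariski_closed n B" "X \<subseteq> A \<union> B"
  shows "X \<subseteq> A \<or> X \<subseteq> B"
  using assms by (simp add: real_curve_def irreducible_closed_def)

lemma line_in_form_locus_single:
  assumes "hform K n d g" "x \<in> cone_pts n X"
  shows "line x \<in> form_locus n {g} \<longleftrightarrow> g x = 0"
  by (subst line_in_form_locus) (use assms cone_cspace cone_nonzero in blast)+

text \<open>After homogenizing \<open>p\<close> and \<open>q\<close>, an extra factor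
  \<open>x a\<close> puts the points outside the chart into both closed sets, so that together they
  cover \<open>X\<close> and irreducibility applies.\<close>

lemma curve_pfun_irreducible:
  assumes X: "real_curve n X" and a: "a \<le> n" and pq: "pfun n p" "pfun n q"
    and zero: "\<And>x. x \<in> cone_pts n X \<Longrightarrow> x a = 1 \<Longrightarrow> p x * q x = 0"
  shows "(\<forall>x\<in>cone_pts n X. x a = 1 \<longrightarrow> p x = 0) \<or> (\<forall>x\<in>cone_pts n X. x a = 1 \<longrightarrow> q x = 0)"
proof -
  note XP = real_curve_subset[OF X]
  obtain d g where g: "hform UNIV n d g" "\<forall>x. x a = 1 \<longrightarrow> g x = p x"
    using pfun_homogenize[OF pq(1) a] by blast
  obtain e h where h: "hform UNIV n e h" "\<forall>x. x a = 1 \<longrightarrow> h x = q x"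
    using pfun_homogenize[OF pq(2) a] by blast
  define A where "A = form_locus n {\<lambda>x. x a * g x}"
  define B where "B = form_locus n {\<lambda>x. x a * h x}"
  have fg: "hform UNIV n (1 + d) (\<lambda>x. x a * g x)" and fh: "hform UNIV n (1 + e) (\<lambda>x. x a * h x)"
    by (rule hform_mult[OF hform_var[OF a] g(1)], rule hform_mult[OF hform_var[OF a] h(1)])
  have A: "line x \<in> A \<longleftrightarrow> x a * g x = 0" and B: "line x \<in> B \<longleftrightarrow> x a * h x = 0"
    if "x \<in> cone_pts n X" for x
    unfolding A_def B_def using line_in_form_locus_single[OF fg that] line_in_form_locus_single[OF fh that]
    by auto
  have "zariski_closed n A" "zariski_closed n B"
    unfolding A_def B_def using fg fh by (intro zariski_closed_form_locus; blast)+
  moreover have "X \<subseteq> A \<union> B"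
  proof
    fix y assume "y \<in> X"
    then obtain x where x: "x \<in> cone_pts n X" "y = line x" using in_points_cone[OF XP] by blast
    show "y \<in> A \<union> B"
    proof (cases "x a = 0")
      case True
      then show ?thesis using A[OF x(1)] x(2) by auto
    next
      case False
      define u where "u = (\<lambda>i. (1 / x a) * x i)"
      have u: "u \<in> cone_pts n X" "line u = y" "u a = 1"
        using cone_scale[OF x(1), of "1 / x a"] line_scale[of "1 / x a" x] x(2) False
        by (auto simp: u_def)
      then show ?thesis using A[OF u(1)] B[OF u(1)] zero[OF u(1,3)] g(2) h(2) by auto
    qed
  qed
  ultimately have "X \<subseteq> A \<or> X \<subseteq> B"
    by (rule real_curve_irreducible[OF X])
  then show ?thesis
  proof
    assume "X \<subseteq> A"
    then have "x a * g x = 0" if "x \<in> cone_pts n X" for x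
      using A[OF that] cone_line[OF that] by (simp add: subset_iff)
    then have "\<forall>x\<in>cone_pts n X. x a = 1 \<longrightarrow> p x = 0" using g(2) by force
    then show ?thesis ..
  next
    assume "X \<subseteq> B"
    then have "x a * h x = 0" if "x \<in> cone_pts n X" for x
      using B[OF that] cone_line[OF that] by (simp add: subset_iff)
    then have "\<forall>x\<in>cone_pts n X. x a = 1 \<longrightarrow> q x = 0" using h(2) by force
    then show ?thesis ..
  qed
qed

text \<open>Two nonempty sets, one strictly inside the other, do not fit into one point, so no chain
  has positive length and the dimension would be 0.\<close>

lemma curve_not_point: assumes "real_curve n X" shows "X \<noteq> {p}"
proof
  assume X: "X = {p}"
  define K where "K = {k. \<exists>c :: nat \<Rightarrow> cpoint set.
     (\<forall>i\<le>k. irreducible_closed n (c i) \<and> c i \<subseteq> X) \<and> (\<forall>i<k. c i \<subset> c (Suc i))}"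
  have "k = 0" if k: "k \<in> K" for k
  proof (rule ccontr)
    assume "k \<noteq> 0"
    obtain c where c: "\<forall>i\<le>k. irreducible_closed n (c i) \<and> c i \<subseteq> X" "\<forall>i<k. c i \<subset> c (Suc i)"
      using k unfolding K_def by blast
    then have "c 0 \<noteq> {}" "c 0 \<subset> c 1" "c 1 \<subseteq> {p}"
      using \<open>k \<noteq> 0\<close> X unfolding irreducible_closed_def by auto
    then show False by blast
  qed
  then have "(SUP k\<in>K. enat k) \<le> 0" by (intro SUP_least) (metis zero_enat_def order_refl)
  moreover have "(SUP k\<in>K. enat k) = 1"
    using assms unfolding real_curve_def zariski_dim_def K_def by blast
  ultimately show False by simp
qed

text \<open>The situation produced by \<open>defining_equations\<close>: coordinate \<open>a\<close>
  is normalised to 1, coordinate \<open>b\<close> is the parameter, and the coordinates in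
  \<open>J\<close> are to be solved from equally many equations \<open>P i = 0\<close>.\<close>

locale curve_chart =
  fixes n :: nat and X :: "cpoint set" and v :: cvec and a b :: nat
    and P :: "nat \<Rightarrow> cvec \<Rightarrow> complex" and c :: "nat \<Rightarrow> nat \<Rightarrow> cvec \<Rightarrow> cvec \<Rightarrow> complex" and J :: "nat set"
  assumes X: "real_curve n X" and v: "v \<in> cone_pts n X" and a: "a \<le> n" and va: "v a = 1"
    and b: "b \<le> n" "b \<noteq> a" and J: "J = {..n} - {a, b}"
    and dq: "\<And>i. i \<in> J \<Longrightarrow> diff_quot n (P i) (c i)"
    and pP: "\<And>i. i \<in> J \<Longrightarrow> pfun n (P i)"
    and PX: "\<And>i x. i \<in> J \<Longrightarrow> x \<in> cone_pts n X \<Longrightarrow> P i x = 0"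
    and cv: "\<And>i j. i \<in> J \<Longrightarrow> j \<in> J \<Longrightarrow> c i j v v = (if i = j then 1 else 0)"
begin

lemma v_cspace: "v \<in> cspace n"
  using v by (rule cone_cspace)

lemma finite_J: "finite J" and card_J: "card J \<le> n + 1"
  using card_mono[of "{..n}" J] by (auto simp: J)

lemma sum_split: "(\<Sum>j\<le>n. f j) = f a + f b + (\<Sum>j\<in>J. f j)" for f :: "nat \<Rightarrow> complex"
proof -
  have "{..n} = insert a (insert b J)" "a \<notin> insert b J" "b \<notin> J"
    using a b by (auto simp: J)
  then show ?thesis using finite_J by (simp add: add.assoc)
qed

lemma J_iff: "i \<in> J \<longleftrightarrow> i \<le> n \<and> i \<noteq> a \<and> i \<noteq> b"
  by (auto simp: J)

text \<open>Newton's iteration with the Jacobian at \<open>v\<close>, which is the identity.\<close>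

primrec newton :: "nat \<Rightarrow> complex \<Rightarrow> cvec" where
  "newton 0 z = v(b := v b + z)"
| "newton (Suc k) z = (\<lambda>i. if i \<in> J then newton k z i - P i (newton k z) else newton k z i)"

lemma newton_a: "newton k z a = 1"
  using va b by (induction k) (auto simp: J_iff)

lemma newton_b: "newton k z b = v b + z"
  by (induction k) (auto simp: J_iff)

lemma newton_cspace: "newton k z \<in> cspace n"
  using v_cspace b by (induction k) (auto simp: cspace_def J_iff)

lemma newton_holomorphic: "(\<lambda>z. newton k z i) holomorphic_on S"
proof (induction k arbitrary: i)
  case 0
  show ?case by (cases "i = b") (auto intro!: holomorphic_intros)
next
  case (Suc k)
  show ?case
  proof (cases "i \<in> J")
    case True
    have "(\<lambda>z. P i (newton k z)) holomorphic_on S"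
      using pP[OF True] Suc.IH by (rule pfun_holomorphic)
    with True Suc.IH show ?thesis by (auto intro!: holomorphic_intros)
  qed (use Suc.IH in auto)
qed

text \<open>The bound is made for \<open>contraction\<close>: at most \<open>n + 1\<close> summands
  of size \<open>1 / (2 * (n + 1))\<close> give the factor 1/2.\<close>

lemma exists_contraction_box:
  "\<exists>\<eta>>0. \<forall>x\<in>box_around n v \<eta>. \<forall>y\<in>box_around n v \<eta>. \<forall>i\<in>J. \<forall>j\<in>J.
     norm (c i j x y - (if i = j then 1 else 0)) < 1 / (2 * (real n + 1))"
proof -
  define U where "U = (\<Inter>i\<in>J. \<Inter>j\<in>J. {z :: cvec \<times> cvec.
     norm (c i j (fst z) (snd z) - (if i = j then 1 else 0)) < 1 / (2 * (real n + 1))})"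
  have "continuous_on UNIV (\<lambda>z. c i j (fst z) (snd z))" if "i \<in> J" for i j
    by (intro diff_quot_continuous[OF dq[OF that]] continuous_on_fst continuous_on_snd continuous_on_id)
  then have "open U"
    unfolding U_def
    by (intro open_INT finite_J ballI open_Collect_less continuous_on_norm continuous_on_diff continuous_on_const)
  moreover have "(v, v) \<in> U"
    unfolding U_def by (simp add: cv)
  ultimately have "\<exists>\<eta>>0. \<forall>x\<in>box_around n v \<eta>. \<forall>y\<in>box_around n v \<eta>. (x, y) \<in> U"
    using v_cspace by (rule open_contains_box2)
  then show ?thesis unfolding U_def by simp
qed

definition \<eta>0 where "\<eta>0 = (SOME \<eta>. \<eta> > 0 \<and>
  (\<forall>x\<in>box_around n v \<eta>. \<forall>y\<in>box_around n v \<eta>. \<forall>i\<in>J. \<forall>j\<in>J.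
     norm (c i j x y - (if i = j then 1 else 0)) < 1 / (2 * (real n + 1))))"

lemma \<eta>0: "\<eta>0 > 0"
  "\<And>x y i j. x \<in> box_around n v \<eta>0 \<Longrightarrow> y \<in> box_around n v \<eta>0 \<Longrightarrow> i \<in> J \<Longrightarrow> j \<in> J \<Longrightarrow>
     norm (c i j x y - (if i = j then 1 else 0)) < 1 / (2 * (real n + 1))"
  using someI_ex[OF exists_contraction_box] unfolding \<eta>0_def[symmetric] by blast+

text \<open>The map \<open>x - P x\<close> has the identity minus \<open>c\<close> as its difference
  quotient, which is small near \<open>v\<close>. The arguments agree in coordinates
  \<open>a\<close> and \<open>b\<close>, so only differences in \<open>J\<close> contribute.\<close>

lemma contraction:
  assumes "x \<in> box_around n v \<eta>0" "y \<in> box_around n v \<eta>0" "x a = y a" "x b = y b"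
    and M: "\<And>j. j \<in> J \<Longrightarrow> norm (x j - y j) \<le> M" and i: "i \<in> J"
  shows "norm ((x i - P i x) - (y i - P i y)) \<le> M / 2"
proof -
  have "P i x - P i y = (\<Sum>j\<in>J. (x j - y j) * c i j x y)"
    using dq[OF i] assms(3,4) by (simp add: diff_quot_def sum_split)
  moreover have "x i - y i = (\<Sum>j\<in>J. (x j - y j) * (if i = j then 1 else 0))"
    using i finite_J by (simp add: if_distrib cong: if_cong)
  moreover have "(x i - P i x) - (y i - P i y) = (x i - y i) - (P i x - P i y)" by simp
  ultimately have "(x i - P i x) - (y i - P i y) =
      - (\<Sum>j\<in>J. (x j - y j) * (c i j x y - (if i = j then 1 else 0)))"
    by (simp only: right_diff_distrib sum_subtractf minus_diff_eq)
  also have "norm \<dots> \<le> (\<Sum>j\<in>J. M * (1 / (2 * (real n + 1))))"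
    unfolding norm_minus_cancel
  proof (rule sum_norm_le)
    fix j assume j: "j \<in> J"
    show "norm ((x j - y j) * (c i j x y - (if i = j then 1 else 0))) \<le> M * (1 / (2 * (real n + 1)))"
      unfolding norm_mult
    proof (intro mult_mono M j)
      show "norm (c i j x y - (if i = j then 1 else 0)) \<le> 1 / (2 * (real n + 1))"
        using \<eta>0(2)[OF assms(1,2) i j] by simp
      show "0 \<le> M" using M[OF j] norm_ge_zero order_trans by blast
    qed auto
  qed
  also have "\<dots> = (real (card J) / (real n + 1)) * (M / 2)" by simp
  also have "\<dots> \<le> 1 * (M / 2)"
  proof (rule mult_right_mono)
    show "real (card J) / (real n + 1) \<le> 1" using card_J by (simp add: divide_le_eq_1)
    show "0 \<le> M / 2" using M[OF i] norm_ge_zero[of "x i - y i"] by linarith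
  qed
  finally show ?thesis by simp
qed

text \<open>An initial defect below \<open>\<eta>0 / 4\<close> makes the geometric series of Newton
  steps sum to at most \<open>\<eta>0 / 2\<close>, which keeps all iterates inside the box.\<close>

lemma exists_radius: "\<exists>\<rho>>0. \<rho> \<le> \<eta>0 \<and> (\<forall>z\<in>ball 0 \<rho>. \<forall>i\<in>J. norm (P i (newton 0 z)) < \<eta>0 / 4)"
proof -
  define U where "U = (\<Inter>i\<in>J. {z. norm (P i (newton 0 z)) < \<eta>0 / 4})"
  have "continuous_on UNIV (\<lambda>z. P i (newton 0 z))" if "i \<in> J" for i
    using pfun_holomorphic[OF pP[OF that] newton_holomorphic] by (rule holomorphic_on_imp_continuous_on)
  then have "open U"
    unfolding U_def by (intro open_INT finite_J ballI open_Collect_less continuous_intros)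
  moreover have "0 \<in> U"
    using PX[OF _ v] \<eta>0(1) by (auto simp: U_def)
  ultimately obtain e where e: "e > 0" "ball 0 e \<subseteq> U" using open_contains_ball by blast
  have "\<forall>z\<in>ball 0 (min e \<eta>0). \<forall>i\<in>J. norm (P i (newton 0 z)) < \<eta>0 / 4"
    using e(2) unfolding U_def by (simp add: subset_iff)
  then show ?thesis using e(1) \<eta>0(1) by (intro exI[of _ "min e \<eta>0"]) auto
qed

definition \<rho> where "\<rho> = (SOME \<rho>. \<rho> > 0 \<and> \<rho> \<le> \<eta>0 \<and>
  (\<forall>z\<in>ball 0 \<rho>. \<forall>i\<in>J. norm (P i (newton 0 z)) < \<eta>0 / 4))"

lemma \<rho>: "\<rho> > 0" "\<rho> \<le> \<eta>0" "\<And>z i. z \<in> ball 0 \<rho> \<Longrightarrow> i \<in> J \<Longrightarrow> norm (P i (newton 0 z)) < \<eta>0 / 4"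
  using someI_ex[OF exists_radius] unfolding \<rho>_def[symmetric] by blast+

lemma in_boxI:
  assumes "x \<in> cspace n" "x a = 1" "norm (x b - v b) < \<eta>0" "\<And>j. j \<in> J \<Longrightarrow> norm (x j - v j) < \<eta>0"
  shows "x \<in> box_around n v \<eta>0"
proof -
  have "norm (x j - v j) < \<eta>0" if "j \<le> n" for j
    using that assms(2-4) va \<eta>0(1) by (cases "j = a"; cases "j = b") (auto simp: J_iff)
  then show ?thesis using assms(1) by (simp add: box_around_def)
qed

text \<open>The two bounds need each other: the first keeps the iterates in the box where the
  contraction applies, and the contraction halves the next step in the second.\<close>

lemma newton_estimates:
  assumes z: "z \<in> ball 0 \<rho>"
  shows "(\<forall>i\<in>J. norm (newton k z i - v i) \<le> (1 - (1/2)^k) * (\<eta>0 / 2)) \<and>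
    (\<forall>i\<in>J. norm (newton (Suc k) z i - newton k z i) \<le> (1/2)^k * (\<eta>0 / 4))"
proof (induction k)
  case 0
  have "i \<noteq> b" if "i \<in> J" for i using that by (auto simp: J_iff)
  then show ?case using \<rho>(3)[OF z] by (auto simp del: newton.simps(1) simp: newton.simps(1)[THEN fun_cong] intro: less_imp_le)
next
  case (Suc k)
  have box: "newton m z \<in> box_around n v \<eta>0"
    if "\<forall>i\<in>J. norm (newton m z i - v i) \<le> (1 - (1/2)^m) * (\<eta>0 / 2)" for m
  proof (rule in_boxI[OF newton_cspace newton_a])
    show "norm (newton m z b - v b) < \<eta>0" using z \<rho>(2) by (simp add: newton_b)
    fix j assume "j \<in> J"
    then have "norm (newton m z j - v j) \<le> (1 - (1/2)^m) * (\<eta>0 / 2)" using that by blast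
    also have "\<dots> \<le> 1 * (\<eta>0 / 2)" using \<eta>0(1) by (intro mult_right_mono) auto
    also have "\<dots> < \<eta>0" using \<eta>0(1) by simp
    finally show "norm (newton m z j - v j) < \<eta>0" .
  qed
  have first: "\<forall>i\<in>J. norm (newton (Suc k) z i - v i) \<le> (1 - (1/2)^Suc k) * (\<eta>0 / 2)"
  proof
    fix i assume i: "i \<in> J"
    have "norm (newton (Suc k) z i - v i) \<le>
        norm (newton (Suc k) z i - newton k z i) + norm (newton k z i - v i)"
      using norm_triangle_ineq[of "newton (Suc k) z i - newton k z i" "newton k z i - v i"] by simp
    also have "\<dots> \<le> (1/2)^k * (\<eta>0 / 4) + (1 - (1/2)^k) * (\<eta>0 / 2)"
      using Suc.IH i by (intro add_mono) blast+
    also have "\<dots> = (1 - (1/2)^Suc k) * (\<eta>0 / 2)" by (simp add: field_simps)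
    finally show "norm (newton (Suc k) z i - v i) \<le> (1 - (1/2)^Suc k) * (\<eta>0 / 2)" .
  qed
  have "norm (newton (Suc (Suc k)) z i - newton (Suc k) z i) \<le> (1/2)^Suc k * (\<eta>0 / 4)" if i: "i \<in> J" for i
  proof -
    have "norm ((newton (Suc k) z i - P i (newton (Suc k) z)) - (newton k z i - P i (newton k z)))
        \<le> ((1/2)^k * (\<eta>0 / 4)) / 2"
    proof (rule contraction)
      show "newton (Suc k) z \<in> box_around n v \<eta>0" using first by (rule box)
      show "newton k z \<in> box_around n v \<eta>0" using Suc.IH by (intro box) blast
      show "newton (Suc k) z a = newton k z a" "newton (Suc k) z b = newton k z b"
        by (simp_all only: newton_a newton_b)
    qed (use Suc.IH i in blast)+
    then show ?thesis using i by (simp add: field_simps)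
  qed
  with first show ?case by blast
qed

text \<open>The limit of the iteration, written as a telescoping series so that the Weierstrass test
  yields uniform convergence and hence holomorphy.\<close>

definition \<psi> :: "complex \<Rightarrow> cvec" where
  "\<psi> z i = newton 0 z i + suminf (\<lambda>k. newton (Suc k) z i - newton k z i)"

lemma newton_uniform_limit: "uniform_limit (ball 0 \<rho>) (\<lambda>N z. newton N z i) (\<lambda>z. \<psi> z i) sequentially"
proof -
  have bd: "norm (newton (Suc k) z i - newton k z i) \<le> (1/2)^k * (\<eta>0 / 4)" if "z \<in> ball 0 \<rho>" for k z
  proof (cases "i \<in> J")
    case True then show ?thesis using newton_estimates[OF that] by blast
  next
    case False then show ?thesis using \<eta>0(1) by simp
  qed
  have "summable (\<lambda>k. (1/2)^k * (\<eta>0 / 4))"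
    by (intro summable_mult2 summable_geometric) auto
  from Weierstrass_m_test[of "ball 0 \<rho>" "\<lambda>k z. newton (Suc k) z i - newton k z i", OF bd this]
  have "uniform_limit (ball 0 \<rho>) (\<lambda>N z. \<Sum>k<N. newton (Suc k) z i - newton k z i)
      (\<lambda>z. suminf (\<lambda>k. newton (Suc k) z i - newton k z i)) sequentially" .
  then have "uniform_limit (ball 0 \<rho>)
      (\<lambda>N z. newton 0 z i + (\<Sum>k<N. newton (Suc k) z i - newton k z i)) (\<lambda>z. \<psi> z i) sequentially"
    unfolding \<psi>_def by (intro uniform_limit_intros)
  moreover have "newton 0 z i + (\<Sum>k<N. newton (Suc k) z i - newton k z i) = newton N z i" for N z
    using sum_lessThan_telescope[of "\<lambda>k. newton k z i" N] by (simp del: newton.simps)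
  ultimately show ?thesis by (simp only:)
qed

lemma newton_tendsto: "z \<in> ball 0 \<rho> \<Longrightarrow> (\<lambda>N. newton N z i) \<longlonglongrightarrow> \<psi> z i"
  using newton_uniform_limit by (rule tendsto_uniform_limitI)

lemma \<psi>_holomorphic: "(\<lambda>z. \<psi> z i) holomorphic_on ball 0 \<rho>"
proof (rule holomorphic_uniform_sequence[OF open_ball newton_holomorphic])
  fix x :: complex assume "x \<in> ball 0 \<rho>"
  then obtain d where "d > 0" "cball x d \<subseteq> ball 0 \<rho>" using open_contains_cball[of "ball 0 \<rho>"] by blast
  then show "\<exists>d>0. cball x d \<subseteq> ball 0 \<rho> \<and>
      uniform_limit (cball x d) (\<lambda>N z. newton N z i) (\<lambda>z. \<psi> z i) sequentially"
    using uniform_limit_on_subset[OF newton_uniform_limit] by blast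
qed

lemma \<psi>_fixed: assumes "i \<notin> J" shows "\<psi> z i = newton 0 z i"
  using assms by (simp add: \<psi>_def)

lemma \<psi>_a: "\<psi> z a = 1" and \<psi>_b: "\<psi> z b = v b + z" and \<psi>_cspace: "\<psi> z \<in> cspace n"
proof -
  have "a \<notin> J" "b \<notin> J" by (auto simp: J_iff)
  then show "\<psi> z a = 1" "\<psi> z b = v b + z" using \<psi>_fixed newton_a newton_b by metis+
  have "\<psi> z i = 0" if "i > n" for i
    using \<psi>_fixed[of i z] newton_cspace[of 0 z] that by (auto simp: J_iff cspace_def)
  then show "\<psi> z \<in> cspace n" by (simp add: cspace_def)
qed

text \<open>For \<open>i\<close> in \<open>J\<close> the value of \<open>P i\<close> at an iterate
  is the difference of consecutive iterates in coordinate \<open>i\<close>, which tends to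
  0.\<close>

lemma \<psi>_zero: assumes z: "z \<in> ball 0 \<rho>" and i: "i \<in> J" shows "P i (\<psi> z) = 0"
proof -
  have "(\<lambda>N. P i (newton N z)) \<longlonglongrightarrow> P i (\<psi> z)"
    using pP[OF i] newton_tendsto[OF z] by (rule pfun_tendsto)
  moreover have "(\<lambda>N. newton N z i - newton (Suc N) z i) \<longlonglongrightarrow> \<psi> z i - \<psi> z i"
    by (intro tendsto_diff newton_tendsto[OF z] LIMSEQ_Suc[OF newton_tendsto[OF z]])
  then have "(\<lambda>N. P i (newton N z)) \<longlonglongrightarrow> 0" using i by simp
  ultimately show ?thesis using LIMSEQ_unique by blast
qed

lemma \<psi>_box: assumes z: "z \<in> ball 0 \<rho>" shows "\<psi> z \<in> box_around n v \<eta>0"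
proof (rule in_boxI[OF \<psi>_cspace \<psi>_a])
  show "norm (\<psi> z b - v b) < \<eta>0" using z \<rho>(2) by (simp add: \<psi>_b)
  fix j assume j: "j \<in> J"
  have "norm (newton N z j - v j) \<le> \<eta>0 / 2" for N
  proof -
    have "norm (newton N z j - v j) \<le> (1 - (1/2)^N) * (\<eta>0 / 2)"
      using newton_estimates[OF z] j by blast
    also have "\<dots> \<le> 1 * (\<eta>0 / 2)" using \<eta>0(1) by (intro mult_right_mono) auto
    finally show ?thesis by simp
  qed
  moreover have "(\<lambda>N. norm (newton N z j - v j)) \<longlonglongrightarrow> norm (\<psi> z j - v j)"
    by (intro tendsto_norm tendsto_diff newton_tendsto[OF z] tendsto_const)
  ultimately have "norm (\<psi> z j - v j) \<le> \<eta>0 / 2"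
    by (intro LIMSEQ_le_const2) auto
  then show "norm (\<psi> z j - v j) < \<eta>0" using \<eta>0(1) by simp
qed

text \<open>Both sides are fixed points of the contraction with the same coordinates
  \<open>a\<close> and \<open>b\<close>, so their distance \<open>M\<close> over \<open>J\<close>
  satisfies \<open>M \<le> M / 2\<close>.\<close>

lemma \<psi>_unique:
  assumes x: "x \<in> box_around n v \<eta>0" "x a = 1" "\<And>i. i \<in> J \<Longrightarrow> P i x = 0" "norm (x b - v b) < \<rho>"
  shows "x = \<psi> (x b - v b)"
proof -
  define y where "y = \<psi> (x b - v b)"
  have z: "x b - v b \<in> ball 0 \<rho>" using x(4) by simp
  have y: "y \<in> box_around n v \<eta>0" "y a = 1" "y b = x b" "\<And>i. i \<in> J \<Longrightarrow> P i y = 0"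
    using \<psi>_box[OF z] \<psi>_a \<psi>_b \<psi>_zero[OF z] by (simp_all add: y_def)
  have J: "x j = y j" if "j \<in> J" for j
  proof -
    define M where "M = Max ((\<lambda>j. norm (x j - y j)) ` J)"
    have M: "norm (x j - y j) \<le> M" if "j \<in> J" for j
      unfolding M_def using that finite_J by (intro Max_ge) auto
    have "M \<in> (\<lambda>j. norm (x j - y j)) ` J"
      unfolding M_def using that finite_J by (intro Max_in) auto
    then obtain i where i: "i \<in> J" "M = norm (x i - y i)" by blast
    have "norm ((x i - P i x) - (y i - P i y)) \<le> M / 2"
      using x(1) y(1) x(2) y(2,3) M i(1) by (intro contraction) auto
    then have "M \<le> 0" using x(3) y(4) i by simp
    then show ?thesis using M[OF that] norm_le_zero_iff[of "x j - y j"] by (simp only: order_trans) auto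
  qed
  show ?thesis
  proof
    fix j
    show "x j = \<psi> (x b - v b) j"
      unfolding y_def[symmetric]
    proof (cases "j \<le> n")
      case True
      then show "x j = y j" using J y x(2) by (cases "j = a"; cases "j = b") (auto simp: J_iff)
    next
      case False
      then show "x j = y j" using x(1) y(1) by (auto simp: box_around_def cspace_def)
    qed
  qed
qed

lemma \<psi>_origin: "\<psi> 0 = v"
  using \<psi>_unique[of v] va PX[OF _ v] \<rho>(1) \<eta>0(1) v_cspace by (simp add: box_around_def)

text \<open>The affine zero set of the chosen equations. It contains the curve in the chart as well
  as the arc \<open>\<psi>\<close>, which is not yet known to lie on the curve; identities proved on
  \<open>Z\<close> apply to both.\<close>

definition Z where "Z = {x \<in> cspace n. x a = 1 \<and> (\<forall>i\<in>J. P i x = 0)}"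

text \<open>Difference quotients turn \<open>P i x = P i v\<close> into a linear system for the
  \<open>x j - v j\<close> with right-hand side divisible by \<open>x b - v b\<close>. Solving it
  shows that \<open>x b - v b\<close> generates the maximal ideal at \<open>v\<close>, up to the
  unit \<open>Q\<close>.\<close>

lemma eliminate:
  obtains Q e where "pfun n Q" "Q v = 1" "\<And>j. j \<in> J \<Longrightarrow> pfun n (e j)"
    "\<And>j x. j \<in> J \<Longrightarrow> x \<in> Z \<Longrightarrow> Q x * (x j - v j) = (x b - v b) * e j x"
proof -
  have "\<exists>Q e. pfun n Q \<and> Q v = 1 \<and>
    (\<forall>j\<in>J. pfun n (e j) \<and> (\<forall>x\<in>Z. Q x * (x j - v j) = (x b - v b) * e j x))"
  proof (rule elimination[OF finite_J, where M = "\<lambda>i j x. c i j x v" and B = "\<lambda>i x. - 1 * c i b x v"])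
    show pc: "pfun n (\<lambda>x. c i j x v)" if "i \<in> J" for i j
      using dq[OF that] by (auto simp: diff_quot_def)
    show "pfun n (\<lambda>x. - 1 * c i b x v)" if "i \<in> J" for i
      using pc[OF that] by (intro pfun.intros)
    show "c i j v v = (if i = j then 1 else 0)" if "i \<in> J" "j \<in> J" for i j
      using that by (rule cv)
    show "(\<Sum>j\<in>J. c i j x v * (x j - v j)) = (x b - v b) * (- 1 * c i b x v)"
      if i: "i \<in> J" and x: "x \<in> Z" for i x
    proof -
      have "P i x - P i v = (\<Sum>j\<le>n. (x j - v j) * c i j x v)"
        using dq[OF i] by (simp only: diff_quot_def)
      moreover have "P i x = 0" "P i v = 0" "x a = 1" using x i PX[OF i v] by (auto simp: Z_def)
      ultimately have "(x b - v b) * c i b x v + (\<Sum>j\<in>J. (x j - v j) * c i j x v) = 0"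
        using va by (simp add: sum_split)
      then have "(\<Sum>j\<in>J. (x j - v j) * c i j x v) = - ((x b - v b) * c i b x v)"
        by (metis add.commute add_eq_0_iff)
      then show ?thesis by (simp add: mult.commute)
    qed
  qed
  then show thesis using that by blast
qed

lemma cone_in_Z: "x \<in> cone_pts n X \<Longrightarrow> x a = 1 \<Longrightarrow> x \<in> Z"
  using PX cone_cspace by (auto simp: Z_def)

lemma \<psi>_in_Z: "z \<in> ball 0 \<rho> \<Longrightarrow> \<psi> z \<in> Z"
  using \<psi>_cspace \<psi>_a \<psi>_zero by (auto simp: Z_def)

lemma pfun_\<psi>_tendsto: "pfun n R \<Longrightarrow> ((\<lambda>z. R (\<psi> z)) \<longlongrightarrow> R v) (at 0)"
proof -
  assume "pfun n R"
  then have "(\<lambda>z. R (\<psi> z)) holomorphic_on ball 0 \<rho>" using \<psi>_holomorphic by (rule pfun_holomorphic)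
  then have "isCont (\<lambda>z. R (\<psi> z)) 0"
    using \<rho>(1) holomorphic_on_imp_continuous_on continuous_on_eq_continuous_at[OF open_ball] by (metis centre_in_ball)
  then show ?thesis using \<psi>_origin by (simp add: isCont_def)
qed

text \<open>A function of order \<open>N\<close> along the curve \<open>\<psi>\<close> is, up to a unit at \<open>v\<close>, the \<open>N\<close>-th power of the
  local parameter.\<close>

lemma divide_by_parameter:
  assumes Q: "pfun n Q" "Q v = 1" and e: "\<And>j. j \<in> J \<Longrightarrow> pfun n (e j)"
    "\<And>j x. j \<in> J \<Longrightarrow> x \<in> Z \<Longrightarrow> Q x * (x j - v j) = (x b - v b) * e j x"
    and "pfun n R" "\<forall>\<^sub>F z in at 0. R (\<psi> z) = z ^ N * s z" "(s \<longlongrightarrow> L) (at 0)" "L \<noteq> 0"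
  shows "\<exists>R' k. pfun n R' \<and> R' v \<noteq> 0 \<and> (\<forall>x\<in>Z. Q x ^ k * R x = (x b - v b) ^ N * R' x)"
  using assms(5-)
proof (induction N arbitrary: R s L)
  case 0
  have "(s \<longlongrightarrow> R v) (at 0)"
    using pfun_\<psi>_tendsto[OF 0(1)] 0(2) by (simp add: tendsto_cong)
  then have "R v \<noteq> 0" using 0(3,4) tendsto_unique[of "at (0::complex)"] by auto
  then show ?case using 0(1) by (intro exI[of _ R] exI[of _ 0]) simp
next
  case (Suc N)
  obtain d where d: "diff_quot n R d" using exists_diff_quot Suc.prems(1) by blast
  have "((\<lambda>z. z ^ Suc N * s z) \<longlongrightarrow> 0 ^ Suc N * L) (at 0)"
    by (intro tendsto_intros Suc.prems(3))
  then have "((\<lambda>z. R (\<psi> z)) \<longlongrightarrow> 0) (at 0)"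
    using Suc.prems(2) by (simp add: tendsto_cong)
  then have "R v = 0"
    using pfun_\<psi>_tendsto[OF Suc.prems(1)] tendsto_unique[of "at (0::complex)"] by auto
  \<comment> \<open>Writing \<open>R\<close> by difference quotients at \<open>v\<close> and
    replacing each \<open>x j - v j\<close> by its multiple of \<open>x b - v b\<close> extracts one
    factor \<open>x b - v b\<close> at the cost of one factor \<open>Q\<close>.\<close>
  define R1 where "R1 x = (\<Sum>j\<in>J. e j x * d j x v) + Q x * d b x v" for x
  have pd: "pfun n (\<lambda>x. d j x v)" for j using d by (auto simp: diff_quot_def)
  have pR1: "pfun n R1"
    unfolding R1_def using pd e(1) Q(1) by (auto intro!: pfun.intros pfun_sum)
  have QR: "Q x * R x = (x b - v b) * R1 x" if x: "x \<in> Z" for x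
  proof -
    have "R x - R v = (\<Sum>j\<le>n. (x j - v j) * d j x v)"
      using d by (simp only: diff_quot_def)
    then have "R x = (x b - v b) * d b x v + (\<Sum>j\<in>J. (x j - v j) * d j x v)"
      using \<open>R v = 0\<close> va x by (simp add: sum_split Z_def)
    then have "Q x * R x = Q x * ((x b - v b) * d b x v) + (\<Sum>j\<in>J. (Q x * (x j - v j)) * d j x v)"
      by (simp add: distrib_left sum_distrib_left mult.assoc)
    also have "(\<Sum>j\<in>J. (Q x * (x j - v j)) * d j x v) = (\<Sum>j\<in>J. (x b - v b) * (e j x * d j x v))"
      using e(2)[OF _ x] by (intro sum.cong) (simp_all add: mult.assoc)
    finally show ?thesis
      by (simp add: R1_def distrib_left sum_distrib_left mult.left_commute)
  qed
  have "\<forall>\<^sub>F z in at 0. z \<in> ball 0 \<rho> \<and> z \<noteq> 0"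
    using \<rho>(1) by (auto simp: eventually_at dist_commute intro!: exI[of _ \<rho>])
  \<comment> \<open>Cancelling one \<open>z\<close> lowers the order along the arc by one; the new
    cofactor \<open>Q (\<psi> z) * s z\<close> still has a nonzero limit because
    \<open>Q v = 1\<close>.\<close>
  with Suc.prems(2) have "\<forall>\<^sub>F z in at 0. R1 (\<psi> z) = z ^ N * (Q (\<psi> z) * s z)"
  proof eventually_elim
    case (elim z)
    then have "Q (\<psi> z) * (z ^ Suc N * s z) = z * R1 (\<psi> z)"
      using QR[OF \<psi>_in_Z[of z]] by (simp add: \<psi>_b)
    then have "z * (z ^ N * (Q (\<psi> z) * s z)) = z * R1 (\<psi> z)" by (simp add: mult_ac)
    then show ?case using elim by simp
  qed
  moreover have "((\<lambda>z. Q (\<psi> z) * s z) \<longlongrightarrow> Q v * L) (at 0)"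
    by (intro tendsto_mult pfun_\<psi>_tendsto Q Suc.prems)
  ultimately obtain R' k where R': "pfun n R'" "R' v \<noteq> 0"
    "\<forall>x\<in>Z. Q x ^ k * R1 x = (x b - v b) ^ N * R' x"
    using Suc.IH[OF pR1, of "\<lambda>z. Q (\<psi> z) * s z" "Q v * L"] Q(2) Suc.prems(4) by auto
  have "Q x ^ Suc k * R x = (x b - v b) ^ Suc N * R' x" if x: "x \<in> Z" for x
  proof -
    have "Q x ^ Suc k * R x = Q x ^ k * (Q x * R x)" by (simp add: mult_ac)
    also have "\<dots> = (x b - v b) * (Q x ^ k * R1 x)" unfolding QR[OF x] by (rule mult.left_commute)
    also have "\<dots> = (x b - v b) * ((x b - v b) ^ N * R' x)" using R'(3) x by simp
    finally show ?thesis by (simp only: power_Suc mult.assoc)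
  qed
  then show ?case using R'(1,2) by blast
qed

text \<open>Otherwise \<open>R\<close> has a finite order \<open>N\<close> along the arc, and
  \<open>Q ^ k * R = (x b - v b) ^ N * R'\<close> on \<open>Z\<close> with \<open>R' v\<close>
  nonzero. On the curve the left side vanishes, so by irreducibility \<open>x b\<close> is constant
  there, and then so are all other coordinates: the curve would be a single point.\<close>

lemma \<psi>_vanishing:
  assumes R: "pfun n R" "\<And>x. x \<in> cone_pts n X \<Longrightarrow> x a = 1 \<Longrightarrow> R x = 0" and z: "z \<in> ball 0 \<rho>"
  shows "R (\<psi> z) = 0"
proof (rule ccontr)
  assume nz: "R (\<psi> z) \<noteq> 0"
  have hol: "(\<lambda>z. R (\<psi> z)) holomorphic_on ball 0 \<rho>"
    using R(1) \<psi>_holomorphic by (rule pfun_holomorphic)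
  have z0: "R (\<psi> 0) = 0" using R(2)[OF v va] \<psi>_origin by simp
  have nc: "\<not> (\<lambda>z. R (\<psi> z)) constant_on ball 0 \<rho>"
  proof
    assume "(\<lambda>z. R (\<psi> z)) constant_on ball 0 \<rho>"
    then obtain y where "\<And>w. w \<in> ball 0 \<rho> \<Longrightarrow> R (\<psi> w) = y" by (auto simp: constant_on_def)
    from this[OF z] this[of 0] show False using nz z0 \<rho>(1) by simp
  qed
  have "0 \<in> ball 0 \<rho>" using \<rho>(1) by simp
  obtain g r N where g: "0 < (N::nat)" "0 < r" "ball (0::complex) r \<subseteq> ball 0 \<rho>" "g holomorphic_on ball 0 r"
    "\<And>w. w \<in> ball 0 r \<Longrightarrow> R (\<psi> w) = (w - 0) ^ N * g w" "\<And>w. w \<in> ball 0 r \<Longrightarrow> g w \<noteq> 0"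
    by (rule holomorphic_factor_zero_nonconstant[OF hol open_ball connected_ball \<open>0 \<in> ball 0 \<rho>\<close> z0 nc])
      blast
  have "isCont g 0"
    using g(2,4) holomorphic_on_imp_continuous_on continuous_on_eq_continuous_at[OF open_ball]
    by (metis centre_in_ball)
  then have lim: "(g \<longlongrightarrow> g 0) (at 0)" by (simp add: isCont_def)
  have ev: "\<forall>\<^sub>F w in at 0. R (\<psi> w) = w ^ N * g w"
    using g(2,5) unfolding eventually_at by (intro exI[of _ r]) (auto simp: dist_norm)
  obtain Q e where Q: "pfun n Q" "Q v = 1" and e: "\<And>j. j \<in> J \<Longrightarrow> pfun n (e j)"
    "\<And>j x. j \<in> J \<Longrightarrow> x \<in> Z \<Longrightarrow> Q x * (x j - v j) = (x b - v b) * e j x"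
    using eliminate by blast
  have "g 0 \<noteq> 0" using g(2,6) by simp
  from divide_by_parameter[OF Q e R(1) ev lim this]
  obtain R' k where R': "pfun n R'" "R' v \<noteq> 0" "\<forall>x\<in>Z. Q x ^ k * R x = (x b - v b) ^ N * R' x"
    by blast
  have pt: "pfun n (\<lambda>x. x b - v b)" by (intro pfun_diff pfun.intros b)
  have "(\<forall>x\<in>cone_pts n X. x a = 1 \<longrightarrow> (x b - v b) ^ N = 0) \<or> (\<forall>x\<in>cone_pts n X. x a = 1 \<longrightarrow> R' x = 0)"
  proof (rule curve_pfun_irreducible[OF X a pfun_power[OF pt] R'(1)])
    fix x assume "x \<in> cone_pts n X" "x a = 1"
    then show "(x b - v b) ^ N * R' x = 0" using R'(3) R(2) cone_in_Z by fastforce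
  qed
  then have xb: "x b = v b" if "x \<in> cone_pts n X" "x a = 1" for x
    using R'(2) v va that by auto
  have xj: "x j = v j" if "x \<in> cone_pts n X" "x a = 1" "j \<in> J" for x j
  proof -
    have "(\<forall>x\<in>cone_pts n X. x a = 1 \<longrightarrow> Q x = 0) \<or> (\<forall>x\<in>cone_pts n X. x a = 1 \<longrightarrow> x j - v j = 0)"
    proof (rule curve_pfun_irreducible[OF X a Q(1)])
      show "pfun n (\<lambda>x. x j - v j)" using that(3) by (intro pfun_diff pfun.intros) (auto simp: J_iff)
      fix x assume "x \<in> cone_pts n X" "x a = 1"
      then show "Q x * (x j - v j) = 0" using e(2)[OF that(3) cone_in_Z] xb by simp
    qed
    then show ?thesis using Q(2) v va that by auto
  qed
  have only: "x = v" if x: "x \<in> cone_pts n X" "x a = 1" for x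
  proof
    fix j
    show "x j = v j"
      using xb[OF x] xj[OF x, of j] x(2) va cone_cspace[OF x(1)] v_cspace
      by (cases "j \<le> n"; cases "j = a"; cases "j = b") (auto simp: J_iff cspace_def)
  qed
  have pv: "pfun n (\<lambda>x. x j)" if "j \<le> n" for j using that by (rule pfun.intros)
  txt \<open>The part of the curve at infinity is a closed subset, so irreducibility leaves only the point itself.\<close>
  define A where "A = form_locus n {\<lambda>x. x a}"
  define B where "B = form_locus n ((\<lambda>j x. x j - v j * x a) ` {..n})"
  have fa: "hform UNIV n 1 (\<lambda>x. x a)" using a by (rule hform_var)
  have fb: "hform UNIV n 1 (\<lambda>x. x j - v j * x a)" if "j \<le> n" for j
    using that a by (intro hform_diff hform_scaleI hform_var) auto
  have A: "line x \<in> A \<longleftrightarrow> x a = 0" if "x \<in> cone_pts n X" for x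
    unfolding A_def using fa that by (rule line_in_form_locus_single)
  have "\<forall>g\<in>(\<lambda>j x. x j - v j * x a) ` {..n}. \<exists>K d. hform K n d g"
    using fb by blast
  from line_in_form_locus[OF this]
  have B: "line x \<in> B \<longleftrightarrow> (\<forall>j\<le>n. x j - v j * x a = 0)" if "x \<in> cone_pts n X" for x
    unfolding B_def using cone_cspace[OF that] cone_nonzero[OF that] by auto
  have cl: "zariski_closed n A" "zariski_closed n B"
    unfolding A_def B_def using fa fb by (intro zariski_closed_form_locus; blast)+
  have pt_eq: "line x = line v" if x: "x \<in> cone_pts n X" "x a \<noteq> 0" for x
  proof -
    have "(\<lambda>i. (1 / x a) * x i) = v"
      using x cone_scale[OF x(1), of "1 / x a"] by (intro only) auto
    then show ?thesis using line_scale[of "1 / x a" x] x(2) by simp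
  qed
  have "line v \<in> B" using B[OF v] va by simp
  have "X \<subseteq> A \<union> B"
  proof
    fix p assume "p \<in> X"
    then obtain x where x: "x \<in> cone_pts n X" "p = line x"
      using in_points_cone[OF real_curve_subset[OF X]] by blast
    then show "p \<in> A \<union> B"
      using A[OF x(1)] pt_eq[OF x(1)] \<open>line v \<in> B\<close> by (cases "x a = 0") auto
  qed
  then have "X \<subseteq> A \<or> X \<subseteq> B"
    by (rule real_curve_irreducible[OF X cl])
  then have "X \<subseteq> B" using A[OF v] va cone_line[OF v] by auto
  have "line x = line v" if x: "x \<in> cone_pts n X" for x
  proof (rule pt_eq[OF x])
    show "x a \<noteq> 0"
      using B[OF x] \<open>X \<subseteq> B\<close> cone_line[OF x] exists_nonzero_coord[OF cone_cspace[OF x] cone_nonzero[OF x]]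
      by (metis diff_zero mult_zero_right subsetD)
  qed
  then have "X \<subseteq> {line v}"
    using in_points_cone[OF real_curve_subset[OF X]] by (metis singletonI subsetI)
  then have "X = {line v}"
    using cone_line[OF v] by (intro equalityI) simp_all
  then show False using curve_not_point[OF X] by simp
qed

text \<open>The forms defining \<open>X\<close> vanish on the curve, and
  \<open>\<psi>_vanishing\<close> carries this over to the arc.\<close>

lemma \<psi>_in_cone: assumes z: "z \<in> ball 0 \<rho>" shows "\<psi> z \<in> cone_pts n X"
proof -
  obtain S where S: "\<forall>g\<in>S. \<exists>d. hform \<real> n d g" "X = form_locus n S"
    using X[unfolded real_curve_def, THEN conjunct1, unfolded real_zariski_closed_iff] by (elim exE conjE)
  have ex: "\<forall>g\<in>S. \<exists>K d. hform K n d g" using S(1) by blast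
  have "\<psi> z \<noteq> 0" using \<psi>_a[of z] by auto
  moreover have "g (\<psi> z) = 0" if g: "g \<in> S" for g
  proof (rule \<psi>_vanishing[OF _ _ z])
    show "pfun n g" using S(1) g hform_imp_pfun by blast
    fix x assume x: "x \<in> cone_pts n X"
    then show "g x = 0"
      using line_in_form_locus[OF ex cone_cspace[OF x] cone_nonzero[OF x]] S(2) g cone_line[OF x] by simp
  qed
  ultimately show ?thesis
    using \<psi>_cspace[of z] by (auto simp: cone_pts_def S(2) form_locus_def)
qed

end

text \<open>Reduces questions near a point of the curve to one complex variable: the arc stays on
  the curve and sweeps out all of its points close to \<open>v\<close>.\<close>

theorem local_parametrization:
  assumes X: "real_curve n X" and v: "v \<in> cone_pts n X" "a \<le> n" "v a = 1"
  obtains b \<rho> \<eta> \<psi> where "b \<le> n" "b \<noteq> a" "\<rho> > 0" "\<eta> > 0" "\<psi> 0 = v"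
    "\<And>j. (\<lambda>z. \<psi> z j) holomorphic_on ball 0 \<rho>"
    "\<And>z. z \<in> ball 0 \<rho> \<Longrightarrow> \<psi> z \<in> cone_pts n X"
    "\<And>z. z \<in> ball 0 \<rho> \<Longrightarrow> \<psi> z a = 1"
    "\<And>z. z \<in> ball 0 \<rho> \<Longrightarrow> \<psi> z b = v b + z"
    "\<And>x. x \<in> cone_pts n X \<Longrightarrow> x a = 1 \<Longrightarrow> (\<And>j. j \<le> n \<Longrightarrow> norm (x j - v j) < \<eta>) \<Longrightarrow>
       norm (x b - v b) < \<rho> \<and> x = \<psi> (x b - v b)"
proof -
  from defining_equations[OF X v]
  obtain b P c where *: "b \<le> n" "b \<noteq> a"
    "\<And>i. i \<in> {..n} - {a, b} \<Longrightarrow> diff_quot n (P i) (c i)"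
    "\<And>i. i \<in> {..n} - {a, b} \<Longrightarrow> pfun n (P i)"
    "\<And>i x. i \<in> {..n} - {a, b} \<Longrightarrow> x \<in> cone_pts n X \<Longrightarrow> P i x = 0"
    "\<And>i j. i \<in> {..n} - {a, b} \<Longrightarrow> j \<in> {..n} - {a, b} \<Longrightarrow> c i j v v = (if i = j then 1 else 0)"
    by blast
  interpret curve_chart n X v a b P c "{..n} - {a, b}"
    using X v * by unfold_locales auto
  show thesis
  \<comment> \<open>The radius \<open>\<rho>\<close> also serves as the size of the box, since
    \<open>\<rho> \<le> \<eta>0\<close>.\<close>
  proof (rule that[of b \<rho> \<rho> \<psi>])
    fix x assume x: "x \<in> cone_pts n X" "x a = 1" "\<And>j. j \<le> n \<Longrightarrow> norm (x j - v j) < \<rho>"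
    have "x \<in> box_around n v \<eta>0"
      using x(3) \<rho>(2) cone_cspace[OF x(1)] unfolding box_around_def by force
    then show "norm (x b - v b) < \<rho> \<and> x = \<psi> (x b - v b)"
      using x *(1) PX[OF _ x(1)] by (intro conjI \<psi>_unique) auto
  qed (use * \<rho>(1) \<psi>_origin \<psi>_holomorphic \<psi>_in_cone \<psi>_a \<psi>_b in auto)
qed

section \<open>The classical topology\<close>

text \<open>Conditions on representatives that do not depend on the choice made; for these, openness
  among vectors passes to openness among points.\<close>

definition scale_inv :: "(cvec \<Rightarrow> bool) \<Rightarrow> bool" where
  "scale_inv R \<longleftrightarrow> (\<forall>v c. c \<noteq> 0 \<longrightarrow> R v \<longrightarrow> R (\<lambda>i. c * v i))"

definition proj_set :: "nat \<Rightarrow> (cvec \<Rightarrow> bool) \<Rightarrow> cpoint set" where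
  "proj_set n R = line ` {v \<in> cspace n - {0}. R v}"

lemma line_in_proj_set:
  assumes "scale_inv R" "v \<in> cspace n" "v \<noteq> 0"
  shows "line v \<in> proj_set n R \<longleftrightarrow> R v"
proof
  assume "line v \<in> proj_set n R"
  then obtain w where w: "w \<in> cspace n" "w \<noteq> 0" "R w" "line v = line w"
    by (auto simp: proj_set_def)
  then obtain c where "c \<noteq> 0" "v = (\<lambda>i. c * w i)"
    using line_eq_iff[of w v] assms(3) by auto
  then show "R v" using assms(1) w(3) by (simp add: scale_inv_def)
qed (use assms in \<open>auto simp: proj_set_def\<close>)

lemma openin_proj_set:
  assumes "scale_inv R" "open {v. R v}"
  shows "openin (proj_topology n) (proj_set n R)"
  unfolding openin_proj_topology
proof
  show "proj_set n R \<subseteq> proj_space n" by (auto simp: proj_set_def proj_space_def)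
  have "{v \<in> cspace n - {0}. line v \<in> proj_set n R} = (cspace n - {0}) \<inter> {v. R v}"
    using line_in_proj_set[OF assms(1)] by auto
  then show "openin (top_of_set (cspace n - {0})) {v \<in> cspace n - {0}. line v \<in> proj_set n R}"
    using assms(2) by (simp add: openin_open_Int)
qed

lemma proj_space_line: "p \<in> proj_space n \<Longrightarrow> \<exists>v\<in>cspace n - {0}. p = line v"
  by (auto simp: proj_space_def)

lemma continuous_map_line: "continuous_map (top_of_set (cspace n - {0})) (proj_topology n) line"
  unfolding continuous_map_def topspace_proj_topology
  by (auto simp: proj_space_def openin_proj_topology)

text \<open>Dividing a representative by a coordinate of maximal modulus lands in \<open>K\<close>,
  the vectors with coordinates in closed unit discs and one coordinate equal to 1. So projective
  space is a continuous image of a compact set.\<close>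

lemma compact_space_proj: "compact_space (proj_topology n)"
proof -
  define B where "B = (\<Pi>\<^sub>E i\<in>(UNIV :: nat set). if i \<le> n then cball (0::complex) 1 else {0})"
  define K where "K = B \<inter> (\<Union>i\<in>{..n}. {v. v i = 1})"
  have "compactin (product_topology (\<lambda>i. euclidean) UNIV) B"
    unfolding B_def compactin_PiE by auto
  then have "compact B"
    by (simp add: euclidean_product_topology)
  moreover have "closed (\<Union>i\<in>{..n}. {v :: cvec. v i = 1})"
    by (intro closed_UN ballI closed_Collect_eq continuous_intros) auto
  ultimately have "compact K" unfolding K_def by (rule compact_Int_closed)
  have K: "K \<subseteq> cspace n - {0}"
  proof
    fix v assume v: "v \<in> K"
    then have "v \<in> B" "\<exists>i. v i = 1" unfolding K_def by auto
    then obtain i where "v i = 1" by blast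
    then have "v \<noteq> 0" by (intro notI) simp
    moreover have "v i = 0" if "i > n" for i
      using PiE_mem[OF \<open>v \<in> B\<close>[unfolded B_def], of i] that by simp
    then have "v \<in> cspace n" by (simp add: cspace_def)
    ultimately show "v \<in> cspace n - {0}" by simp
  qed
  have "compactin (top_of_set (cspace n - {0})) K"
    using \<open>compact K\<close> K by (simp add: compactin_subtopology)
  from image_compactin[OF this continuous_map_line]
  have "compactin (proj_topology n) (line ` K)" .
  moreover have "line ` K = proj_space n"
  proof
    show "line ` K \<subseteq> proj_space n" using K by (auto simp: proj_space_def)
    show "proj_space n \<subseteq> line ` K"
    proof
      fix p assume "p \<in> proj_space n"
      then obtain v where v: "v \<in> cspace n" "v \<noteq> 0" "p = line v" using proj_space_line by blast
      have "Max ((\<lambda>i. norm (v i)) ` {..n}) \<in> (\<lambda>i. norm (v i)) ` {..n}" by (intro Max_in) auto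
      then obtain m where m0: "m \<le> n" "Max ((\<lambda>i. norm (v i)) ` {..n}) = norm (v m)" by (elim imageE) simp
      have m: "m \<le> n" "\<And>i. i \<le> n \<Longrightarrow> norm (v i) \<le> norm (v m)"
        using m0(1) unfolding m0(2)[symmetric] by (auto intro!: Max_ge)
      obtain i where "i \<le> n" "v i \<noteq> 0" using exists_nonzero_coord v by blast
      then have "norm (v m) > 0" using m(2)[of i] by (metis norm_le_zero_iff not_le order_trans)
      then have vm: "v m \<noteq> 0" by simp
      define w where "w = (\<lambda>i. (1 / v m) * v i)"
      have "norm (w i) \<le> 1" if "i \<le> n" for i
        using m(2)[OF that] vm by (simp add: w_def norm_mult norm_divide divide_le_eq_1)
      moreover have "w i = 0" if "i > n" for i
        using that v(1) by (simp add: w_def cspace_def)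
      moreover have "w m = 1" using vm by (simp add: w_def)
      ultimately have "w \<in> K" using m(1) by (auto simp: K_def B_def)
      moreover have "line w = p" unfolding w_def v(3) using vm by (intro line_scale) simp
      ultimately show "p \<in> line ` K" by blast
    qed
  qed
  ultimately show ?thesis by (simp add: compact_space_def topspace_proj_topology)
qed

text \<open>\<open>D v x\<close> adds the absolute values of the 2x2 minors of \<open>v\<close> and
  \<open>x\<close> and vanishes only for \<open>x\<close> on the line of \<open>v\<close>. The
  points closer to \<open>v\<close> than to \<open>w\<close> in this sense, and those closer to
  \<open>w\<close>, separate the two lines; both quantities scale by the same factor.\<close>

lemma Hausdorff_space_proj: "Hausdorff_space (proj_topology n)"
  unfolding Hausdorff_space_def topspace_proj_topology
proof (intro allI impI, elim conjE)
  fix p q assume pq: "p \<in> proj_space n" "q \<in> proj_space n" "p \<noteq> q"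
  obtain v where v: "v \<in> cspace n" "v \<noteq> 0" "p = line v" using proj_space_line pq(1) by blast
  obtain w where w: "w \<in> cspace n" "w \<noteq> 0" "q = line w" using proj_space_line pq(2) by blast
  define D where "D v x = (\<Sum>i\<le>n. \<Sum>j\<le>n. norm (x i * v j - x j * v i))" for v x :: cvec
  have Ds: "D u (\<lambda>i. c * x i) = norm c * D u x" for u c x
  proof -
    have "norm (c * x i * u j - c * x j * u i) = norm c * norm (x i * u j - x j * u i)" for i j
      unfolding norm_mult[symmetric] by (simp add: right_diff_distrib mult.assoc)
    then show ?thesis by (simp add: D_def sum_distrib_left)
  qed
  have Dc: "continuous_on UNIV (D u)" for u
    unfolding D_def by (intro continuous_intros) auto
  have D0: "D u u = 0" for u by (simp add: D_def mult.commute)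
  have Dpos: "D u x > 0" if ux: "u \<in> cspace n" "u \<noteq> 0" "x \<in> cspace n" "x \<noteq> 0" "line x \<noteq> line u" for u x
  proof (rule ccontr)
    assume "\<not> D u x > 0"
    moreover have "D u x \<ge> 0" unfolding D_def by (intro sum_nonneg) auto
    ultimately have "D u x = 0" by simp
    then have eq: "x i * u j = x j * u i" if "i \<le> n" "j \<le> n" for i j
      using that unfolding D_def by (simp add: sum_nonneg_eq_0_iff sum_nonneg)
    obtain m where m: "m \<le> n" "u m \<noteq> 0" using exists_nonzero_coord ux(1,2) by blast
    have "x i = (x m / u m) * u i" for i
    proof (cases "i \<le> n")
      case True
      then show ?thesis using eq[OF True m(1)] m(2) by (simp add: field_simps)
    next
      case False then show ?thesis using ux(1,3) by (simp add: cspace_def)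
    qed
    then have "x = (\<lambda>i. (x m / u m) * u i)" by blast
    then have "x \<in> line u" unfolding in_line by (rule exI)
    then show False using line_eqD ux(4,5) by blast
  qed
  define R where "R = (\<lambda>x. D v x < D w x)"
  define R' where "R' = (\<lambda>x. D w x < D v x)"
  have "scale_inv R" "scale_inv R'" unfolding scale_inv_def R_def R'_def Ds by simp_all
  moreover have "open {x. R x}" "open {x. R' x}"
    unfolding R_def R'_def by (intro open_Collect_less Dc)+
  ultimately have op: "openin (proj_topology n) (proj_set n R)" "openin (proj_topology n) (proj_set n R')"
    using openin_proj_set by blast+
  have "R v" using Dpos[of w v] pq(3) v w by (simp add: R_def D0)
  moreover have "R' w" using Dpos[of v w] pq(3) v w by (simp add: R'_def D0)
  ultimately have "p \<in> proj_set n R" "q \<in> proj_set n R'"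
    using v w by (simp_all add: line_in_proj_set[OF \<open>scale_inv R\<close>] line_in_proj_set[OF \<open>scale_inv R'\<close>])
  moreover have "disjnt (proj_set n R) (proj_set n R')"
    unfolding disjnt_iff
  proof (intro allI notI, elim conjE)
    fix y assume y: "y \<in> proj_set n R" "y \<in> proj_set n R'"
    then obtain x where x: "x \<in> cspace n" "x \<noteq> 0" "y = line x" "R x" by (auto simp: proj_set_def)
    then have "R' x" using y(2) line_in_proj_set[OF \<open>scale_inv R'\<close>] by blast
    then show False using x(4) by (simp add: R_def R'_def)
  qed
  ultimately show "\<exists>U V. openin (proj_topology n) U \<and> openin (proj_topology n) V \<and> p \<in> U \<and> q \<in> V \<and> disjnt U V"
    using op by blast
qed

lemma closedin_proj_set:
  assumes "scale_inv (\<lambda>v. \<not> R v)" "scale_inv R" "closed {v. R v}"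
  shows "closedin (proj_topology n) (proj_set n R)"
proof -
  have "proj_space n - proj_set n R = proj_set n (\<lambda>v. \<not> R v)"
  proof (rule set_eqI)
    fix p
    show "p \<in> proj_space n - proj_set n R \<longleftrightarrow> p \<in> proj_set n (\<lambda>v. \<not> R v)"
    proof (cases "p \<in> proj_space n")
      case True
      then obtain v where v: "v \<in> cspace n" "v \<noteq> 0" "p = line v" using proj_space_line by blast
      then show ?thesis using True line_in_proj_set[OF assms(1) v(1,2)] line_in_proj_set[OF assms(2) v(1,2)] by simp
    qed (auto simp: proj_set_def proj_space_def)
  qed
  moreover have "open {v. \<not> R v}" using assms(3) by (simp add: closed_def Collect_neg_eq)
  ultimately show ?thesis
    using openin_proj_set[OF assms(1)]
    by (auto simp: closedin_def topspace_proj_topology proj_set_def proj_space_def)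
qed

lemma closedin_form_locus:
  assumes "\<And>g. g \<in> S \<Longrightarrow> \<exists>K d. hform K n d g"
  shows "closedin (proj_topology n) (form_locus n S)"
proof -
  have "form_locus n S = proj_set n (\<lambda>v. \<forall>g\<in>S. g v = 0)" by (simp add: form_locus_def proj_set_def)
  moreover have sc: "g (\<lambda>i. c * v i) = 0 \<longleftrightarrow> g v = 0" if "g \<in> S" "c \<noteq> 0" for g c v
    using assms[OF that(1)] hform_scale that(2) by fastforce
  moreover have "closed {v. \<forall>g\<in>S. g v = 0}"
  proof -
    have "{v. \<forall>g\<in>S. g v = 0} = (\<Inter>g\<in>S. {v. g v = 0})" by auto
    moreover have "closed {v. g v = 0}" if "g \<in> S" for g
      using assms[OF that] hform_continuous by (intro closed_Collect_eq continuous_on_const) blast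
    ultimately show ?thesis by auto
  qed
  ultimately show ?thesis
    by (simp add: closedin_proj_set scale_inv_def)
qed

text \<open>Instead of dividing by a nonzero coordinate one multiplies with its conjugate, which
  makes realness a closed, scale-invariant condition on representatives.\<close>

lemma line_in_real_proj_space:
  assumes v: "v \<in> cspace n" "v \<noteq> 0"
  shows "line v \<in> real_proj_space n \<longleftrightarrow> (\<forall>i j. Im (v i * cnj (v j)) = 0)"
proof
  assume "line v \<in> real_proj_space n"
  then obtain w where w: "w \<noteq> 0" "\<forall>i. w i \<in> \<real>" "line v = line w" by (auto simp: real_proj_space_def)
  then obtain c where c: "v = (\<lambda>i. c * w i)" using line_eq_iff[of w v] v by auto
  have "v i * cnj (v j) = (c * cnj c) * (w i * w j)" for i j
    using w(2) by (simp add: c Reals_cnj_iff)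
  moreover have "c * cnj c \<in> \<real>" by (simp add: complex_mult_cnj)
  ultimately have "v i * cnj (v j) \<in> \<real>" for i j
    using w(2) by auto
  then show "\<forall>i j. Im (v i * cnj (v j)) = 0" by (simp add: complex_is_Real_iff)
next
  assume im: "\<forall>i j. Im (v i * cnj (v j)) = 0"
  obtain m where m: "m \<le> n" "v m \<noteq> 0" using exists_nonzero_coord v by blast
  define w where "w = (\<lambda>i. cnj (v m) * v i)"
  have "w i \<in> \<real>" for i unfolding w_def using im complex_is_Real_iff by (simp add: mult.commute)
  moreover have "line w = line v" unfolding w_def using m(2) by (intro line_scale) simp
  moreover have "w \<in> cspace n" "w \<noteq> 0" using v m(2) unfolding w_def
    by (simp_all add: cspace_scale scale_nonzero)
  ultimately show "line v \<in> real_proj_space n"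
    unfolding real_proj_space_def by (intro image_eqI[of _ _ w]) auto
qed

lemma Im_scale: "Im ((c * x) * cnj (c * y)) = (norm c)\<^sup>2 * Im (x * cnj y)"
proof -
  have "(c * x) * cnj (c * y) = of_real ((norm c)\<^sup>2) * (x * cnj y)"
    unfolding complex_norm_square by simp
  then show ?thesis by (simp only: times_complex.sel(2)[of "of_real _"] Re_complex_of_real Im_complex_of_real mult_zero_left add_0_right)
qed

lemma closedin_real_proj_space: "closedin (proj_topology n) (real_proj_space n)"
proof -
  define R where "R v \<longleftrightarrow> (\<forall>i j. Im (v i * cnj (v j)) = 0)" for v :: cvec
  have sc: "R (\<lambda>i. c * v i) \<longleftrightarrow> R v" if "c \<noteq> 0" for c v
    unfolding R_def Im_scale using that by simp
  have "closedin (proj_topology n) (proj_set n R)"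
  proof (rule closedin_proj_set)
    show "closed {v. R v}"
      unfolding R_def by (intro closed_Collect_all closed_Collect_eq continuous_intros) auto
  qed (use sc in \<open>auto simp: scale_inv_def\<close>)
  moreover have "proj_set n R = real_proj_space n"
  proof (rule set_eqI)
    fix p
    show "p \<in> proj_set n R \<longleftrightarrow> p \<in> real_proj_space n"
    proof (cases "p \<in> proj_space n")
      case True
      then obtain v where v: "v \<in> cspace n" "v \<noteq> 0" "p = line v" using proj_space_line by blast
      have "scale_inv R" using sc by (auto simp: scale_inv_def)
      then show ?thesis
        using line_in_proj_set[OF _ v(1,2)] line_in_real_proj_space[OF v(1,2)] v(3) by (simp add: R_def)
    next
      case False
      then show ?thesis by (auto simp: proj_set_def proj_space_def real_proj_space_def)
    qed
  qed
  ultimately show ?thesis by simp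
qed

lemma closedin_real_points: assumes "real_curve n X" shows "closedin (proj_topology n) (real_points n X)"
proof -
  obtain S where S: "\<forall>g\<in>S. \<exists>d. hform \<real> n d g" "X = form_locus n S"
    using assms[unfolded real_curve_def, THEN conjunct1, unfolded real_zariski_closed_iff] by (elim exE conjE)
  have "closedin (proj_topology n) X" unfolding S(2) using S(1) by (intro closedin_form_locus) blast
  then show ?thesis unfolding real_points_def by (intro closedin_Int closedin_real_proj_space)
qed

section \<open>The sign of a separating morphism\<close>

lemma cnj_in_cone:
  assumes X: "real_curve n X" and v: "v \<in> cone_pts n X"
  shows "(\<lambda>i. cnj (v i)) \<in> cone_pts n X"
proof -
  obtain S where S: "\<forall>g\<in>S. \<exists>d. hform \<real> n d g" "X = form_locus n S"
    using X[unfolded real_curve_def, THEN conjunct1, unfolded real_zariski_closed_iff] by (elim exE conjE)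
  have ex: "\<forall>g\<in>S. \<exists>K d. hform K n d g" using S(1) by blast
  have c: "(\<lambda>i. cnj (v i)) \<in> cspace n" "(\<lambda>i. cnj (v i)) \<noteq> 0"
    using cone_cspace[OF v] cone_nonzero[OF v] by (auto simp: cspace_def fun_eq_iff)
  have "g v = 0" if "g \<in> S" for g
    using line_in_form_locus[OF ex cone_cspace[OF v] cone_nonzero[OF v]] cone_line[OF v] S(2) that by simp
  then have "g (\<lambda>i. cnj (v i)) = 0" if "g \<in> S" for g
    using S(1) that hform_cnj[of n _ g v] by fastforce
  then have "line (\<lambda>i. cnj (v i)) \<in> X"
    unfolding S(2) using line_in_form_locus[OF ex c] by simp
  then show ?thesis using c by (simp add: cone_pts_def)
qed

text \<open>\<open>Im (w 0 * cnj (w 1))\<close> has the sign of the imaginary part of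
  \<open>w 0 / w 1\<close>, so these are the points of the open upper half plane. Without the
  division the point with \<open>w 1 = 0\<close> is covered too and lies in neither half.\<close>

definition upper_point :: "cpoint \<Rightarrow> bool" where
  "upper_point p \<longleftrightarrow> (\<exists>w. w \<noteq> 0 \<and> p = line w \<and> Im (w 0 * cnj (w 1)) > 0)"

definition lower_point :: "cpoint \<Rightarrow> bool" where
  "lower_point p \<longleftrightarrow> (\<exists>w. w \<noteq> 0 \<and> p = line w \<and> Im (w 0 * cnj (w 1)) < 0)"

lemma upper_point_line: "w \<noteq> 0 \<Longrightarrow> upper_point (line w) \<longleftrightarrow> Im (w 0 * cnj (w 1)) > 0"
  and lower_point_line: "w \<noteq> 0 \<Longrightarrow> lower_point (line w) \<longleftrightarrow> Im (w 0 * cnj (w 1)) < 0"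
proof -
  have *: "\<exists>c. c \<noteq> 0 \<and> u = (\<lambda>i. c * w i)" if "w \<noteq> 0" "u \<noteq> 0" "line w = line u" for u
    using line_eq_iff that by blast
  show "upper_point (line w) \<longleftrightarrow> Im (w 0 * cnj (w 1)) > 0" if "w \<noteq> 0"
  proof
    assume "upper_point (line w)"
    then obtain u where u: "u \<noteq> 0" "line w = line u" "Im (u 0 * cnj (u 1)) > 0"
      by (auto simp: upper_point_def)
    then obtain c where "u = (\<lambda>i. c * w i)" using * \<open>w \<noteq> 0\<close> by blast
    then show "Im (w 0 * cnj (w 1)) > 0" using u(3) by (simp only: Im_scale zero_less_mult_iff) (auto simp: not_less)
  qed (use that in \<open>auto simp: upper_point_def\<close>)
  show "lower_point (line w) \<longleftrightarrow> Im (w 0 * cnj (w 1)) < 0" if "w \<noteq> 0"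
  proof
    assume "lower_point (line w)"
    then obtain u where u: "u \<noteq> 0" "line w = line u" "Im (u 0 * cnj (u 1)) < 0"
      by (auto simp: lower_point_def)
    then obtain c where "u = (\<lambda>i. c * w i)" using * \<open>w \<noteq> 0\<close> by blast
    then show "Im (w 0 * cnj (w 1)) < 0" using u(3) by (simp only: Im_scale mult_less_0_iff) (auto simp: not_less)
  qed (use that in \<open>auto simp: lower_point_def\<close>)
qed

lemma real_point_iff:
  assumes "w \<in> cspace 1" "w \<noteq> 0"
  shows "line w \<in> real_proj_space 1 \<longleftrightarrow> Im (w 0 * cnj (w 1)) = 0"
proof -
  have "Im (w i * cnj (w j)) = 0" if "Im (w 0 * cnj (w 1)) = 0" for i j
  proof (cases "i \<le> 1 \<and> j \<le> 1")
    case True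
    then consider "i = 0" "j = 0" | "i = 0" "j = 1" | "i = 1" "j = 0" | "i = 1" "j = 1" by linarith
    then show ?thesis using that by cases (auto simp: mult.commute)
  qed (use assms in \<open>auto simp: cspace_def\<close>)
  then show ?thesis using line_in_real_proj_space[OF assms] by blast
qed

lemma vec_upto_cspace: "vec_upto m F v \<in> cspace m"
  by (simp add: cspace_def)

lemma vec_upto_nonzero: "\<exists>i\<le>m. F i v \<noteq> 0 \<Longrightarrow> vec_upto m F v \<noteq> 0"
  by (auto simp: fun_eq_iff)

lemma local_forms_1:
  assumes F: "local_forms n X 1 f d F" and v: "v \<in> cone_pts n X" and nz: "\<exists>i\<le>1. F i v \<noteq> 0"
  shows "upper_point (f (line v)) \<longleftrightarrow> Im (F 0 v * cnj (F 1 v)) > 0"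
    and "lower_point (f (line v)) \<longleftrightarrow> Im (F 0 v * cnj (F 1 v)) < 0"
    and "f (line v) \<in> real_proj_space 1 \<longleftrightarrow> Im (F 0 v * cnj (F 1 v)) = 0"
proof -
  have f: "f (line v) = line (vec_upto 1 F v)" using F v nz by (simp add: local_forms_def)
  have nz': "vec_upto 1 F v \<noteq> 0" using nz by (rule vec_upto_nonzero)
  show "upper_point (f (line v)) \<longleftrightarrow> Im (F 0 v * cnj (F 1 v)) > 0"
    "lower_point (f (line v)) \<longleftrightarrow> Im (F 0 v * cnj (F 1 v)) < 0"
    "f (line v) \<in> real_proj_space 1 \<longleftrightarrow> Im (F 0 v * cnj (F 1 v)) = 0"
    unfolding f upper_point_line[OF nz'] lower_point_line[OF nz'] real_point_iff[OF vec_upto_cspace[of 1 F v] nz']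
    by simp_all
qed

lemma morphism_local_forms:
  assumes "real_curve n X" "real_morphism n X m f" "v \<in> cone_pts n X"
  obtains d F where "local_forms n X m f d F" "\<exists>i\<le>m. F i v \<noteq> 0"
  using assms real_morphism_iff[OF real_curve_subset[OF assms(1)]] by blast

text \<open>One argument for both signs: near a point the sign is read off from fixed local forms.
  \<open>S\<close> is an open half-line without 0, so membership in \<open>S\<close> is open,
  independent of the representative, and forces the forms not to vanish together.\<close>

lemma openin_upper:
  assumes X: "real_curve n X" and f: "real_morphism n X 1 f"
  shows "openin (subtopology (proj_topology n) X) {p \<in> X. upper_point (f p)}"
    and "openin (subtopology (proj_topology n) X) {p \<in> X. lower_point (f p)}"
proof -
  have main: "openin (subtopology (proj_topology n) X) {p \<in> X. Q (f p)}"
    if S: "open S" "\<And>x c. x \<in> S \<Longrightarrow> c > 0 \<Longrightarrow> c * x \<in> S" "0 \<notin> S"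
      and Q: "\<And>d F v. local_forms n X 1 f d F \<Longrightarrow> v \<in> cone_pts n X \<Longrightarrow> \<exists>i\<le>1. F i v \<noteq> 0 \<Longrightarrow>
        Q (f (line v)) \<longleftrightarrow> Im (F 0 v * cnj (F 1 v)) \<in> S" for S :: "real set" and Q
  proof (subst openin_subopen, intro ballI)
    fix p assume p: "p \<in> {p \<in> X. Q (f p)}"
    then obtain v where v: "v \<in> cone_pts n X" "p = line v" using in_points_cone[OF real_curve_subset[OF X]] by blast
    obtain d F where F: "local_forms n X 1 f d F" and nz: "\<exists>i\<le>1. F i v \<noteq> 0"
      using morphism_local_forms[OF X f v(1)] by blast
    have hf: "hform \<real> n d (F 0)" "hform \<real> n d (F 1)" using F by (auto simp: local_forms_def)
    define R where "R = (\<lambda>x. Im (F 0 x * cnj (F 1 x)) \<in> S)"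
    have si: "scale_inv R"
      unfolding scale_inv_def R_def
    proof (intro allI impI)
      fix x and c :: complex assume "c \<noteq> 0" "Im (F 0 x * cnj (F 1 x)) \<in> S"
      then show "Im (F 0 (\<lambda>i. c * x i) * cnj (F 1 (\<lambda>i. c * x i))) \<in> S"
        unfolding hform_scale[OF hf(1)] hform_scale[OF hf(2)] Im_scale by (intro S(2)) auto
    qed
    have "{x. R x} = (\<lambda>x. Im (F 0 x * cnj (F 1 x))) -` S" by (auto simp: R_def)
    moreover have "continuous_on UNIV (\<lambda>x. Im (F 0 x * cnj (F 1 x)))"
      by (intro continuous_intros hform_continuous[OF hf(1)] hform_continuous[OF hf(2)])
    ultimately have "open {x. R x}" using S(1) open_vimage by metis
    then have op: "openin (proj_topology n) (proj_set n R)" using si by (intro openin_proj_set)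
    have eq: "line x \<in> proj_set n R \<longleftrightarrow> R x" if "x \<in> cone_pts n X" for x
      using line_in_proj_set[OF si cone_cspace[OF that] cone_nonzero[OF that]] .
    have nzR: "\<exists>i\<le>1. F i x \<noteq> 0" if "R x" for x
    proof (rule ccontr)
      assume "\<not> ?thesis"
      then have "F 0 x = 0" by auto
      then show False using that S(3) by (simp add: R_def)
    qed
    show "\<exists>T. openin (subtopology (proj_topology n) X) T \<and> p \<in> T \<and> T \<subseteq> {p \<in> X. Q (f p)}"
    proof (intro exI conjI subsetI)
      show "openin (subtopology (proj_topology n) X) (proj_set n R \<inter> X)"
        using op by (auto simp: openin_subtopology)
      show "p \<in> proj_set n R \<inter> X"
        using p v eq[OF v(1)] Q[OF F v(1) nz] by (simp add: R_def)
      fix q assume q: "q \<in> proj_set n R \<inter> X"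
      then obtain x where x: "x \<in> cone_pts n X" "q = line x" using in_points_cone[OF real_curve_subset[OF X]] by blast
      then have "R x" using q eq by simp
      then show "q \<in> {p \<in> X. Q (f p)}"
        using q x Q[OF F x(1) nzR] by (simp add: R_def)
    qed
  qed
  show "openin (subtopology (proj_topology n) X) {p \<in> X. upper_point (f p)}"
    by (rule main[of "{0<..}"]) (auto simp: local_forms_1)
  show "openin (subtopology (proj_topology n) X) {p \<in> X. lower_point (f p)}"
    by (rule main[of "{..<0}"]) (auto simp: local_forms_1 mult_less_0_iff)
qed

text \<open>Local forms have real coefficients, so conjugating the point conjugates their
  values.\<close>

lemma morphism_cnj:
  assumes X: "real_curve n X" and f: "real_morphism n X 1 f" and v: "v \<in> cone_pts n X"
  shows "upper_point (f (line (\<lambda>i. cnj (v i)))) \<longleftrightarrow> lower_point (f (line v))"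
    and "lower_point (f (line (\<lambda>i. cnj (v i)))) \<longleftrightarrow> upper_point (f (line v))"
proof -
  obtain d F where F: "local_forms n X 1 f d F" and nz: "\<exists>i\<le>1. F i v \<noteq> 0"
    using morphism_local_forms[OF X f v] by blast
  have hf: "\<And>i. i \<le> 1 \<Longrightarrow> hform \<real> n d (F i)" using F by (auto simp: local_forms_def)
  have c: "F i (\<lambda>i. cnj (v i)) = cnj (F i v)" if "i \<le> 1" for i using hf[OF that] by (rule hform_cnj)
  then have nz': "\<exists>i\<le>1. F i (\<lambda>i. cnj (v i)) \<noteq> 0" using nz by auto
  show "upper_point (f (line (\<lambda>i. cnj (v i)))) \<longleftrightarrow> lower_point (f (line v))"
    "lower_point (f (line (\<lambda>i. cnj (v i)))) \<longleftrightarrow> upper_point (f (line v))"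
    using local_forms_1[OF F v nz] local_forms_1[OF F cnj_in_cone[OF X v] nz'] c by auto
qed

lemma upper_lower_exclusive: "\<not> (upper_point p \<and> lower_point p)"
  using upper_point_line by (auto simp: lower_point_def)

lemma separating_signs:
  assumes X: "real_curve n X" and f: "separating n X f" and p: "p \<in> X"
  shows "p \<in> real_points n X \<longleftrightarrow> \<not> upper_point (f p) \<and> \<not> lower_point (f p)"
proof -
  obtain v where v: "v \<in> cone_pts n X" "p = line v" using in_points_cone[OF real_curve_subset[OF X] p] by blast
  have rm: "real_morphism n X 1 f" using f by (simp add: separating_def)
  obtain d F where F: "local_forms n X 1 f d F" and nz: "\<exists>i\<le>1. F i v \<noteq> 0"
    using morphism_local_forms[OF X rm v(1)] by blast
  have "p \<in> real_points n X \<longleftrightarrow> f p \<in> real_proj_space 1" using f p by (auto simp: separating_def)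
  then show ?thesis using local_forms_1[OF F v(1) nz] v(2) by auto
qed

lemma connectedin_two_opens:
  assumes "connectedin T C" "openin T A" "openin T B" "C \<subseteq> A \<union> B" "A \<inter> B = {}"
  shows "C \<subseteq> A \<or> C \<subseteq> B"
proof (rule ccontr)
  assume "\<not> ?thesis"
  then have "A \<inter> C \<noteq> {}" "B \<inter> C \<noteq> {}" using assms(4) by auto
  moreover have "A \<inter> B \<inter> C = {}" using assms(5) by simp
  ultimately show False
    using assms(1-4) unfolding connectedin by (elim conjE) (rule notE, assumption, intro exI[of _ A] exI[of _ B] conjI)
qed

text \<open>The nonreal points split into the open sets \<open>A\<close> of equal and
  \<open>B\<close> of opposite signs. If both were nonempty, one half would lie in \<open>A\<close>
  and the other in \<open>B\<close>. Conjugation flips both signs and so preserves \<open>A\<close>,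
  hence that half; but \<open>f\<close> has constant sign on it.\<close>

lemma dividing_signs_agree:
  assumes X: "real_curve n X" "dividing_type n X" and f: "separating n X f" and g: "separating n X g"
  shows "(\<forall>p\<in>X. (upper_point (f p) \<longleftrightarrow> upper_point (g p)) \<and> (lower_point (f p) \<longleftrightarrow> lower_point (g p))) \<or>
    (\<forall>p\<in>X. (upper_point (f p) \<longleftrightarrow> lower_point (g p)) \<and> (lower_point (f p) \<longleftrightarrow> upper_point (g p)))"
proof -
  define Y where "Y = X - real_points n X"
  define T where "T = subtopology (proj_topology n) Y"
  have Xs: "X \<subseteq> topspace (proj_topology n)"
    using real_curve_subset[OF X(1)] by (simp add: topspace_proj_topology)
  have tT: "topspace T = Y" using Xs by (auto simp: T_def Y_def topspace_subtopology)
  have rf: "real_morphism n X 1 f" and rg: "real_morphism n X 1 g"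
    using f g by (simp_all add: separating_def)
  have T: "T = subtopology (subtopology (proj_topology n) X) Y"
    by (auto simp: T_def subtopology_subtopology Y_def Int_absorb1 intro: arg_cong[where f = "subtopology (proj_topology n)"])
  have op: "openin T {p \<in> Y. upper_point (h p)}" "openin T {p \<in> Y. lower_point (h p)}"
    if "real_morphism n X 1 h" for h
  proof -
    have "{p \<in> Y. upper_point (h p)} = {p \<in> X. upper_point (h p)} \<inter> Y"
      "{p \<in> Y. lower_point (h p)} = {p \<in> X. lower_point (h p)} \<inter> Y" by (auto simp: Y_def)
    then show "openin T {p \<in> Y. upper_point (h p)}" "openin T {p \<in> Y. lower_point (h p)}"
      unfolding T using openin_upper[OF X(1) that] by (auto simp: openin_subtopology)
  qed
  have ul: "upper_point (h p) \<longleftrightarrow> \<not> lower_point (h p)" if "p \<in> Y" "separating n X h" for p h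
    using separating_signs[OF X(1) that(2), of p] that(1) upper_lower_exclusive[of "h p"] by (auto simp: Y_def)
  define A where "A = {p \<in> Y. upper_point (f p) \<longleftrightarrow> upper_point (g p)}"
  define B where "B = {p \<in> Y. upper_point (f p) \<longleftrightarrow> lower_point (g p)}"
  have "A = ({p \<in> Y. upper_point (f p)} \<inter> {p \<in> Y. upper_point (g p)}) \<union>
    ({p \<in> Y. lower_point (f p)} \<inter> {p \<in> Y. lower_point (g p)})"
    using ul f g by (auto simp: A_def)
  then have opA: "openin T A" using op[OF rf] op[OF rg] by auto
  have "B = ({p \<in> Y. upper_point (f p)} \<inter> {p \<in> Y. lower_point (g p)}) \<union>
    ({p \<in> Y. lower_point (f p)} \<inter> {p \<in> Y. upper_point (g p)})"
    using ul f g by (auto simp: B_def)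
  then have opB: "openin T B" using op[OF rf] op[OF rg] by auto
  have AB: "A \<union> B = Y" "A \<inter> B = {}" using ul[OF _ g] by (auto simp: A_def B_def)
  have "A = {} \<or> B = {}"
  proof (rule ccontr)
    assume "\<not> ?thesis"
    then obtain p q where pq: "p \<in> A" "q \<in> B" by blast
    then have Y: "p \<in> Y" "q \<in> Y" by (auto simp: A_def B_def)
    define U where "U = connected_component_of_set T p"
    define V where "V = connected_component_of_set T q"
    have pU: "p \<in> U" "q \<in> V" using Y tT by (simp_all add: U_def V_def connected_component_of_refl)
    have cU: "connectedin T U" "connectedin T V"
      by (simp_all add: U_def V_def connectedin_connected_component_of)
    have sub: "U \<subseteq> A \<or> U \<subseteq> B" "V \<subseteq> A \<or> V \<subseteq> B"
      using connectedin_two_opens[OF _ opA opB _ AB(2)] cU connectedin_subset_topspace tT AB(1) by metis+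
    have UA: "U \<subseteq> A" "V \<subseteq> B" using sub pU pq AB(2) by blast+
    have "U \<noteq> V" using UA pU AB(2) by blast
    have comps: "U \<in> connected_components_of T" "V \<in> connected_components_of T"
      using Y tT by (simp_all add: connected_components_of_def U_def V_def)
    have "card (connected_components_of T) = 2"
      using X(2) by (simp add: dividing_type_def proj_components_def T_def Y_def)
    then have "connected_components_of T = {U, V}"
      using comps \<open>U \<noteq> V\<close> by (auto simp: card_2_iff)
    then have cover: "Y = U \<union> V"
      using Union_connected_components_of[of T] tT by auto
    obtain v where v: "v \<in> cone_pts n X" "p = line v"
      using in_points_cone[OF real_curve_subset[OF X(1)], of p] Y by (auto simp: Y_def)
    define s where "s = line (\<lambda>i. cnj (v i))"
    have sX: "s \<in> X" using cone_line[OF cnj_in_cone[OF X(1) v(1)]] by (simp add: s_def)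
    note cf = morphism_cnj[OF X(1) rf v(1), folded s_def v(2)]
    note cg = morphism_cnj[OF X(1) rg v(1), folded s_def v(2)]
    have sY: "s \<in> Y"
      using separating_signs[OF X(1) f sX] separating_signs[OF X(1) f, of p] cf Y sX by (auto simp: Y_def)
    \<comment> \<open>Both signs are flipped at the conjugate point, so their agreement
      persists.\<close>
    have "s \<in> A" using pq(1) sY cf cg ul[OF Y(1) f] ul[OF Y(1) g] by (auto simp: A_def)
    then have "s \<in> U" using cover sY UA AB(2) by blast
    have "U \<subseteq> {p \<in> Y. upper_point (f p)} \<or> U \<subseteq> {p \<in> Y. lower_point (f p)}"
    proof (rule connectedin_two_opens[OF cU(1) op[OF rf]])
      show "U \<subseteq> {p \<in> Y. upper_point (f p)} \<union> {p \<in> Y. lower_point (f p)}"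
        using cover ul[OF _ f] by auto
      show "{p \<in> Y. upper_point (f p)} \<inter> {p \<in> Y. lower_point (f p)} = {}"
        using upper_lower_exclusive by auto
    qed
    then show False using \<open>s \<in> U\<close> pU(1) cf ul[OF Y(1) f] by auto
  qed
  moreover have real: "\<not> upper_point (h p) \<and> \<not> lower_point (h p)" if "p \<in> X - Y" "separating n X h" for p h
    using separating_signs[OF X(1) that(2), of p] that(1) by (auto simp: Y_def)
  ultimately show ?thesis
  proof (elim disjE)
    assume "A = {}"
    then have "Y = B" using AB by auto
    then have "(upper_point (f p) \<longleftrightarrow> lower_point (g p)) \<and> (lower_point (f p) \<longleftrightarrow> upper_point (g p))" if "p \<in> X" for p
      using real[of p f] real[of p g] f g ul[of p f] ul[of p g] that by (cases "p \<in> Y") (auto simp: B_def)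
    then show ?thesis by blast
  next
    assume "B = {}"
    then have "Y = A" using AB by auto
    then have "(upper_point (f p) \<longleftrightarrow> upper_point (g p)) \<and> (lower_point (f p) \<longleftrightarrow> lower_point (g p))" if "p \<in> X" for p
      using real[of p f] real[of p g] f g ul[of p f] ul[of p g] that by (cases "p \<in> Y") (auto simp: A_def)
    then show ?thesis by blast
  qed
qed

section \<open>Fibres over real points\<close>

text \<open>The covering argument with an angle as parameter. Finitely many of the given
  neighbourhoods cover the compact \<open>C\<close>; for close \<open>\<theta>\<close> those centred
  outside \<open>F \<theta>0\<close> contain no point of \<open>F \<theta>\<close>, and disjoint
  ones around the points of \<open>F \<theta>0\<close> contain exactly one each.\<close>

lemma fibre_card_locally_constant:
  fixes T :: "'a topology" and F :: "real \<Rightarrow> 'a set"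
  assumes C: "compactin T C" and T: "Hausdorff_space T" and F: "\<And>\<theta>. F \<theta> \<subseteq> C"
    and unique: "\<And>p N. p \<in> F \<theta>0 \<Longrightarrow> openin T N \<Longrightarrow> p \<in> N \<Longrightarrow>
      \<exists>W \<epsilon>. openin T W \<and> p \<in> W \<and> W \<subseteq> N \<and> \<epsilon> > 0 \<and> (\<forall>\<theta>. \<bar>\<theta> - \<theta>0\<bar> < \<epsilon> \<longrightarrow> (\<exists>!q. q \<in> W \<inter> F \<theta>))"
    and away: "\<And>p. p \<in> C - F \<theta>0 \<Longrightarrow>
      \<exists>W \<epsilon>. openin T W \<and> p \<in> W \<and> \<epsilon> > 0 \<and> (\<forall>\<theta>. \<bar>\<theta> - \<theta>0\<bar> < \<epsilon> \<longrightarrow> W \<inter> F \<theta> = {})"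
  shows "\<exists>\<epsilon>>0. \<forall>\<theta>. \<bar>\<theta> - \<theta>0\<bar> < \<epsilon> \<longrightarrow> finite (F \<theta>) \<and> card (F \<theta>) = card (F \<theta>0)"
proof -
  have Ctop: "C \<subseteq> topspace T" using C by (rule compactin_subset_topspace)
  have subcover: "\<exists>D. finite D \<and> D \<subseteq> C \<and> C \<subseteq> (\<Union>p\<in>D. W p)"
    if "\<forall>p\<in>C. openin T (W p) \<and> p \<in> W p" for W :: "'a \<Rightarrow> 'a set"
  proof -
    have "(\<forall>U\<in>W ` C. openin T U) \<and> C \<subseteq> \<Union>(W ` C)" using that by blast
    then obtain \<F> where "finite \<F>" "\<F> \<subseteq> W ` C" "C \<subseteq> \<Union>\<F>"
      using C unfolding compactin_def by metis
    then show ?thesis using finite_subset_image[of \<F> W C] by metis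
  qed
  have "finite (F \<theta>0)"
  proof -
    have "\<exists>W. openin T W \<and> p \<in> W \<and> finite (W \<inter> F \<theta>0)" if "p \<in> C" for p
    proof (cases "p \<in> F \<theta>0")
      case True
      have "p \<in> topspace T" using Ctop that by blast
      from unique[OF True openin_topspace this]
      obtain W \<epsilon> where "openin T W" "p \<in> W" "\<epsilon> > 0" and ex1: "\<forall>\<theta>. \<bar>\<theta> - \<theta>0\<bar> < \<epsilon> \<longrightarrow> (\<exists>!q. q \<in> W \<inter> F \<theta>)"
        by (elim exE conjE)
      have "\<exists>!q. q \<in> W \<inter> F \<theta>0" using ex1 \<open>\<epsilon> > 0\<close> by simp
      then obtain q where "\<And>y. y \<in> W \<inter> F \<theta>0 \<Longrightarrow> y = q" by (elim ex1E) blast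
      then have "W \<inter> F \<theta>0 \<subseteq> {q}" by blast
      then show ?thesis using \<open>openin T W\<close> \<open>p \<in> W\<close> finite_subset by blast
    next
      case False
      then have "p \<in> C - F \<theta>0" using that by simp
      from away[OF this]
      obtain W \<epsilon> where "openin T W" "p \<in> W" "\<epsilon> > 0" "\<forall>\<theta>. \<bar>\<theta> - \<theta>0\<bar> < \<epsilon> \<longrightarrow> W \<inter> F \<theta> = {}"
        by (elim exE conjE)
      then have "W \<inter> F \<theta>0 = {}" by simp
      then show ?thesis using \<open>openin T W\<close> \<open>p \<in> W\<close> by (intro exI[of _ W] conjI) simp_all
    qed
    then have "\<forall>p\<in>C. \<exists>W. openin T W \<and> p \<in> W \<and> finite (W \<inter> F \<theta>0)" by blast
    from bchoice[OF this]
    obtain W where W: "\<forall>p\<in>C. openin T (W p) \<and> p \<in> W p \<and> finite (W p \<inter> F \<theta>0)" by (elim exE)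
    then have "\<forall>p\<in>C. openin T (W p) \<and> p \<in> W p" by simp
    from subcover[OF this] obtain D where "finite D" "D \<subseteq> C" "C \<subseteq> (\<Union>p\<in>D. W p)" by (elim exE conjE)
    then have "F \<theta>0 \<subseteq> (\<Union>p\<in>D. W p \<inter> F \<theta>0)" using F[of \<theta>0] by auto
    moreover have "finite (\<Union>p\<in>D. W p \<inter> F \<theta>0)"
      using \<open>finite D\<close> \<open>D \<subseteq> C\<close> W by (intro finite_UN_I) auto
    ultimately show ?thesis by (rule finite_subset)
  qed
  have "\<forall>p q. \<exists>U V. p \<in> topspace T \<and> q \<in> topspace T \<and> p \<noteq> q \<longrightarrow>
      openin T U \<and> openin T V \<and> p \<in> U \<and> q \<in> V \<and> disjnt U V"
  proof (intro allI)
    fix p q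
    show "\<exists>U V. p \<in> topspace T \<and> q \<in> topspace T \<and> p \<noteq> q \<longrightarrow>
      openin T U \<and> openin T V \<and> p \<in> U \<and> q \<in> V \<and> disjnt U V"
      using T[unfolded Hausdorff_space_def, THEN spec[of _ p], THEN spec[of _ q]] by simp
  qed
  then obtain U V where UV: "\<And>p q. p \<in> topspace T \<Longrightarrow> q \<in> topspace T \<Longrightarrow> p \<noteq> q \<Longrightarrow>
      openin T (U p q) \<and> openin T (V p q) \<and> p \<in> U p q \<and> q \<in> V p q \<and> disjnt (U p q) (V p q)"
    by metis
  \<comment> \<open>Using \<open>p\<close> in both roles gives \<open>N p \<subseteq> U p q\<close>
    and \<open>N q \<subseteq> V p q\<close>, hence disjointness. The intersection is finite, and
    \<open>topspace T\<close> takes care of the empty family for a one-point fibre.\<close>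
  define N where "N p = (\<Inter>q\<in>F \<theta>0 - {p}. U p q \<inter> V q p) \<inter> topspace T" for p
  have FT: "p \<in> topspace T" if "p \<in> F \<theta>0" for p using that F Ctop by blast
  have N: "openin T (N p) \<and> p \<in> N p" if "p \<in> F \<theta>0" for p
    unfolding N_def using that UV FT \<open>finite (F \<theta>0)\<close> by (auto intro!: openin_INT)
  have Ndisj: "N p \<inter> N q = {}" if "p \<in> F \<theta>0" "q \<in> F \<theta>0" "p \<noteq> q" for p q
  proof -
    have "N p \<subseteq> U p q" "N q \<subseteq> V p q" using that by (auto simp: N_def)
    moreover have "disjnt (U p q) (V p q)" using UV[OF FT FT that(3)] that by blast
    ultimately show ?thesis by (meson disjnt_def disjnt_subset1 disjnt_subset2)
  qed
  have "\<exists>W \<epsilon>. openin T W \<and> p \<in> W \<and> \<epsilon> > 0 \<and>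
      (if p \<in> F \<theta>0 then W \<subseteq> N p \<and> (\<forall>\<theta>. \<bar>\<theta> - \<theta>0\<bar> < \<epsilon> \<longrightarrow> (\<exists>!q. q \<in> W \<inter> F \<theta>))
       else \<forall>\<theta>. \<bar>\<theta> - \<theta>0\<bar> < \<epsilon> \<longrightarrow> W \<inter> F \<theta> = {})" if p: "p \<in> C" for p
  proof (cases "p \<in> F \<theta>0")
    case True
    from N[OF True] have "openin T (N p)" "p \<in> N p" by simp_all
    from unique[OF True this] show ?thesis unfolding if_P[OF True]
      by (elim exE conjE) (intro exI conjI)
  next
    case False
    show ?thesis unfolding if_not_P[OF False] using away[of p] p False by simp
  qed
  then obtain W \<epsilon> where W: "\<And>p. p \<in> C \<Longrightarrow> openin T (W p) \<and> p \<in> W p \<and> \<epsilon> p > (0::real) \<and>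
      (if p \<in> F \<theta>0 then W p \<subseteq> N p \<and> (\<forall>\<theta>. \<bar>\<theta> - \<theta>0\<bar> < \<epsilon> p \<longrightarrow> (\<exists>!q. q \<in> W p \<inter> F \<theta>))
       else \<forall>\<theta>. \<bar>\<theta> - \<theta>0\<bar> < \<epsilon> p \<longrightarrow> W p \<inter> F \<theta> = {})" by metis
  then have "\<forall>p\<in>C. openin T (W p) \<and> p \<in> W p" by simp
  from subcover[OF this] obtain D where D: "finite D" "D \<subseteq> C" "C \<subseteq> (\<Union>p\<in>D. W p)" by (elim exE conjE)
  define e where "e = Min (insert 1 (\<epsilon> ` (D \<union> F \<theta>0)))"
  have fin: "finite (insert 1 (\<epsilon> ` (D \<union> F \<theta>0)))" using D(1) \<open>finite (F \<theta>0)\<close> by simp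
  have "e > 0" unfolding e_def using fin W D(2) F by (subst Min_gr_iff) auto
  have e: "e \<le> \<epsilon> p" if "p \<in> D \<union> F \<theta>0" for p unfolding e_def using fin that by (intro Min_le) auto
  have "finite (F \<theta>) \<and> card (F \<theta>) = card (F \<theta>0)" if \<theta>: "\<bar>\<theta> - \<theta>0\<bar> < e" for \<theta>
  proof -
    have ex1: "\<exists>!q. q \<in> W p \<inter> F \<theta>" and WN: "W p \<subseteq> N p" if "p \<in> F \<theta>0" for p
    proof -
      have "p \<in> C" using F that by blast
      note Wp = W[OF this, unfolded if_P[OF that]]
      have "\<bar>\<theta> - \<theta>0\<bar> < \<epsilon> p" using e[of p] that \<theta> by simp
      then show "\<exists>!q. q \<in> W p \<inter> F \<theta>" "W p \<subseteq> N p" using Wp by blast+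
    qed
    define h where "h p = (THE q. q \<in> W p \<inter> F \<theta>)" for p
    have h: "h p \<in> W p \<inter> F \<theta>" if "p \<in> F \<theta>0" for p
      unfolding h_def using ex1[OF that] by (rule theI')
    have "bij_betw h (F \<theta>0) (F \<theta>)"
      unfolding bij_betw_def
    proof
      show "inj_on h (F \<theta>0)"
        using h WN Ndisj by (intro inj_onI) (metis IntD1 IntI emptyE subsetD)
      show "h ` F \<theta>0 = F \<theta>"
      proof
        show "h ` F \<theta>0 \<subseteq> F \<theta>" using h by blast
        show "F \<theta> \<subseteq> h ` F \<theta>0"
        proof
          fix q assume q: "q \<in> F \<theta>"
          then obtain p where p: "p \<in> D" "q \<in> W p" using F D(3) by blast
          have "p \<in> F \<theta>0"
          proof (rule ccontr)
            assume "p \<notin> F \<theta>0"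
            have "p \<in> C" using p(1) D(2) by blast
            note Wp = W[OF this, unfolded if_not_P[OF \<open>p \<notin> F \<theta>0\<close>]]
            have "\<bar>\<theta> - \<theta>0\<bar> < \<epsilon> p" using e[of p] p(1) \<theta> by simp
            then have "W p \<inter> F \<theta> = {}" using Wp by blast
            then show False using p(2) q by blast
          qed
          then have "h p = q" using ex1 h p(2) q by blast
          then show "q \<in> h ` F \<theta>0" using \<open>p \<in> F \<theta>0\<close> by blast
        qed
      qed
    qed
    then show ?thesis using \<open>finite (F \<theta>0)\<close> bij_betw_finite bij_betw_same_card by metis
  qed
  then show ?thesis using \<open>e > 0\<close> by blast
qed

text \<open>A zero of order \<open>k \<ge> 2\<close> would map rays in the upper half disc, at the angles \<open>\<pi>/(2k)\<close> and
  \<open>3\<pi>/(2k)\<close>, to both sides of the real axis.\<close>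

lemma real_preserving_locally_injective:
  assumes u: "u holomorphic_on ball 0 r" and r: "r > 0" and u0: "u 0 = 0"
    and real: "\<And>z. z \<in> ball 0 r \<Longrightarrow> Im (u z) = 0 \<longleftrightarrow> Im z = 0"
  obtains s where "s > 0" "s \<le> r" "inj_on u (ball 0 s)"
proof -
  have "0 \<in> ball (0::complex) r" using r by simp
  have nc: "\<not> u constant_on ball 0 r"
  proof
    assume "u constant_on ball 0 r"
    then obtain c where c: "\<And>z. z \<in> ball 0 r \<Longrightarrow> u z = c" by (auto simp: constant_on_def)
    have z: "\<i> * of_real (r / 2) \<in> ball 0 r" using r by (simp add: norm_mult)
    have "u (\<i> * of_real (r / 2)) = u 0" using c[OF z] c[OF \<open>0 \<in> ball 0 r\<close>] by simp
    then show False using real[OF z] u0 r by simp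
  qed
  obtain g r1 k where k: "0 < (k::nat)" and r1: "0 < r1" "ball (0::complex) r1 \<subseteq> ball 0 r"
    and g: "g holomorphic_on ball 0 r1" "\<And>w. w \<in> ball 0 r1 \<Longrightarrow> u w = (w - 0) ^ k * g w"
      "\<And>w. w \<in> ball 0 r1 \<Longrightarrow> g w \<noteq> 0"
    by (rule holomorphic_factor_zero_nonconstant[OF u open_ball connected_ball \<open>0 \<in> ball 0 r\<close> u0 nc]) blast
  have z1: "0 \<in> ball (0::complex) r1" using r1 by simp
  have "continuous_on (ball 0 r1) g" using g(1) by (rule holomorphic_on_imp_continuous_on)
  then have cont: "isCont g 0" using z1 continuous_on_eq_continuous_at[OF open_ball] by blast
  have greal: "Im (g 0) = 0"
  proof -
    \<comment> \<open>Nonzero reals tending to 0 inside the disc; \<open>u\<close> and the power of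
      \<open>z\<close> are real along them, so \<open>g\<close> is real there and in the
      limit.\<close>
    define X where "X m = complex_of_real (r1 / (2 + real m))" for m
    have X: "X m \<in> ball 0 r1" "X m \<noteq> 0" for m
    proof -
      have "0 < r1 / (2 + real m)" "r1 / (2 + real m) < r1"
        using r1(1) mult_strict_left_mono[of 1 "2 + real m" r1] by (simp_all add: divide_less_eq)
      then show "X m \<in> ball 0 r1" "X m \<noteq> 0"
        unfolding X_def mem_ball_0 norm_of_real of_real_eq_0_iff by linarith+
    qed
    have "(\<lambda>m. r1 / (2 + real m)) \<longlonglongrightarrow> 0" by real_asymp
    from tendsto_of_real[OF this, where ?'a = complex]
    have "X \<longlonglongrightarrow> 0" unfolding X_def by simp
    then have "(\<lambda>m. Im (g (X m))) \<longlonglongrightarrow> Im (g 0)"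
      using cont by (intro tendsto_Im) (rule isCont_tendsto_compose)
    moreover have "Im (g (X m)) = 0" for m
    proof -
      have "X m \<in> ball 0 r" using X(1) r1(2) by blast
      moreover have "Im (X m) = 0" unfolding X_def by (rule Im_complex_of_real)
      ultimately have "Im (u (X m)) = 0" using real by blast
      moreover have "u (X m) = of_real ((r1 / (2 + real m)) ^ k) * g (X m)"
        using g(2)[OF X(1)] by (simp add: X_def)
      ultimately have "(r1 / (2 + real m)) ^ k * Im (g (X m)) = 0"
        by (simp only: times_complex.sel(2)[of "of_real _"] Re_complex_of_real Im_complex_of_real mult_zero_left add_0_right)
      then show ?thesis using r1(1) by simp
    qed
    ultimately show ?thesis by (simp add: LIMSEQ_const_iff)
  qed
  then have gre: "Re (g 0) \<noteq> 0" using g(3)[OF z1] by (simp add: complex_eq_iff)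
  have "k = 1"
  proof (rule ccontr)
    assume "k \<noteq> 1"
    then have k2: "k \<ge> 2" using k by simp
    have "isCont (\<lambda>z. Re (g z)) 0" using cont unfolding isCont_def by (rule tendsto_Re)
    then obtain d where d: "d > 0" "\<And>z. norm z < d \<Longrightarrow> \<bar>Re (g z) - Re (g 0)\<bar> < \<bar>Re (g 0)\<bar>"
      using gre unfolding continuous_at_eps_delta dist_norm by (metis diff_zero zero_less_abs_iff real_norm_def)
    \<comment> \<open>Small enough that \<open>Re (g z)\<close> keeps the sign of
      \<open>Re (g 0)\<close> on the circle of radius \<open>t\<close>.\<close>
    define t where "t = min d r1 / 2"
    have t: "0 < t" "t < d" "t < r1" using d(1) r1(1) by (auto simp: t_def)
    have sgn: "Re (g z) * Re (g 0) > 0" if "norm z = t" for z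
      using d(2)[of z] that t(2) by (cases "Re (g 0) > 0") (auto simp: zero_less_mult_iff abs_if split: if_splits)
    define z where "z a = of_real t * cis (a * pi / (2 * real k))" for a :: real
    have nz: "norm (z a) = t" for a using t by (simp add: z_def norm_mult)
    have zr: "z a \<in> ball 0 r1" for a using nz t by simp
    have up: "Im (z a) > 0" if "0 < a" "a < 4" for a
    proof -
      have "a * pi / (2 * real k) < pi"
        using that k2 by (simp add: divide_less_eq field_simps)
      moreover have "0 < a * pi / (2 * real k)" using that k by simp
      ultimately show ?thesis using t(1) by (simp add: z_def sin_gt_zero)
    qed
    have zk: "z a ^ k = of_real (t ^ k) * cis (a * pi / 2)" for a
    proof -
      have "cis (a * pi / (2 * real k)) ^ k = cis (real k * (a * pi / (2 * real k)))" by (rule Complex.DeMoivre)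
      also have "real k * (a * pi / (2 * real k)) = a * pi / 2" using k by simp
      finally show ?thesis by (simp add: z_def power_mult_distrib)
    qed
    have Im1: "Im (u (z 1)) = t ^ k * Re (g (z 1))"
    proof -
      have "u (z 1) = of_real (t ^ k) * (\<i> * g (z 1))"
        using g(2)[OF zr, of 1] zk[of 1] by (simp add: cis_pi_half mult.assoc)
      then show ?thesis by (simp only: times_complex.sel(2)[of "of_real _"] Re_complex_of_real Im_complex_of_real mult_zero_left add_0_right Im_i_times)
    qed
    have "cis (3 * pi / 2) = - \<i>"
      using cos_3over2_pi sin_3over2_pi by (simp add: complex_eq_iff)
    then have Im3: "Im (u (z 3)) = - (t ^ k * Re (g (z 3)))"
    proof -
      have "u (z 3) = of_real (t ^ k) * (- (\<i> * g (z 3)))"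
        using g(2)[OF zr, of 3] zk[of 3] \<open>cis (3 * pi / 2) = - \<i>\<close> by (simp add: mult.assoc)
      then show ?thesis by (simp only: times_complex.sel(2)[of "of_real _"] Re_complex_of_real Im_complex_of_real mult_zero_left add_0_right Im_i_times uminus_complex.sel mult_minus_right)
    qed
    \<comment> \<open>On the connected upper half disc \<open>Im (u z)\<close> takes both signs and
      therefore vanishes somewhere, although \<open>u\<close> is real only on the real axis.\<close>
    define H where "H = ball 0 r \<inter> {z. Im z > 0}"
    have "connected H" unfolding H_def
      by (intro convex_connected convex_Int convex_ball convex_halfspace_Im_gt)
    moreover have "continuous_on H (\<lambda>z. Im (u z))"
      unfolding H_def by (intro continuous_intros continuous_on_subset[OF holomorphic_on_imp_continuous_on[OF u]]) auto
    ultimately have conn: "connected ((\<lambda>z. Im (u z)) ` H)" by (intro connected_continuous_image)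
    have zH: "z 1 \<in> H" "z 3 \<in> H" unfolding H_def using zr[THEN subsetD[OF r1(2)]] up by auto
    have "0 \<in> (\<lambda>z. Im (u z)) ` H"
    proof (cases "Re (g 0) > 0")
      case True
      then have "Im (u (z 1)) > 0" "Im (u (z 3)) < 0"
        using sgn[OF nz] Im1 Im3 t(1) by (simp_all add: zero_less_mult_iff)
      then show ?thesis
        using connectedD_interval[OF conn imageI[OF zH(2)] imageI[OF zH(1)], of 0] by simp
    next
      case False
      then have "Re (g 0) < 0" using gre by simp
      then have "Re (g (z 1)) < 0" "Re (g (z 3)) < 0" using sgn[OF nz] by (simp_all add: zero_less_mult_iff)
      then have "Im (u (z 1)) < 0" "Im (u (z 3)) > 0"
        using Im1 Im3 t(1) by (simp_all add: mult_less_0_iff)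
      then show ?thesis
        using connectedD_interval[OF conn imageI[OF zH(1)] imageI[OF zH(2)], of 0] by simp
    qed
    then obtain y where "y \<in> H" "Im (u y) = 0" by (elim imageE) simp
    then have "y \<in> ball 0 r" "Im y > 0" by (simp_all add: H_def)
    then show False using real[of y] \<open>Im (u y) = 0\<close> by simp
  qed
  \<comment> \<open>For a simple zero the derivative of \<open>u\<close> at 0 is the nonzero number
    \<open>g 0\<close>.\<close>
  have "((\<lambda>w. w * g w) has_field_derivative 1 * g 0 + deriv g 0 * 0) (at 0)"
    using holomorphic_derivI[OF g(1) open_ball z1] by (intro DERIV_mult DERIV_ident) auto
  then have D: "((\<lambda>w. w * g w) has_field_derivative g 0) (at 0)" by simp
  have "w * g w = u w" if "w \<in> ball 0 r1" for w using g(2)[OF that] \<open>k = 1\<close> by simp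
  then have "(u has_field_derivative g 0) (at 0)"
    by (rule has_field_derivative_transform_within_open[OF D open_ball z1])
  then have "deriv u 0 \<noteq> 0" using g(3)[OF z1] DERIV_imp_deriv by metis
  then obtain s where s: "s > 0" "ball 0 s \<subseteq> ball (0::complex) r" "inj_on u (ball 0 s)"
    by (rule has_complex_derivative_locally_injective[OF u \<open>0 \<in> ball 0 r\<close> open_ball])
  show thesis
  proof (rule that[of "min s r"])
    show "inj_on u (ball 0 (min s r))" using s(3) by (rule inj_on_subset) auto
  qed (use s r in auto)
qed

text \<open>An angle as parameter makes the constancy of fibre cardinalities a statement about the
  connected real line. Angle 0 is the point \<open>(1 : 0)\<close>, where poles are counted.\<close>

definition circle_point :: "real \<Rightarrow> cpoint" where
  "circle_point \<theta> = line (\<lambda>i. if i = 0 then of_real (cos \<theta>) else if i = 1 then of_real (sin \<theta>) else 0)"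

lemma sin_cos_squared_of_real:
  "complex_of_real (sin x) * of_real (sin x) + of_real (cos x) * of_real (cos x) = 1"
  using sin_cos_squared_add[of x] by (metis of_real_1 of_real_add of_real_mult power2_eq_square)

lemma cspace_1_eqI:
  assumes "v \<in> cspace 1" "w \<in> cspace 1" "v 0 = w 0" "v 1 = w 1"
  shows "v = w"
proof
  fix i :: nat
  consider "i = 0" | "i = 1" | "i > 1" by linarith
  then show "v i = w i" using assms by cases (auto simp: cspace_def)
qed

lemma line_eq_circle_point:
  assumes w: "w \<in> cspace 1" "w \<noteq> 0"
  shows "line w = circle_point \<theta> \<longleftrightarrow> w 0 * of_real (sin \<theta>) = w 1 * of_real (cos \<theta>)"
proof -
  define u where "u = (\<lambda>i::nat. if i = 0 then complex_of_real (cos \<theta>) else if i = 1 then of_real (sin \<theta>) else 0)"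
  have u: "u 0 = of_real (cos \<theta>)" "u 1 = of_real (sin \<theta>)" by (simp_all add: u_def)
  have uc: "u \<in> cspace 1" by (simp add: u_def cspace_def)
  have u0: "u \<noteq> 0"
  proof
    assume "u = 0"
    then have "u 0 = 0" "u 1 = 0" by simp_all
    then show False using sin_cos_squared_of_real[of \<theta>] u by simp
  qed
  have cu: "circle_point \<theta> = line u" by (simp add: circle_point_def u_def)
  show ?thesis
  proof
    assume "line w = circle_point \<theta>"
    then obtain c where "w = (\<lambda>i. c * u i)" using line_eq_iff[OF u0 w(2)] cu by auto
    then show "w 0 * of_real (sin \<theta>) = w 1 * of_real (cos \<theta>)" by (simp only: u mult_ac)
  next
    assume eq: "w 0 * of_real (sin \<theta>) = w 1 * of_real (cos \<theta>)"
    \<comment> \<open>The inner product of \<open>w\<close> with the unit vector \<open>u\<close> is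
      the factor of proportionality.\<close>
    define c where "c = w 0 * of_real (cos \<theta>) + w 1 * of_real (sin \<theta>)"
    have "c * u 0 = w 0 * (of_real (cos \<theta>) * of_real (cos \<theta>)) + (w 1 * of_real (cos \<theta>)) * of_real (sin \<theta>)"
      unfolding c_def u by (simp add: algebra_simps)
    also have "\<dots> = w 0 * (of_real (sin \<theta>) * of_real (sin \<theta>) + of_real (cos \<theta>) * of_real (cos \<theta>))"
      unfolding eq[symmetric] by (simp add: algebra_simps)
    finally have c0: "w 0 = c * u 0" unfolding sin_cos_squared_of_real by simp
    have "c * u 1 = (w 0 * of_real (sin \<theta>)) * of_real (cos \<theta>) + w 1 * (of_real (sin \<theta>) * of_real (sin \<theta>))"
      unfolding c_def u by (simp add: algebra_simps)
    also have "\<dots> = w 1 * (of_real (sin \<theta>) * of_real (sin \<theta>) + of_real (cos \<theta>) * of_real (cos \<theta>))"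
      unfolding eq by (simp add: algebra_simps)
    finally have c1: "w 1 = c * u 1" unfolding sin_cos_squared_of_real by simp
    have wc: "w = (\<lambda>i. c * u i)"
      using c0 c1 by (intro cspace_1_eqI w cspace_scale uc) auto
    then have "c \<noteq> 0" using w(2) by (auto simp: fun_eq_iff)
    then show "line w = circle_point \<theta>" unfolding cu wc by (rule line_scale)
  qed
qed

lemma real_proj_space_1_circle: "t \<in> real_proj_space 1 \<longleftrightarrow> (\<exists>\<theta>. t = circle_point \<theta>)"
proof
  assume "t \<in> real_proj_space 1"
  then obtain w where w: "w \<in> cspace 1" "w \<noteq> 0" "\<forall>i. w i \<in> \<real>" "t = line w"
    by (auto simp: real_proj_space_def)
  define x y where "x = Re (w 0)" and "y = Re (w 1)"
  have xy: "w 0 = of_real x" "w 1 = of_real y" using w(3) by (auto simp: x_def y_def)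
  have "x \<noteq> 0 \<or> y \<noteq> 0"
    using cspace_1_eqI[of w 0] w(1,2) xy by (auto simp: cspace_def)
  then have s: "x\<^sup>2 + y\<^sup>2 > 0" by (simp add: sum_power2_gt_zero_iff)
  define \<rho> where "\<rho> = sqrt (x\<^sup>2 + y\<^sup>2)"
  have \<rho>: "\<rho> > 0" "\<rho>\<^sup>2 = x\<^sup>2 + y\<^sup>2" using s by (simp_all add: \<rho>_def)
  have "(x / \<rho>)\<^sup>2 + (y / \<rho>)\<^sup>2 = 1"
  proof -
    have "(x / \<rho>)\<^sup>2 + (y / \<rho>)\<^sup>2 = (x\<^sup>2 + y\<^sup>2) / \<rho>\<^sup>2" by (simp add: power_divide add_divide_distrib)
    then show ?thesis using \<rho>(2) s by (metis divide_self less_irrefl)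
  qed
  then obtain \<theta> where "x / \<rho> = cos \<theta>" "y / \<rho> = sin \<theta>" using sincos_total_2pi by metis
  then have "x = \<rho> * cos \<theta>" "y = \<rho> * sin \<theta>" using \<rho>(1) by (simp_all add: field_simps)
  then have "t = circle_point \<theta>"
    unfolding w(4) line_eq_circle_point[OF w(1,2)] xy by simp
  then show "\<exists>\<theta>. t = circle_point \<theta>" ..
next
  assume "\<exists>\<theta>. t = circle_point \<theta>"
  then obtain \<theta> where t: "t = circle_point \<theta>" by blast
  define u where "u = (\<lambda>i::nat. if i = 0 then complex_of_real (cos \<theta>) else if i = 1 then of_real (sin \<theta>) else 0)"
  have u: "u 0 = of_real (cos \<theta>)" "u 1 = of_real (sin \<theta>)" by (simp_all add: u_def)
  have "u \<noteq> 0"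
  proof
    assume "u = 0"
    then have "u 0 = 0" "u 1 = 0" by simp_all
    then show False using sin_cos_squared_of_real[of \<theta>] u by simp
  qed
  then show "t \<in> real_proj_space 1"
    unfolding t circle_point_def real_proj_space_def
    by (intro image_eqI[of _ _ u]) (auto simp: u_def cspace_def)
qed

lemma local_forms_circle:
  assumes F: "local_forms n X 1 f d F" "v \<in> cone_pts n X" "\<exists>i\<le>1. F i v \<noteq> 0"
  shows "f (line v) = circle_point \<theta> \<longleftrightarrow> F 0 v * of_real (sin \<theta>) = F 1 v * of_real (cos \<theta>)"
proof -
  have "f (line v) = line (vec_upto 1 F v)" using F by (simp add: local_forms_def)
  then show ?thesis
    using line_eq_circle_point[OF vec_upto_cspace[of 1 F v] vec_upto_nonzero[of 1 F v, OF F(3)], of \<theta>] by simp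
qed

text \<open>Lying in the fibre means that a determinant vanishes, which is \<open>D\<close> for the
  angle \<open>\<theta>0\<close>. If sine and cosine change by less than \<open>k\<close>, the
  determinant changes by at most \<open>k * S x\<close>, so the open, scale-invariant condition
  \<open>k * S x < norm (D x)\<close> excludes the fibres over nearby angles.\<close>

lemma fibre_locally_away:
  assumes X: "real_curve n X" and f: "real_morphism n X 1 f" and p: "p \<in> X" "f p \<noteq> circle_point \<theta>0"
  shows "\<exists>W \<epsilon>. openin (proj_topology n) W \<and> p \<in> W \<and> \<epsilon> > 0 \<and>
    (\<forall>\<theta>. \<bar>\<theta> - \<theta>0\<bar> < \<epsilon> \<longrightarrow> (\<forall>q\<in>W \<inter> X. f q \<noteq> circle_point \<theta>))"
proof -
  obtain v where v: "v \<in> cone_pts n X" "p = line v" using in_points_cone[OF real_curve_subset[OF X] p(1)] by blast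
  obtain d F where F: "local_forms n X 1 f d F" and nz: "\<exists>i\<le>1. F i v \<noteq> 0"
    using morphism_local_forms[OF X f v(1)] by blast
  have hf: "hform \<real> n d (F 0)" "hform \<real> n d (F 1)" using F by (auto simp: local_forms_def)
  define D where "D x = F 0 x * of_real (sin \<theta>0) - F 1 x * of_real (cos \<theta>0)" for x
  define S where "S x = norm (F 0 x) + norm (F 1 x)" for x
  have "D v \<noteq> 0" using local_forms_circle[OF F v(1) nz, of \<theta>0] p(2) v(2) by (simp add: D_def)
  have "S v > 0"
  proof -
    obtain i where "i \<le> 1" "F i v \<noteq> 0" using nz by blast
    then have "i = 0 \<or> i = 1" by linarith
    then show ?thesis using \<open>F i v \<noteq> 0\<close> unfolding S_def by (metis add_pos_nonneg add_nonneg_pos norm_ge_zero zero_less_norm_iff)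
  qed
  \<comment> \<open>Half of the critical quotient, so that \<open>R\<close> holds at
    \<open>v\<close> with room to spare.\<close>
  define k where "k = norm (D v) / (2 * S v)"
  have k: "k > 0" using \<open>D v \<noteq> 0\<close> \<open>S v > 0\<close> by (simp add: k_def)
  define R where "R x \<longleftrightarrow> k * S x < norm (D x)" for x
  have Rv: "R v" using \<open>D v \<noteq> 0\<close> \<open>S v > 0\<close> by (simp add: R_def k_def)
  have Ds: "norm (D (\<lambda>i. c * x i)) = norm c ^ d * norm (D x)" and Ss: "S (\<lambda>i. c * x i) = norm c ^ d * S x" for c x
  proof -
    have "D (\<lambda>i. c * x i) = c ^ d * D x"
      unfolding D_def hform_scale[OF hf(1)] hform_scale[OF hf(2)] by (simp add: right_diff_distrib mult.assoc)
    then show "norm (D (\<lambda>i. c * x i)) = norm c ^ d * norm (D x)" by (simp add: norm_mult norm_power)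
    show "S (\<lambda>i. c * x i) = norm c ^ d * S x"
      unfolding S_def hform_scale[OF hf(1)] hform_scale[OF hf(2)] by (simp add: norm_mult norm_power distrib_left)
  qed
  have si: "scale_inv R"
    unfolding scale_inv_def R_def Ds Ss
  proof (intro allI impI)
    fix x and c :: complex assume "c \<noteq> 0" "k * S x < norm (D x)"
    then have "norm c ^ d * (k * S x) < norm c ^ d * norm (D x)" by simp
    then show "k * (norm c ^ d * S x) < norm c ^ d * norm (D x)" by (simp only: mult.left_commute)
  qed
  have "open {x. R x}"
    unfolding R_def D_def S_def
    by (intro open_Collect_less continuous_intros hform_continuous[OF hf(1)] hform_continuous[OF hf(2)])
  then have op: "openin (proj_topology n) (proj_set n R)" using si by (intro openin_proj_set)
  have "isCont sin \<theta>0" "isCont cos \<theta>0" by simp_all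
  then obtain e1 e2 where e: "e1 > 0" "\<And>\<theta>. \<bar>\<theta> - \<theta>0\<bar> < e1 \<Longrightarrow> \<bar>sin \<theta> - sin \<theta>0\<bar> < k"
    "e2 > 0" "\<And>\<theta>. \<bar>\<theta> - \<theta>0\<bar> < e2 \<Longrightarrow> \<bar>cos \<theta> - cos \<theta>0\<bar> < k"
    using k unfolding continuous_at_eps_delta dist_real_def by metis
  have "f q \<noteq> circle_point \<theta>" if \<theta>: "\<bar>\<theta> - \<theta>0\<bar> < min e1 e2" and q: "q \<in> proj_set n R \<inter> X" for \<theta> q
  proof
    assume fq: "f q = circle_point \<theta>"
    obtain x where x: "x \<in> cone_pts n X" "q = line x" using q in_points_cone[OF real_curve_subset[OF X]] by blast
    have Rx: "R x" using q line_in_proj_set[OF si cone_cspace[OF x(1)] cone_nonzero[OF x(1)]] x(2) by simp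
    have nzx: "\<exists>i\<le>1. F i x \<noteq> 0"
    proof (rule ccontr)
      assume "\<not> ?thesis"
      then have "F 0 x = 0" "F 1 x = 0" by auto
      then show False using Rx by (simp add: R_def D_def S_def)
    qed
    have "F 0 x * of_real (sin \<theta>) = F 1 x * of_real (cos \<theta>)"
      using local_forms_circle[OF F x(1) nzx] fq x(2) by simp
    then have "D x = F 1 x * of_real (cos \<theta> - cos \<theta>0) - F 0 x * of_real (sin \<theta> - sin \<theta>0)"
      by (simp add: D_def right_diff_distrib)
    also have "norm \<dots> \<le> norm (F 1 x) * \<bar>cos \<theta> - cos \<theta>0\<bar> + norm (F 0 x) * \<bar>sin \<theta> - sin \<theta>0\<bar>"
      by (rule order_trans[OF norm_triangle_ineq4]) (simp only: norm_mult norm_of_real order_refl)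
    also have "\<dots> \<le> norm (F 1 x) * k + norm (F 0 x) * k"
      using e(2)[of \<theta>] e(4)[of \<theta>] \<theta> by (intro add_mono mult_left_mono) auto
    also have "\<dots> = k * S x" by (simp add: S_def algebra_simps)
    finally show False using Rx by (simp add: R_def)
  qed
  then show ?thesis
    using op e(1,3) Rv line_in_proj_set[OF si cone_cspace[OF v(1)] cone_nonzero[OF v(1)]] v(2)
    by (intro exI[of _ "proj_set n R"] exI[of _ "min e1 e2"]) auto
qed

lemma real_representative:
  assumes "p \<in> real_proj_space n"
  obtains v a where "v \<in> cspace n" "\<forall>i. v i \<in> \<real>" "a \<le> n" "v a = 1" "p = line v"
proof -
  obtain w where w: "w \<in> cspace n" "w \<noteq> 0" "\<forall>i. w i \<in> \<real>" "p = line w"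
    using assms by (auto simp: real_proj_space_def)
  obtain a where a: "a \<le> n" "w a \<noteq> 0" using exists_nonzero_coord w by blast
  show thesis
  proof (rule that[of "\<lambda>i. (1 / w a) * w i" a])
    show "p = line (\<lambda>i. (1 / w a) * w i)" using line_scale[of "1 / w a" w] a(2) w(4) by simp
  qed (use w a in \<open>auto simp: cspace_def\<close>)
qed

lemma continuous_map_line_compose:
  assumes "continuous_on S \<phi>" "\<phi> ` S \<subseteq> cspace n - {0}"
  shows "continuous_map (top_of_set S) (proj_topology n) (\<lambda>z. line (\<phi> z))"
proof -
  have "continuous_map (top_of_set S) (top_of_set (cspace n - {0})) \<phi>"
    using assms by (auto simp: continuous_map_in_subtopology)
  from continuous_map_compose[OF this continuous_map_line] show ?thesis by (simp add: comp_def)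
qed

text \<open>A union of components of the real points.\<close>

definition real_part :: "nat \<Rightarrow> cpoint set \<Rightarrow> cpoint set \<Rightarrow> bool" where
  "real_part n X C \<longleftrightarrow> C \<subseteq> real_points n X \<and> closedin (proj_topology n) C \<and>
     (\<forall>S. connectedin (subtopology (proj_topology n) (real_points n X)) S \<longrightarrow> S \<inter> C \<noteq> {} \<longrightarrow> S \<subseteq> C)"

text \<open>In the arc parameter \<open>z\<close> at \<open>p\<close> the morphism becomes
  \<open>u\<close>, the tangent of the angle relative to \<open>\<theta>0\<close>, and
  \<open>u\<close> is real exactly for real \<open>z\<close>. Hence \<open>u\<close> is injective
  near 0 and its image contains a disc, so each nearby angle is attained for exactly one
  \<open>z\<close>, which is real.\<close>

lemma fibre_locally_unique:
  assumes X: "real_curve n X" and f: "separating n X f" and C: "real_part n X C"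
    and p: "p \<in> C" "f p = circle_point \<theta>0" and N: "openin (proj_topology n) N" "p \<in> N"
  shows "\<exists>W \<epsilon>. openin (proj_topology n) W \<and> p \<in> W \<and> W \<subseteq> N \<and> \<epsilon> > 0 \<and>
    (\<forall>\<theta>. \<bar>\<theta> - \<theta>0\<bar> < \<epsilon> \<longrightarrow> (\<exists>!q. q \<in> W \<inter> {q \<in> C. f q = circle_point \<theta>}))"
proof -
  have rm: "real_morphism n X 1 f" using f by (simp add: separating_def)
  have pr: "p \<in> real_points n X" using p(1) C by (auto simp: real_part_def)
  then have pX: "p \<in> X" "p \<in> real_proj_space n" by (auto simp: real_points_def)
  obtain v a where v: "v \<in> cspace n" "\<forall>i. v i \<in> \<real>" "a \<le> n" "v a = 1" "p = line v"
    using real_representative[OF pX(2)] by metis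
  have "v \<noteq> 0" using v(4) by auto
  then have vX: "v \<in> cone_pts n X" using v pX(1) by (simp add: cone_pts_def)
  obtain b \<rho> \<eta> \<psi> where b: "b \<le> n" "b \<noteq> a" and \<rho>: "\<rho> > 0" and \<eta>: "\<eta> > 0" and \<psi>0: "\<psi> 0 = v"
    and hol: "\<And>j. (\<lambda>z. \<psi> z j) holomorphic_on ball 0 \<rho>"
    and \<psi>X: "\<And>z. z \<in> ball 0 \<rho> \<Longrightarrow> \<psi> z \<in> cone_pts n X"
    and \<psi>a: "\<And>z. z \<in> ball 0 \<rho> \<Longrightarrow> \<psi> z a = 1"
    and \<psi>b: "\<And>z. z \<in> ball 0 \<rho> \<Longrightarrow> \<psi> z b = v b + z"
    and param: "\<And>x. x \<in> cone_pts n X \<Longrightarrow> x a = 1 \<Longrightarrow> (\<And>j. j \<le> n \<Longrightarrow> norm (x j - v j) < \<eta>) \<Longrightarrow>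
       norm (x b - v b) < \<rho> \<and> x = \<psi> (x b - v b)"
    by (rule local_parametrization[OF X vX v(3,4)]) blast
  have zb: "0 \<in> ball (0::complex) \<rho>" using \<rho> by simp
  obtain d F where F: "local_forms n X 1 f d F" and nz: "\<exists>i\<le>1. F i v \<noteq> 0"
    using morphism_local_forms[OF X rm vX] by blast
  have hf: "hform \<real> n d (F 0)" "hform \<real> n d (F 1)" using F by (auto simp: local_forms_def)
  \<comment> \<open>The local forms rotated by \<open>- \<theta>0\<close>: the fibre over
    \<open>\<theta>0\<close> becomes \<open>B = 0\<close>, and \<open>A\<close> is nonzero at the
    origin.\<close>
  define A where "A z = F 0 (\<psi> z) * of_real (cos \<theta>0) + F 1 (\<psi> z) * of_real (sin \<theta>0)" for z
  define B where "B z = F 1 (\<psi> z) * of_real (cos \<theta>0) - F 0 (\<psi> z) * of_real (sin \<theta>0)" for z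
  have holF: "(\<lambda>z. F 0 (\<psi> z)) holomorphic_on ball 0 \<rho>" "(\<lambda>z. F 1 (\<psi> z)) holomorphic_on ball 0 \<rho>"
    using pfun_holomorphic[OF hform_imp_pfun[OF hf(1)] hol] pfun_holomorphic[OF hform_imp_pfun[OF hf(2)] hol] by auto
  have holAB: "A holomorphic_on ball 0 \<rho>" "B holomorphic_on ball 0 \<rho>"
    unfolding A_def[abs_def] B_def[abs_def] using holF by (auto intro!: holomorphic_intros)
  have F0: "F 0 (\<psi> z) = A z * of_real (cos \<theta>0) - B z * of_real (sin \<theta>0)" for z
  proof -
    have "A z * of_real (cos \<theta>0) - B z * of_real (sin \<theta>0) = F 0 (\<psi> z) *
        (complex_of_real (sin \<theta>0) * of_real (sin \<theta>0) + of_real (cos \<theta>0) * of_real (cos \<theta>0))"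
      unfolding A_def B_def by (simp add: algebra_simps)
    then show ?thesis unfolding sin_cos_squared_of_real by simp
  qed
  have F1: "F 1 (\<psi> z) = A z * of_real (sin \<theta>0) + B z * of_real (cos \<theta>0)" for z
  proof -
    have "A z * of_real (sin \<theta>0) + B z * of_real (cos \<theta>0) = F 1 (\<psi> z) *
        (complex_of_real (sin \<theta>0) * of_real (sin \<theta>0) + of_real (cos \<theta>0) * of_real (cos \<theta>0))"
      unfolding A_def B_def by (simp add: algebra_simps)
    then show ?thesis unfolding sin_cos_squared_of_real by simp
  qed
  have B0: "B 0 = 0"
    using local_forms_circle[OF F vX nz, of \<theta>0] p(2) v(5) \<psi>0 by (simp add: B_def)
  have A0: "A 0 \<noteq> 0"
  proof
    assume "A 0 = 0"
    then have "F 0 v = 0" "F 1 v = 0" using F0[of 0] F1[of 0] B0 \<psi>0 by simp_all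
    moreover obtain i where "i \<le> 1" "F i v \<noteq> 0" using nz by blast
    then have "i = 0 \<or> i = 1" by linarith
    ultimately show False using \<open>F i v \<noteq> 0\<close> by auto
  qed
  have contA: "isCont A 0"
    using holomorphic_on_imp_continuous_on[OF holAB(1)] zb continuous_on_eq_continuous_at[OF open_ball] by blast
  have cont\<psi>: "isCont (\<lambda>z. \<psi> z j) 0" for j
    using holomorphic_on_imp_continuous_on[OF hol] zb continuous_on_eq_continuous_at[OF open_ball] by blast
  have "\<forall>\<^sub>F z in nhds 0. A z \<noteq> 0"
    using tendsto_imp_eventually_ne[OF contA[unfolded continuous_at] A0] A0 by (simp add: eventually_nhds_conv_at)
  moreover have "\<forall>\<^sub>F z in nhds 0. \<forall>j\<in>{..n}. norm (\<psi> z j - v j) < \<eta>"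
  proof (subst eventually_ball_finite_distrib)
    have "\<forall>\<^sub>F z in nhds 0. norm (\<psi> z j - v j) < \<eta>" for j
    proof -
      have "((\<lambda>z. \<psi> z j) \<longlongrightarrow> v j) (nhds 0)"
        using cont\<psi>[of j] \<psi>0 by (simp add: isCont_def tendsto_nhds_iff)
      then show ?thesis using \<eta> unfolding tendsto_iff dist_norm by blast
    qed
    then show "\<forall>j\<in>{..n}. \<forall>\<^sub>F z in nhds 0. norm (\<psi> z j - v j) < \<eta>" by blast
  qed simp
  ultimately have "\<forall>\<^sub>F z in nhds 0. A z \<noteq> 0 \<and> (\<forall>j\<in>{..n}. norm (\<psi> z j - v j) < \<eta>)"
    by (rule eventually_conj)
  then obtain r0 where r0: "r0 > 0" "\<And>z. norm z < r0 \<Longrightarrow> A z \<noteq> 0 \<and> (\<forall>j\<in>{..n}. norm (\<psi> z j - v j) < \<eta>)"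
    unfolding eventually_nhds_metric by auto
  define r where "r = min r0 \<rho>"
  have r: "r > 0" "r \<le> \<rho>" using r0(1) \<rho> by (simp_all add: r_def)
  have Anz: "A z \<noteq> 0" and near: "\<And>j. j \<le> n \<Longrightarrow> norm (\<psi> z j - v j) < \<eta>" if "z \<in> ball 0 r" for z
    using r0(2)[of z] that by (simp_all add: r_def)
  have sub: "ball 0 r \<subseteq> ball (0::complex) \<rho>" using r(2) by (rule subset_ball)
  define u where "u z = B z / A z" for z
  have holu: "u holomorphic_on ball 0 r"
    unfolding u_def[abs_def] using holAB Anz sub by (auto intro!: holomorphic_on_divide intro: holomorphic_on_subset)
  have nzF: "\<exists>i\<le>1. F i (\<psi> z) \<noteq> 0" if "z \<in> ball 0 r" for z
  proof (rule ccontr)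
    assume "\<not> ?thesis"
    then have "F 0 (\<psi> z) = 0" "F 1 (\<psi> z) = 0" by auto
    then show False using Anz[OF that] by (simp add: A_def)
  qed
  have circ: "f (line (\<psi> z)) = circle_point \<theta> \<longleftrightarrow> u z = of_real (tan (\<theta> - \<theta>0))"
    if z: "z \<in> ball 0 r" and \<theta>: "\<bar>\<theta> - \<theta>0\<bar> < pi / 2" for z \<theta>
  proof -
    have "\<psi> z \<in> cone_pts n X" using \<psi>X sub z by blast
    from local_forms_circle[OF F this nzF[OF z], of \<theta>]
    have "f (line (\<psi> z)) = circle_point \<theta> \<longleftrightarrow> (A z * of_real (cos \<theta>0) - B z * of_real (sin \<theta>0)) * of_real (sin \<theta>)
        = (A z * of_real (sin \<theta>0) + B z * of_real (cos \<theta>0)) * of_real (cos \<theta>)"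
      unfolding F0 F1 .
    also have "\<dots> \<longleftrightarrow> A z * of_real (sin (\<theta> - \<theta>0)) = B z * of_real (cos (\<theta> - \<theta>0))"
      unfolding sin_diff cos_diff of_real_add of_real_diff of_real_mult by (auto simp: algebra_simps)
    also have "\<dots> \<longleftrightarrow> u z = of_real (tan (\<theta> - \<theta>0))"
    proof -
      have "cos (\<theta> - \<theta>0) > 0" using \<theta> by (intro cos_gt_zero_pi; linarith)
      then have "complex_of_real (cos (\<theta> - \<theta>0)) \<noteq> 0" by simp
      then show ?thesis unfolding u_def tan_def of_real_divide using Anz[OF z]
        by (auto simp: frac_eq_eq mult.commute)
    qed
    finally show ?thesis .
  qed
  have real_iff_u: "line (\<psi> z) \<in> real_points n X \<longleftrightarrow> Im (u z) = 0" if z: "z \<in> ball 0 r" for z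
  proof -
    have c: "\<psi> z \<in> cone_pts n X" using \<psi>X sub z by blast
    have "line (\<psi> z) \<in> real_points n X \<longleftrightarrow> f (line (\<psi> z)) \<in> real_proj_space 1"
      using f cone_line[OF c] by (auto simp: separating_def)
    also have "\<dots> \<longleftrightarrow> Im (F 0 (\<psi> z) * cnj (F 1 (\<psi> z))) = 0"
      using local_forms_1(3)[OF F c nzF[OF z]] .
    also have "Im (F 0 (\<psi> z) * cnj (F 1 (\<psi> z))) = Im (A z * cnj (B z))"
    proof -
      have "Im (F 0 (\<psi> z) * cnj (F 1 (\<psi> z))) = Im (A z * cnj (B z)) * (cos \<theta>0 * cos \<theta>0 + sin \<theta>0 * sin \<theta>0)"
        unfolding F0 F1 by (simp add: algebra_simps del: sin_cos_squared_add3)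
      then show ?thesis unfolding sin_cos_squared_add3 by simp
    qed
    also have "A z * cnj (B z) = of_real ((norm (A z))\<^sup>2) * cnj (u z)"
      unfolding u_def complex_norm_square using Anz[OF z] by simp
    also have "Im \<dots> = - ((norm (A z))\<^sup>2 * Im (u z))"
      by (simp only: times_complex.sel(2)[of "of_real _"] Re_complex_of_real Im_complex_of_real mult_zero_left add_0_right complex_cnj mult_minus_right cnj.sel)
    finally show ?thesis using Anz[OF z] by simp
  qed
  have real_iff: "line (\<psi> z) \<in> real_points n X \<longleftrightarrow> Im z = 0" if z: "z \<in> ball 0 r" for z
  proof
    have z\<rho>: "z \<in> ball 0 \<rho>" using z sub by blast
    have c: "\<psi> z \<in> cone_pts n X" using \<psi>X[OF z\<rho>] .
    have "Im (v b) = 0" using v(2) complex_is_Real_iff by blast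
    {
      assume "line (\<psi> z) \<in> real_points n X"
      then have "Im (\<psi> z b * cnj (\<psi> z a)) = 0"
        using line_in_real_proj_space[OF cone_cspace[OF c] cone_nonzero[OF c]] by (auto simp: real_points_def)
      then show "Im z = 0" using \<psi>a[OF z\<rho>] \<psi>b[OF z\<rho>] \<open>Im (v b) = 0\<close> by simp
    }
    \<comment> \<open>The conjugate of \<open>\<psi> z\<close> is a point of the cone near
      \<open>v\<close> with the same \<open>b\<close>-coordinate, so uniqueness in the
      parametrization makes it equal to \<open>\<psi> z\<close>.\<close>
    assume "Im z = 0"
    define x where "x = (\<lambda>i. cnj (\<psi> z i))"
    have x: "x \<in> cone_pts n X" unfolding x_def using cnj_in_cone[OF X c] .
    have cz: "cnj z = z" "\<And>i. cnj (v i) = v i" using \<open>Im z = 0\<close> v(2) by (auto simp: complex_eq_iff Reals_cnj_iff)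
    have "x b - v b = z" using \<psi>b[OF z\<rho>] cz by (simp add: x_def)
    moreover have "norm (x j - v j) < \<eta>" if "j \<le> n" for j
    proof -
      have "x j - v j = cnj (\<psi> z j - v j)" using cz by (simp add: x_def)
      then show ?thesis using near[OF z that] by (simp only: complex_mod_cnj)
    qed
    moreover have "x a = 1" using \<psi>a[OF z\<rho>] by (simp add: x_def)
    ultimately have "x = \<psi> z" using param[OF x] by metis
    then have "cnj (\<psi> z i) = \<psi> z i" for i unfolding x_def by (rule fun_cong)
    then have "\<psi> z i \<in> \<real>" for i by (simp add: Reals_cnj_iff)
    then have "line (\<psi> z) \<in> real_proj_space n"
      unfolding real_proj_space_def using cone_cspace[OF c] cone_nonzero[OF c] by blast
    then show "line (\<psi> z) \<in> real_points n X" using cone_line[OF c] by (simp add: real_points_def)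
  qed
  have u0: "u 0 = 0" using B0 by (simp add: u_def)
  obtain s where s: "s > 0" "s \<le> r" "inj_on u (ball 0 s)"
    by (rule real_preserving_locally_injective[OF holu r(1) u0]) (use real_iff real_iff_u in blast)+
  have cline: "continuous_map (top_of_set (ball 0 \<rho>)) (proj_topology n) (\<lambda>z. line (\<psi> z))"
  proof (rule continuous_map_line_compose)
    show "continuous_on (ball 0 \<rho>) \<psi>"
      using holomorphic_on_imp_continuous_on[OF hol] by (rule continuous_on_coordinatewise_then_product)
    show "\<psi> ` ball 0 \<rho> \<subseteq> cspace n - {0}"
      using cone_cspace[OF \<psi>X] cone_nonzero[OF \<psi>X] by (intro image_subsetI) simp
  qed
  from openin_continuous_map_preimage[OF this N(1)]
  have "open {z \<in> ball 0 \<rho>. line (\<psi> z) \<in> N}"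
    using openin_open_trans[OF _ open_ball] by simp
  moreover have "0 \<in> {z \<in> ball 0 \<rho>. line (\<psi> z) \<in> N}" using \<rho> \<psi>0 v(5) N(2) by simp
  ultimately obtain \<delta>0 where \<delta>0: "\<delta>0 > 0" "ball 0 \<delta>0 \<subseteq> {z \<in> ball 0 \<rho>. line (\<psi> z) \<in> N}"
    using open_contains_ball by metis
  define \<delta> where "\<delta> = min \<delta>0 s"
  have \<delta>: "\<delta> > 0" "\<delta> \<le> s" "\<delta> \<le> r" using \<delta>0(1) s by (auto simp: \<delta>_def)
  have \<delta>N: "line (\<psi> z) \<in> N" if "z \<in> ball 0 \<delta>" for z using \<delta>0(2) that by (auto simp: \<delta>_def)
  \<comment> \<open>The conditions \<open>norm (x j / x a - v j) < \<eta>\<close> and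
    \<open>norm (x b / x a - v b) < \<delta>\<close> with denominators cleared; this makes them
    scale-invariant and excludes \<open>x a = 0\<close>.\<close>
  define R where "R x \<longleftrightarrow> (\<forall>j\<in>{..n}. norm (x j - v j * x a) < \<eta> * norm (x a)) \<and> norm (x b - v b * x a) < \<delta> * norm (x a)" for x
  have si: "scale_inv R"
    unfolding scale_inv_def R_def
  proof (intro allI impI)
    fix x and c :: complex
    assume c: "c \<noteq> 0" and x: "(\<forall>j\<in>{..n}. norm (x j - v j * x a) < \<eta> * norm (x a)) \<and> norm (x b - v b * x a) < \<delta> * norm (x a)"
    have "norm (c * x j - v j * (c * x a)) = norm c * norm (x j - v j * x a)" for j
      unfolding norm_mult[symmetric] by (simp add: right_diff_distrib mult.left_commute)
    moreover have "norm c * y < y' * norm (c * x a)" if "y < y' * norm (x a)" for y y'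
      using mult_strict_left_mono[OF that, of "norm c"] c by (simp add: norm_mult mult.left_commute)
    ultimately show "(\<forall>j\<in>{..n}. norm (c * x j - v j * (c * x a)) < \<eta> * norm (c * x a)) \<and>
        norm (c * x b - v b * (c * x a)) < \<delta> * norm (c * x a)"
      using x by (simp only:) blast
  qed
  have "{x. R x} = (\<Inter>j\<in>{..n}. {x. norm (x j - v j * x a) < \<eta> * norm (x a)}) \<inter> {x. norm (x b - v b * x a) < \<delta> * norm (x a)}"
    by (auto simp: R_def)
  moreover have "open (\<Inter>j\<in>{..n}. {x. norm (x j - v j * x a) < \<eta> * norm (x a)})"
    by (intro open_INT ballI open_Collect_less continuous_intros continuous_on_product_coordinates) auto
  moreover have "open {x. norm (x b - v b * x a) < \<delta> * norm (x a)}"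
    by (intro open_Collect_less continuous_intros continuous_on_product_coordinates)
  ultimately have "open {x. R x}" by (simp only: open_Int)
  then have opR: "openin (proj_topology n) (proj_set n R)" using si by (intro openin_proj_set)
  define W where "W = proj_set n R \<inter> N"
  have opW: "openin (proj_topology n) W" unfolding W_def using opR N(1) by (rule openin_Int)
  have W1: "line (\<psi> z) \<in> W" if z: "z \<in> ball 0 \<delta>" for z
  proof -
    have zr: "z \<in> ball 0 r" using z \<delta>(3) by auto
    then have z\<rho>: "z \<in> ball 0 \<rho>" using sub by blast
    have "R (\<psi> z)" using near[OF zr] \<psi>a[OF z\<rho>] \<psi>b[OF z\<rho>] z by (simp add: R_def)
    then show ?thesis
      using line_in_proj_set[OF si cone_cspace[OF \<psi>X[OF z\<rho>]] cone_nonzero[OF \<psi>X[OF z\<rho>]]] \<delta>N[OF z]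
      by (simp add: W_def)
  qed
  have W2: "\<exists>z\<in>ball 0 \<delta>. q = line (\<psi> z)" if q: "q \<in> W" "q \<in> X" for q
  proof -
    obtain x where x: "x \<in> cone_pts n X" "q = line x" using q in_points_cone[OF real_curve_subset[OF X]] by blast
    have Rx: "R x" using q(1) line_in_proj_set[OF si cone_cspace[OF x(1)] cone_nonzero[OF x(1)]] x(2) by (simp add: W_def)
    then have xa: "x a \<noteq> 0" by (auto simp: R_def)
    define y where "y = (\<lambda>i. (1 / x a) * x i)"
    have y: "y \<in> cone_pts n X" "line y = q" "y a = 1"
      using cone_scale[OF x(1), of "1 / x a"] line_scale[of "1 / x a" x] xa x(2) by (auto simp: y_def)
    have "1 / x a \<noteq> 0" using xa by simp
    then have "R y" unfolding y_def using si[unfolded scale_inv_def] Rx by blast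
    then have near_y: "\<And>j. j \<le> n \<Longrightarrow> norm (y j - v j) < \<eta>" and yb: "norm (y b - v b) < \<delta>"
      using y(3) by (auto simp: R_def)
    have "y = \<psi> (y b - v b)" using param[OF y(1,3) near_y] by simp
    then have "q = line (\<psi> (y b - v b))" using y(2) by simp
    then show ?thesis using yb by (intro bexI[of _ "y b - v b"]) auto
  qed
  have \<delta>sub: "ball 0 \<delta> \<subseteq> ball (0::complex) r" using \<delta>(3) by (rule subset_ball)
  have inj: "inj_on u (ball 0 \<delta>)" using s(3) \<delta>(2) by (rule inj_on_subset[OF _ subset_ball])
  \<comment> \<open>An injective holomorphic map is open, so all small values of \<open>u\<close>
    are attained; continuity of the tangent turns close angles into small values.\<close>
  have "open (u ` ball 0 \<delta>)"
    using holomorphic_on_subset[OF holu \<delta>sub] open_ball inj by (rule open_mapping_thm3)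
  moreover have "0 \<in> u ` ball 0 \<delta>" using u0 \<delta>(1) by (intro image_eqI[of _ _ 0]) auto
  ultimately obtain e where e: "e > 0" "ball 0 e \<subseteq> u ` ball 0 \<delta>" using open_contains_ball by metis
  have "isCont tan (0::real)" by (intro isCont_tan) simp
  then obtain \<epsilon>0 where \<epsilon>0: "\<epsilon>0 > 0" "\<And>t::real. \<bar>t\<bar> < \<epsilon>0 \<Longrightarrow> \<bar>tan t\<bar> < e"
    using e(1) unfolding continuous_at_eps_delta dist_real_def by (metis diff_zero tan_zero)
  \<comment> \<open>The real diameter of the disc is mapped to a connected set of real points
    through \<open>p\<close>, which cannot leave the union of components \<open>C\<close>.\<close>
  have seg: "line (\<psi> z) \<in> C" if z: "z \<in> ball 0 \<delta>" "Im z = 0" for z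
  proof -
    define L where "L = ball 0 \<delta> \<inter> {w. Im w = 0}"
    have "L = ball 0 \<delta> \<inter> ({w. Im w \<le> 0} \<inter> {w. Im w \<ge> 0})" unfolding L_def by auto
    then have "convex L" by (simp only: convex_Int convex_ball convex_halfspace_Im_le convex_halfspace_Im_ge)
    then have "connected L" by (rule convex_connected)
    have "continuous_map (top_of_set L) (proj_topology n) (\<lambda>z. line (\<psi> z))"
      using continuous_map_from_subtopology[OF cline, of L] \<delta>sub sub
      by (auto simp: subtopology_subtopology L_def Int_absorb1 subset_trans inf.absorb2 inf_assoc[symmetric])
    moreover have img: "(\<lambda>z. line (\<psi> z)) ` L \<subseteq> real_points n X" using real_iff \<delta>sub by (auto simp: L_def)
    ultimately have "continuous_map (top_of_set L) (subtopology (proj_topology n) (real_points n X)) (\<lambda>z. line (\<psi> z))"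
      by (auto simp: continuous_map_in_subtopology)
    moreover have "connectedin (top_of_set L) L" using \<open>connected L\<close> by (simp add: connectedin_subtopology)
    ultimately have "connectedin (subtopology (proj_topology n) (real_points n X)) ((\<lambda>z. line (\<psi> z)) ` L)"
      by (rule connectedin_continuous_map_image)
    moreover have "p \<in> (\<lambda>z. line (\<psi> z)) ` L" using \<psi>0 v(5) \<delta>(1) by (intro image_eqI[of _ _ 0]) (auto simp: L_def)
    ultimately have "(\<lambda>z. line (\<psi> z)) ` L \<subseteq> C" using C p(1) unfolding real_part_def by blast
    then show ?thesis using z by (auto simp: L_def)
  qed
  have "\<exists>!q. q \<in> W \<inter> {q \<in> C. f q = circle_point \<theta>}" if \<theta>: "\<bar>\<theta> - \<theta>0\<bar> < min \<epsilon>0 (pi / 2)" for \<theta>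
  proof -
    have th: "\<bar>\<theta> - \<theta>0\<bar> < pi / 2" "\<bar>tan (\<theta> - \<theta>0)\<bar> < e" using \<theta> \<epsilon>0(2) by auto
    then have "complex_of_real (tan (\<theta> - \<theta>0)) \<in> ball 0 e" by (simp only: mem_ball_0 norm_of_real)
    then obtain z where z: "z \<in> ball 0 \<delta>" "u z = of_real (tan (\<theta> - \<theta>0))" using e(2) by (metis imageE subsetD)
    have zr: "z \<in> ball 0 r" using z(1) \<delta>sub by blast
    have "Im (u z) = 0" unfolding z(2) by (rule Im_complex_of_real)
    then have "Im z = 0" using real_iff[OF zr] real_iff_u[OF zr] by simp
    show ?thesis
    proof (rule ex1I[of _ "line (\<psi> z)"])
      show "line (\<psi> z) \<in> W \<inter> {q \<in> C. f q = circle_point \<theta>}"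
        using W1[OF z(1)] seg[OF z(1) \<open>Im z = 0\<close>] circ[OF zr th(1)] z(2) by simp
      fix q assume q: "q \<in> W \<inter> {q \<in> C. f q = circle_point \<theta>}"
      then have "q \<in> X" using C by (auto simp: real_part_def real_points_def)
      then obtain w where w: "w \<in> ball 0 \<delta>" "q = line (\<psi> w)" using W2 q by blast
      then have "u w = u z" using circ[OF _ th(1), of w] q \<delta>sub z(2) by auto
      then have "w = z" by (rule inj_onD[OF inj _ w(1) z(1)])
      then show "q = line (\<psi> z)" using w(2) by simp
    qed
  qed
  moreover have "p \<in> W" using W1[of 0] \<delta>(1) \<psi>0 v(5) by simp
  moreover have "min \<epsilon>0 (pi / 2) > 0" using \<epsilon>0(1) by simp
  moreover have "W \<subseteq> N" by (simp add: W_def)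
  ultimately show ?thesis using opW by blast
qed

text \<open>\<open>C\<close> is closed in a compact space, so the fibre cardinality is locally
  constant in the angle and thus constant on the connected real line, which parametrises all real
  values.\<close>

theorem fibre_card_constant:
  assumes X: "real_curve n X" and f: "separating n X f" and C: "real_part n X C"
  shows "\<exists>k. \<forall>t\<in>real_proj_space 1. finite {p \<in> C. f p = t} \<and> card {p \<in> C. f p = t} = k"
proof -
  have rm: "real_morphism n X 1 f" using f by (simp add: separating_def)
  have CX: "C \<subseteq> X" using C by (auto simp: real_part_def real_points_def)
  define F where "F \<theta> = {p \<in> C. f p = circle_point \<theta>}" for \<theta>
  have comp: "compactin (proj_topology n) C"
    using C compact_space_proj closedin_compact_space unfolding real_part_def by blast
  have loc: "\<exists>\<epsilon>>0. \<forall>\<theta>. \<bar>\<theta> - \<theta>0\<bar> < \<epsilon> \<longrightarrow> finite (F \<theta>) \<and> card (F \<theta>) = card (F \<theta>0)" for \<theta>0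
  proof (rule fibre_card_locally_constant[OF comp Hausdorff_space_proj])
    show "F \<theta> \<subseteq> C" for \<theta> by (auto simp: F_def)
    fix p N assume "p \<in> F \<theta>0" "openin (proj_topology n) N" "p \<in> N"
    then show "\<exists>W \<epsilon>. openin (proj_topology n) W \<and> p \<in> W \<and> W \<subseteq> N \<and> 0 < \<epsilon> \<and>
        (\<forall>\<theta>. \<bar>\<theta> - \<theta>0\<bar> < \<epsilon> \<longrightarrow> (\<exists>!q. q \<in> W \<inter> F \<theta>))"
      unfolding F_def by (intro fibre_locally_unique[OF X f C]) auto
  next
    fix p assume p: "p \<in> C - F \<theta>0"
    then have "p \<in> X" "f p \<noteq> circle_point \<theta>0" using CX by (auto simp: F_def)
    from fibre_locally_away[OF X rm this]
    obtain W \<epsilon> where W: "openin (proj_topology n) W" "p \<in> W" "\<epsilon> > 0"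
      "\<forall>\<theta>. \<bar>\<theta> - \<theta>0\<bar> < \<epsilon> \<longrightarrow> (\<forall>q\<in>W \<inter> X. f q \<noteq> circle_point \<theta>)" by (elim exE conjE)
    have "W \<inter> F \<theta> = {}" if "\<bar>\<theta> - \<theta>0\<bar> < \<epsilon>" for \<theta>
      using W(4)[rule_format, OF that] CX unfolding F_def by auto
    then show "\<exists>W \<epsilon>. openin (proj_topology n) W \<and> p \<in> W \<and> 0 < \<epsilon> \<and> (\<forall>\<theta>. \<bar>\<theta> - \<theta>0\<bar> < \<epsilon> \<longrightarrow> W \<inter> F \<theta> = {})"
      using W(1-3) by (intro exI[of _ W] exI[of _ \<epsilon>]) simp
  qed
  have fin: "finite (F \<theta>)" for \<theta> using loc[of \<theta>] by force
  have const: "card (F \<theta>) = card (F 0)" for \<theta>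
  proof (rule connected_local_const[of UNIV \<theta> 0 "\<lambda>\<theta>. card (F \<theta>)"])
    show "\<forall>a\<in>UNIV. \<forall>\<^sub>F b in at a within UNIV. card (F a) = card (F b)"
    proof
      fix a :: real
      from loc[of a] obtain \<epsilon> where "\<epsilon> > 0" and \<epsilon>: "\<forall>\<theta>. \<bar>\<theta> - a\<bar> < \<epsilon> \<longrightarrow> finite (F \<theta>) \<and> card (F \<theta>) = card (F a)"
        by (elim exE conjE)
      have "\<forall>x\<in>UNIV. x \<noteq> a \<and> dist x a < \<epsilon> \<longrightarrow> card (F a) = card (F x)"
      proof (intro ballI impI)
        fix x :: real assume "x \<noteq> a \<and> dist x a < \<epsilon>"
        then have "\<bar>x - a\<bar> < \<epsilon>" by (simp add: dist_real_def)
        from \<epsilon>[rule_format, OF this] show "card (F a) = card (F x)" by simp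
      qed
      then show "\<forall>\<^sub>F b in at a within UNIV. card (F a) = card (F b)"
        unfolding eventually_at using \<open>\<epsilon> > 0\<close> by (intro exI[of _ \<epsilon>] conjI)
    qed
  qed auto
  show ?thesis
  proof (intro exI[of _ "card (F 0)"] ballI conjI)
    fix t assume "t \<in> real_proj_space 1"
    then obtain \<theta> where t: "t = circle_point \<theta>" unfolding real_proj_space_1_circle by (elim exE)
    show "finite {p \<in> C. f p = t}" using fin[of \<theta>] unfolding F_def t .
    show "card {p \<in> C. f p = t} = card (F 0)" using const[of \<theta>] unfolding F_def t .
  qed
qed

section \<open>Sums of separating morphisms\<close>

definition pair_vec :: "complex \<Rightarrow> complex \<Rightarrow> cvec" where
  "pair_vec x y = (\<lambda>i. if i = 0 then x else if i = 1 then y else 0)"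

lemma pair_vec_simps [simp]: "pair_vec x y 0 = x" "pair_vec x y 1 = y" "pair_vec x y (Suc 0) = y"
  by (simp_all add: pair_vec_def)

lemma pair_vec_cspace: "pair_vec x y \<in> cspace 1"
  by (simp add: pair_vec_def cspace_def)

lemma vec_upto_1: "vec_upto 1 F v = pair_vec (F 0 v) (F 1 v)"
  by (intro cspace_1_eqI vec_upto_cspace pair_vec_cspace) auto

lemma pair_vec_scale: "(\<lambda>i. c * pair_vec x y i) = pair_vec (c * x) (c * y)"
  by (intro cspace_1_eqI cspace_scale pair_vec_cspace) auto

lemma pair_vec_nonzero: "pair_vec x y \<noteq> 0 \<longleftrightarrow> x \<noteq> 0 \<or> y \<noteq> 0"
proof -
  have "pair_vec x y = 0 \<longleftrightarrow> x = 0 \<and> y = 0"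
  proof
    assume "pair_vec x y = 0"
    then have "pair_vec x y 0 = 0" "pair_vec x y 1 = 0" by simp_all
    then show "x = 0 \<and> y = 0" by simp
  next
    assume "x = 0 \<and> y = 0"
    then show "pair_vec x y = 0" by (intro cspace_1_eqI pair_vec_cspace) (auto simp: cspace_def)
  qed
  then show ?thesis by blast
qed

lemma some_in_line:
  assumes "w \<noteq> 0"
  obtains c where "c \<noteq> 0" "(SOME v. v \<in> line w - {0}) = (\<lambda>i. c * w i)"
proof -
  have "w \<in> line w - {0}" using assms by simp
  then have "(SOME v. v \<in> line w - {0}) \<in> line w - {0}" by (rule someI[of "\<lambda>v. v \<in> line w - {0}"])
  then show thesis using that in_line_iff by blast
qed

lemma lin_form_scale: "lin_form m a (\<lambda>i. c * w i) = c * lin_form m a w"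
  unfolding lin_form_def sum_distrib_left by (intro sum.cong) (simp_all only: mult.left_commute)

lemma lin_projection_line:
  assumes "w \<noteq> 0"
  shows "lin_projection m a b (line w) = line (pair_vec (lin_form m a w) (lin_form m b w))"
proof -
  obtain c where c: "c \<noteq> 0" "(SOME v. v \<in> line w - {0}) = (\<lambda>i. c * w i)"
    using some_in_line[OF assms] by blast
  show ?thesis
    unfolding lin_projection_def Let_def c(2) lin_form_scale pair_vec_def[symmetric] pair_vec_scale[symmetric]
    by (rule line_scale[OF c(1)])
qed

text \<open>The fraction \<open>v 0 / v 1 + w 0 / w 1\<close> in homogeneous coordinates. The choice
  of representatives is harmless by bilinearity, and only when both points are
  \<open>(1 : 0)\<close> does the formula give the zero vector.\<close>

definition add_points :: "cpoint \<Rightarrow> cpoint \<Rightarrow> cpoint" where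
  "add_points p q = (let v = SOME v. v \<in> p - {0}; w = SOME w. w \<in> q - {0}
     in line (pair_vec (v 0 * w 1 + v 1 * w 0) (v 1 * w 1)))"

lemma add_points_line:
  assumes "v \<noteq> 0" "w \<noteq> 0"
  shows "add_points (line v) (line w) = line (pair_vec (v 0 * w 1 + v 1 * w 0) (v 1 * w 1))"
proof -
  obtain c where c: "c \<noteq> 0" "(SOME x. x \<in> line v - {0}) = (\<lambda>i. c * v i)"
    using some_in_line[OF assms(1)] by blast
  obtain d where d: "d \<noteq> 0" "(SOME x. x \<in> line w - {0}) = (\<lambda>i. d * w i)"
    using some_in_line[OF assms(2)] by blast
  have "pair_vec ((c * v 0) * (d * w 1) + (c * v 1) * (d * w 0)) ((c * v 1) * (d * w 1)) =
      (\<lambda>i. (c * d) * pair_vec (v 0 * w 1 + v 1 * w 0) (v 1 * w 1) i)"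
    unfolding pair_vec_scale by (simp add: algebra_simps)
  then show ?thesis
    unfolding add_points_def Let_def c(2) d(2) using line_scale[of "c * d"] c(1) d(1) by simp
qed

lemma local_formsD:
  assumes "local_forms n X 1 f d F"
  shows "hform \<real> n d (F 0)" "hform \<real> n d (F 1)"
    "\<And>v. v \<in> cone_pts n X \<Longrightarrow> F 0 v \<noteq> 0 \<or> F 1 v \<noteq> 0 \<Longrightarrow> f (line v) = line (pair_vec (F 0 v) (F 1 v))"
proof -
  show "hform \<real> n d (F 0)" "hform \<real> n d (F 1)" using assms by (simp_all add: local_forms_def)
  fix v assume v: "v \<in> cone_pts n X" "F 0 v \<noteq> 0 \<or> F 1 v \<noteq> 0"
  then have "\<exists>i\<le>1. F i v \<noteq> 0" by auto
  then have "f (line v) = line (vec_upto 1 F v)" using assms v(1) by (simp add: local_forms_def)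
  then show "f (line v) = line (pair_vec (F 0 v) (F 1 v))" unfolding vec_upto_1 .
qed

lemma local_formsI:
  assumes "hform \<real> n d F0" "hform \<real> n d F1"
    and eq: "\<And>v. v \<in> cone_pts n X \<Longrightarrow> F0 v \<noteq> 0 \<or> F1 v \<noteq> 0 \<Longrightarrow> f (line v) = line (pair_vec (F0 v) (F1 v))"
  shows "local_forms n X 1 f d (\<lambda>i. if i = 0 then F0 else F1)"
  unfolding local_forms_def
proof (intro conjI allI ballI impI)
  fix v assume v: "v \<in> cone_pts n X" "\<exists>i\<le>1. (if i = 0 then F0 else F1) v \<noteq> 0"
  then have "F0 v \<noteq> 0 \<or> F1 v \<noteq> 0" by (metis (full_types))
  then show "f (line v) = line (vec_upto 1 (\<lambda>i. if i = 0 then F0 else F1) v)"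
  proof -
    have "vec_upto 1 (\<lambda>i. if i = 0 then F0 else F1) v = pair_vec (F0 v) (F1 v)"
      by (intro cspace_1_eqI vec_upto_cspace pair_vec_cspace) auto
    then show ?thesis using eq[OF v(1) \<open>F0 v \<noteq> 0 \<or> F1 v \<noteq> 0\<close>] by (simp only:)
  qed
qed (use assms in auto)

lemma nonvanishing_1: "(\<exists>i\<le>1. F i v \<noteq> 0) \<longleftrightarrow> F 0 v \<noteq> 0 \<or> F (1::nat) v \<noteq> 0"
proof
  assume "\<exists>i\<le>1. F i v \<noteq> 0"
  then obtain i where "i \<le> 1" "F i v \<noteq> 0" by blast
  then have "i = 0 \<or> i = 1" by linarith
  then show "F 0 v \<noteq> 0 \<or> F 1 v \<noteq> 0" using \<open>F i v \<noteq> 0\<close> by auto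
qed auto

text \<open>A Moebius transformation is a linear projection of the projective line to itself, so
  \<open>lin_projection\<close> is reused, with \<open>a\<close> and \<open>b\<close> as the rows of
  the matrix.\<close>

lemma local_forms_moebius:
  assumes G: "local_forms n X 1 g d G" and det: "a 0 * b 1 - a 1 * b 0 \<noteq> (0::real)"
  shows "local_forms n X 1 (\<lambda>p. lin_projection 1 a b (g p)) d
    (\<lambda>i. if i = 0 then (\<lambda>v. of_real (a 0) * G 0 v + of_real (a 1) * G 1 v)
      else (\<lambda>v. of_real (b 0) * G 0 v + of_real (b 1) * G 1 v))"
proof (rule local_formsI)
  show "hform \<real> n d (\<lambda>v. of_real (a 0) * G 0 v + of_real (a 1) * G 1 v)"
    "hform \<real> n d (\<lambda>v. of_real (b 0) * G 0 v + of_real (b 1) * G 1 v)"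
    using local_formsD(1,2)[OF G] by (intro hform_add hform_scaleI; simp)+
  fix v assume v: "v \<in> cone_pts n X"
    and nz: "of_real (a 0) * G 0 v + of_real (a 1) * G 1 v \<noteq> 0 \<or> of_real (b 0) * G 0 v + of_real (b 1) * G 1 v \<noteq> 0"
  then have nz': "G 0 v \<noteq> 0 \<or> G 1 v \<noteq> 0" by auto
  then have "g (line v) = line (pair_vec (G 0 v) (G 1 v))" using local_formsD(3)[OF G v] by simp
  moreover have "pair_vec (G 0 v) (G 1 v) \<noteq> 0" using nz' by (simp add: pair_vec_nonzero)
  moreover have "lin_form 1 c (pair_vec x y) = of_real (c 0) * x + of_real (c 1) * y" for c x y
    by (simp add: lin_form_def)
  ultimately show "lin_projection 1 a b (g (line v)) = line (pair_vec
      (of_real (a 0) * G 0 v + of_real (a 1) * G 1 v) (of_real (b 0) * G 0 v + of_real (b 1) * G 1 v))"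
    by (simp add: lin_projection_line)
qed

lemma real_2x2_kernel:
  fixes a b :: "nat \<Rightarrow> real" and x y :: complex
  assumes det: "a 0 * b 1 - a 1 * b 0 \<noteq> 0"
    and "of_real (a 0) * x + of_real (a 1) * y = 0" "of_real (b 0) * x + of_real (b 1) * y = 0"
  shows "x = 0 \<and> y = 0"
proof -
  have "of_real (a 0 * b 1 - a 1 * b 0) * x =
      of_real (b 1) * (of_real (a 0) * x + of_real (a 1) * y) - of_real (a 1) * (of_real (b 0) * x + of_real (b 1) * y)"
    by (simp add: algebra_simps)
  moreover have "of_real (a 0 * b 1 - a 1 * b 0) * y =
      of_real (a 0) * (of_real (b 0) * x + of_real (b 1) * y) - of_real (b 0) * (of_real (a 0) * x + of_real (a 1) * y)"
    by (simp add: algebra_simps)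
  ultimately have "complex_of_real (a 0 * b 1 - a 1 * b 0) * x = 0" "complex_of_real (a 0 * b 1 - a 1 * b 0) * y = 0"
    using assms(2,3) by simp_all
  moreover have "complex_of_real (a 0 * b 1 - a 1 * b 0) \<noteq> 0" using det by (simp only: of_real_eq_0_iff not_False_eq_True)
  ultimately show ?thesis by (simp only: mult_eq_0_iff) simp
qed

lemma morphism_moebius:
  assumes X: "real_curve n X" and g: "real_morphism n X 1 g" and det: "a 0 * b 1 - a 1 * b 0 \<noteq> (0::real)"
  shows "real_morphism n X 1 (\<lambda>p. lin_projection 1 a b (g p))"
  unfolding real_morphism_iff[OF real_curve_subset[OF X]]
proof
  fix v assume v: "v \<in> cone_pts n X"
  obtain d G where G: "local_forms n X 1 g d G" and nz: "\<exists>i\<le>1. G i v \<noteq> 0"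
    using morphism_local_forms[OF X g v] by blast
  have "of_real (a 0) * G 0 v + of_real (a 1) * G 1 v \<noteq> 0 \<or> of_real (b 0) * G 0 v + of_real (b 1) * G 1 v \<noteq> 0"
    using real_2x2_kernel[OF det] nz[unfolded nonvanishing_1] by blast
  then show "\<exists>d F. local_forms n X 1 (\<lambda>p. lin_projection 1 a b (g p)) d F \<and> (\<exists>i\<le>1. F i v \<noteq> 0)"
    unfolding nonvanishing_1 using local_forms_moebius[OF G det]
    by (intro exI[of _ d] exI[of _ "\<lambda>i. if i = 0 then (\<lambda>v. of_real (a 0) * G 0 v + of_real (a 1) * G 1 v)
      else (\<lambda>v. of_real (b 0) * G 0 v + of_real (b 1) * G 1 v)"] conjI) simp_all
qed

text \<open>The sign of the determinant of a real matrix decides whether the two half planes are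
  kept or exchanged.\<close>

lemma Im_moebius:
  "Im ((of_real a0 * x + of_real a1 * y) * cnj (of_real b0 * x + of_real b1 * y)) =
    (a0 * b1 - a1 * b0) * Im (x * cnj y)"
  by (simp add: algebra_simps)

lemma local_forms_moebius_at:
  assumes G: "local_forms n X 1 g d G" and det: "a 0 * b 1 - a 1 * b 0 \<noteq> (0::real)"
    and v: "v \<in> cone_pts n X" and nz: "G 0 v \<noteq> 0 \<or> G 1 v \<noteq> 0"
  shows "upper_point (lin_projection 1 a b (g (line v))) \<longleftrightarrow> (a 0 * b 1 - a 1 * b 0) * Im (G 0 v * cnj (G 1 v)) > 0"
    and "lower_point (lin_projection 1 a b (g (line v))) \<longleftrightarrow> (a 0 * b 1 - a 1 * b 0) * Im (G 0 v * cnj (G 1 v)) < 0"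
    and "lin_projection 1 a b (g (line v)) \<in> real_proj_space 1 \<longleftrightarrow> Im (G 0 v * cnj (G 1 v)) = 0"
    and "lin_projection 1 a b (g (line v)) = circle_point 0 \<longleftrightarrow> of_real (b 0) * G 0 v + of_real (b 1) * G 1 v = 0"
proof -
  have "of_real (a 0) * G 0 v + of_real (a 1) * G 1 v \<noteq> 0 \<or> of_real (b 0) * G 0 v + of_real (b 1) * G 1 v \<noteq> 0"
    using real_2x2_kernel[OF det] nz by blast
  then have nz': "\<exists>i\<le>(1::nat). (if i = 0 then (\<lambda>v. of_real (a 0) * G 0 v + of_real (a 1) * G 1 v)
      else (\<lambda>v. of_real (b 0) * G 0 v + of_real (b 1) * G 1 v)) v \<noteq> 0"
  proof (elim disjE)
    assume "of_real (a 0) * G 0 v + of_real (a 1) * G 1 v \<noteq> 0"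
    then show ?thesis by (intro exI[of _ "0::nat"]) simp
  next
    assume "of_real (b 0) * G 0 v + of_real (b 1) * G 1 v \<noteq> 0"
    then show ?thesis by (intro exI[of _ "1::nat"]) simp
  qed
  note L = local_forms_1[OF local_forms_moebius[OF G det] v nz']
  note L' = L[unfolded if_P[OF refl] if_not_P[OF one_neq_zero] Im_moebius]
  show "upper_point (lin_projection 1 a b (g (line v))) \<longleftrightarrow> (a 0 * b 1 - a 1 * b 0) * Im (G 0 v * cnj (G 1 v)) > 0"
    "lower_point (lin_projection 1 a b (g (line v))) \<longleftrightarrow> (a 0 * b 1 - a 1 * b 0) * Im (G 0 v * cnj (G 1 v)) < 0"
    by (rule L'(1), rule L'(2))
  show "lin_projection 1 a b (g (line v)) \<in> real_proj_space 1 \<longleftrightarrow> Im (G 0 v * cnj (G 1 v)) = 0"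
    using L'(3) det by (simp only: mult_eq_0_iff) simp
  show "lin_projection 1 a b (g (line v)) = circle_point 0 \<longleftrightarrow> of_real (b 0) * G 0 v + of_real (b 1) * G 1 v = 0"
    using local_forms_circle[OF local_forms_moebius[OF G det] v nz', of 0] by auto
qed

lemma curve_point_cases:
  assumes "real_curve n X" "p \<in> X"
  obtains v where "v \<in> cone_pts n X" "p = line v"
  using in_points_cone[OF real_curve_subset[OF assms(1)] assms(2)] by blast

lemma separating_moebius:
  assumes X: "real_curve n X" and g: "separating n X g" and det: "a 0 * b 1 - a 1 * b 0 \<noteq> (0::real)"
  shows "separating n X (\<lambda>p. lin_projection 1 a b (g p))"
proof -
  have rg: "real_morphism n X 1 g" using g by (simp add: separating_def)
  have "lin_projection 1 a b (g p) \<in> real_proj_space 1 \<longleftrightarrow> g p \<in> real_proj_space 1" if pX: "p \<in> X" for p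
  proof -
    obtain v where v: "v \<in> cone_pts n X" "p = line v" using curve_point_cases[OF X pX] by blast
    obtain d G where G: "local_forms n X 1 g d G" and nz: "\<exists>i\<le>1. G i v \<noteq> 0"
      using morphism_local_forms[OF X rg v(1)] by blast
    show ?thesis unfolding v(2)
      using local_forms_1(3)[OF G v(1) nz] local_forms_moebius_at(3)[OF G det v(1) nz[unfolded nonvanishing_1]] by blast
  qed
  then show ?thesis using g morphism_moebius[where a=a and b=b, OF X rg det] by (auto simp: separating_def)
qed

section \<open>Sheet numbers as fibre cardinalities\<close>

lemma sheet_number_eqI:
  assumes "\<forall>t\<in>real_proj_space 1. finite {p \<in> C. f p = t} \<and> card {p \<in> C. f p = t} = k"
  shows "sheet_number C f = k"
proof -
  have c: "circle_point 0 \<in> real_proj_space 1" using real_proj_space_1_circle by blast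
  show ?thesis
    unfolding sheet_number_def
  proof (rule the_equality)
    show "\<forall>t\<in>real_proj_space 1. finite {p \<in> C. f p = t} \<and> card {p \<in> C. f p = t} = k" by (rule assms)
    fix k' assume "\<forall>t\<in>real_proj_space 1. finite {p \<in> C. f p = t} \<and> card {p \<in> C. f p = t} = k'"
    then show "k' = k" using assms c by metis
  qed
qed

lemma sheet_number_card:
  assumes X: "real_curve n X" and f: "separating n X f" and C: "real_part n X C" and t: "t \<in> real_proj_space 1"
  shows "finite {p \<in> C. f p = t}" "card {p \<in> C. f p = t} = sheet_number C f"
proof -
  obtain k where k: "\<forall>t\<in>real_proj_space 1. finite {p \<in> C. f p = t} \<and> card {p \<in> C. f p = t} = k"
    using fibre_card_constant[OF X f C] by blast
  then show "finite {p \<in> C. f p = t}" "card {p \<in> C. f p = t} = sheet_number C f"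
    using t sheet_number_eqI[OF k] by auto
qed

text \<open>The interval is shorter than \<open>pi\<close>, so the sine of a nonzero difference of
  angles is nonzero. The purpose is to have infinitely many real values to choose from.\<close>

lemma circle_point_inj: "inj_on circle_point {0..<1}"
proof (rule inj_onI)
  fix x y :: real assume xy: "x \<in> {0..<1}" "y \<in> {0..<1}" "circle_point x = circle_point y"
  define u where "u = pair_vec (of_real (cos x)) (of_real (sin x))"
  have "cos x \<noteq> 0 \<or> sin x \<noteq> 0" by (metis sin_cos_squared_add3 mult_zero_left add_0 zero_neq_one)
  then have "u \<noteq> 0" by (simp add: u_def pair_vec_nonzero)
  moreover have "circle_point x = line u" by (simp add: circle_point_def u_def pair_vec_def)
  ultimately have "complex_of_real (cos x) * of_real (sin y) = of_real (sin x) * of_real (cos y)"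
    using xy(3) line_eq_circle_point[of u y] pair_vec_cspace by (simp add: u_def)
  then have "complex_of_real (cos x * sin y) = of_real (sin x * cos y)" by simp
  then have "cos x * sin y = sin x * cos y" by (simp only: of_real_eq_iff)
  then have s: "sin (y - x) = 0" "sin (x - y) = 0" by (simp_all add: sin_diff mult.commute)
  show "x = y"
  proof (rule ccontr)
    assume "x \<noteq> y"
    then consider "x < y" | "y < x" by linarith
    then show False
    proof cases
      case 1
      then have "sin (y - x) > 0" using xy(1,2) pi_gt3 by (intro sin_gt_zero) auto
      then show False using s by simp
    next
      case 2
      then have "sin (x - y) > 0" using xy(1,2) pi_gt3 by (intro sin_gt_zero) auto
      then show False using s by simp
    qed
  qed
qed

text \<open>Treating the whole real locus as one union of components gives finiteness of the full
  real fibres, in particular of the set of poles.\<close>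

lemma real_part_real_points: "real_curve n X \<Longrightarrow> real_part n X (real_points n X)"
  unfolding real_part_def
proof (intro conjI allI impI)
  fix S assume "connectedin (subtopology (proj_topology n) (real_points n X)) S"
  from connectedin_subset_topspace[OF this] show "S \<subseteq> real_points n X" by (simp add: topspace_subtopology)
qed (auto intro: closedin_real_points)

text \<open>A rotation moves a value that \<open>g\<close> does not take at the poles of
  \<open>f\<close> to \<open>(1 : 0)\<close>, and a factor in the first row adjusts the orientation.
  Sheet numbers survive because the new fibre over \<open>(1 : 0)\<close> is an old fibre over
  another real point.\<close>

lemma exists_moebius:
  assumes X: "real_curve n X" "dividing_type n X" and f: "separating n X f" and g: "separating n X g"
  obtains a b where "a 0 * b 1 - a 1 * b 0 \<noteq> (0::real)"
    "\<And>p. p \<in> X \<Longrightarrow> upper_point (f p) \<longleftrightarrow> upper_point (lin_projection 1 a b (g p))"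
    "\<And>p. p \<in> X \<Longrightarrow> lower_point (f p) \<longleftrightarrow> lower_point (lin_projection 1 a b (g p))"
    "\<And>p. p \<in> X \<Longrightarrow> \<not> (f p = circle_point 0 \<and> lin_projection 1 a b (g p) = circle_point 0)"
    "\<And>C. real_part n X C \<Longrightarrow> sheet_number C (\<lambda>p. lin_projection 1 a b (g p)) = sheet_number C g"
proof -
  have rg: "real_morphism n X 1 g" using g by (simp add: separating_def)
  have c0: "circle_point 0 \<in> real_proj_space 1" using real_proj_space_1_circle by blast
  have "finite {p \<in> real_points n X. f p = circle_point 0}"
    by (rule sheet_number_card(1)[OF X(1) f real_part_real_points[OF X(1)] c0])
  then have "finite (g ` {p \<in> real_points n X. f p = circle_point 0})" by (rule finite_imageI)
  moreover have "infinite (circle_point ` {0..<1})"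
    using finite_imageD[OF _ circle_point_inj] infinite_Ico[of "0::real" 1] by auto
  ultimately have "\<not> circle_point ` {0..<1} \<subseteq> g ` {p \<in> real_points n X. f p = circle_point 0}"
    using finite_subset by blast
  then obtain \<phi> where \<phi>: "circle_point \<phi> \<notin> g ` {p \<in> real_points n X. f p = circle_point 0}"
    by blast
  \<comment> \<open>The matrix with rows \<open>a\<close> and \<open>b\<close> below has determinant
    \<open>- s\<close>, so \<open>s = -1\<close> keeps the signs of \<open>g\<close> and
    \<open>s = 1\<close> exchanges them; row \<open>b\<close> vanishes exactly at the angle
    \<open>\<phi>\<close>.\<close>
  define s :: real where "s = (if \<forall>p\<in>X. (upper_point (f p) \<longleftrightarrow> upper_point (g p)) \<and> (lower_point (f p) \<longleftrightarrow> lower_point (g p)) then -1 else 1)"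
  define a where "a = (\<lambda>i::nat. if i = 0 then s * cos \<phi> else s * sin \<phi>)"
  define b where "b = (\<lambda>i::nat. if i = 0 then sin \<phi> else - cos \<phi>)"
  have "a 0 * b 1 - a 1 * b 0 = - s * (cos \<phi> * cos \<phi> + sin \<phi> * sin \<phi>)"
    by (simp add: a_def b_def algebra_simps del: sin_cos_squared_add3)
  then have det: "a 0 * b 1 - a 1 * b 0 = - s" unfolding sin_cos_squared_add3 by simp
  have s: "s = 1 \<or> s = -1" by (simp add: s_def)
  then have det0: "a 0 * b 1 - a 1 * b 0 \<noteq> 0" using det by auto
  have pole: "lin_projection 1 a b (g p) = circle_point 0 \<longleftrightarrow> g p = circle_point \<phi>"
    and up: "upper_point (lin_projection 1 a b (g p)) \<longleftrightarrow> (if s = -1 then upper_point (g p) else lower_point (g p))"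
    and lo: "lower_point (lin_projection 1 a b (g p)) \<longleftrightarrow> (if s = -1 then lower_point (g p) else upper_point (g p))"
    if pX: "p \<in> X" for p
  proof -
    obtain v where v: "v \<in> cone_pts n X" "p = line v" using curve_point_cases[OF X(1) pX] by blast
    obtain d G where G: "local_forms n X 1 g d G" and nz: "\<exists>i\<le>1. G i v \<noteq> 0"
      using morphism_local_forms[OF X(1) rg v(1)] by blast
    note nz' = nz[unfolded nonvanishing_1]
    note M = local_forms_moebius_at[where a = a and b = b, OF G det0 v(1) nz', folded v(2)]
    note L = local_forms_1[OF G v(1) nz, folded v(2)]
    have "of_real (b 0) * G 0 v + of_real (b 1) * G 1 v = 0 \<longleftrightarrow> G 0 v * of_real (sin \<phi>) = G 1 v * of_real (cos \<phi>)"
      by (simp add: b_def mult.commute)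
    then show "lin_projection 1 a b (g p) = circle_point 0 \<longleftrightarrow> g p = circle_point \<phi>"
      using M(4) local_forms_circle[OF G v(1) nz, of \<phi>] v(2) by simp
    show "upper_point (lin_projection 1 a b (g p)) \<longleftrightarrow> (if s = -1 then upper_point (g p) else lower_point (g p))"
      "lower_point (lin_projection 1 a b (g p)) \<longleftrightarrow> (if s = -1 then lower_point (g p) else upper_point (g p))"
      using M(1,2) L(1,2) s unfolding det by auto
  qed
  show thesis
  proof (rule that[of a b])
    show "a 0 * b 1 - a 1 * b 0 \<noteq> 0" by (rule det0)
    fix p assume p: "p \<in> X"
    have *: "(upper_point (f p) \<longleftrightarrow> (if s = -1 then upper_point (g p) else lower_point (g p))) \<and>
      (lower_point (f p) \<longleftrightarrow> (if s = -1 then lower_point (g p) else upper_point (g p)))"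
    proof (cases "s = -1")
      case True
      then have "\<forall>p\<in>X. (upper_point (f p) \<longleftrightarrow> upper_point (g p)) \<and> (lower_point (f p) \<longleftrightarrow> lower_point (g p))"
        unfolding s_def by (metis one_neq_neg_one)
      then show ?thesis using p True by simp
    next
      case False
      then have "\<not> (\<forall>p\<in>X. (upper_point (f p) \<longleftrightarrow> upper_point (g p)) \<and> (lower_point (f p) \<longleftrightarrow> lower_point (g p)))"
        unfolding s_def by argo
      then have "\<forall>p\<in>X. (upper_point (f p) \<longleftrightarrow> lower_point (g p)) \<and> (lower_point (f p) \<longleftrightarrow> upper_point (g p))"
        using dividing_signs_agree[OF X f g] by argo
      then show ?thesis using p False by simp
    qed
    show "upper_point (f p) \<longleftrightarrow> upper_point (lin_projection 1 a b (g p))"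
      "lower_point (f p) \<longleftrightarrow> lower_point (lin_projection 1 a b (g p))"
      using * up[OF p] lo[OF p] by simp_all
    show "\<not> (f p = circle_point 0 \<and> lin_projection 1 a b (g p) = circle_point 0)"
    proof
      assume A: "f p = circle_point 0 \<and> lin_projection 1 a b (g p) = circle_point 0"
      then have "p \<in> real_points n X" using f p c0 by (auto simp: separating_def)
      then show False using \<phi> A pole[OF p] by blast
    qed
  next
    fix C assume C: "real_part n X C"
    then have CX: "C \<subseteq> X" by (auto simp: real_part_def real_points_def)
    have "{p \<in> C. lin_projection 1 a b (g p) = circle_point 0} = {p \<in> C. g p = circle_point \<phi>}"
      using pole CX by blast
    moreover have "circle_point \<phi> \<in> real_proj_space 1" using real_proj_space_1_circle by blast
    ultimately show "sheet_number C (\<lambda>p. lin_projection 1 a b (g p)) = sheet_number C g"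
      using sheet_number_card(2)[OF X(1) separating_moebius[where a = a and b = b, OF X(1) g det0] C c0]
        sheet_number_card(2)[OF X(1) g C, of "circle_point \<phi>"] by simp
  qed
qed

lemma local_forms_add:
  assumes F: "local_forms n X 1 f d F" and G: "local_forms n X 1 g e G"
  shows "local_forms n X 1 (\<lambda>p. add_points (f p) (g p)) (d + e)
    (\<lambda>i. if i = 0 then (\<lambda>v. F 0 v * G 1 v + F 1 v * G 0 v) else (\<lambda>v. F 1 v * G 1 v))"
proof (rule local_formsI)
  show "hform \<real> n (d + e) (\<lambda>v. F 0 v * G 1 v + F 1 v * G 0 v)" "hform \<real> n (d + e) (\<lambda>v. F 1 v * G 1 v)"
    by (rule hform_add[OF hform_mult[OF local_formsD(1)[OF F] local_formsD(2)[OF G]]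
          hform_mult[OF local_formsD(2)[OF F] local_formsD(1)[OF G]]],
        rule hform_mult[OF local_formsD(2)[OF F] local_formsD(2)[OF G]])
  fix v assume v: "v \<in> cone_pts n X" and nz: "F 0 v * G 1 v + F 1 v * G 0 v \<noteq> 0 \<or> F 1 v * G 1 v \<noteq> 0"
  then have nzF: "F 0 v \<noteq> 0 \<or> F 1 v \<noteq> 0" and nzG: "G 0 v \<noteq> 0 \<or> G 1 v \<noteq> 0" by auto
  show "add_points (f (line v)) (g (line v)) = line (pair_vec (F 0 v * G 1 v + F 1 v * G 0 v) (F 1 v * G 1 v))"
    unfolding local_formsD(3)[OF F v nzF] local_formsD(3)[OF G v nzG]
    using add_points_line[of "pair_vec (F 0 v) (F 1 v)" "pair_vec (G 0 v) (G 1 v)"] nzF nzG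
    by (simp add: pair_vec_nonzero)
qed

text \<open>After clearing denominators the imaginary parts add with nonnegative weights, so equal
  signs cannot cancel.\<close>

lemma Im_add_fractions:
  "Im ((x * w + y * z) * cnj (y * w)) = (norm w)\<^sup>2 * Im (x * cnj y) + (norm y)\<^sup>2 * Im (z * cnj w)"
proof -
  have "(x * w + y * z) * cnj (y * w) = (w * x) * cnj (w * y) + (y * z) * cnj (y * w)"
    by (simp add: algebra_simps)
  then show ?thesis by (simp only: plus_complex.sel Im_scale)
qed

text \<open>Away from the real points the value of \<open>f\<close> is not real, so its denominator
  is nonzero and the \<open>g\<close>-term has positive weight; equal signs then make the sum
  nonreal. Sheets are counted over \<open>(1 : 0)\<close>, where the fibre of the sum is the
  disjoint union of the fibres of \<open>f\<close> and \<open>g\<close>.\<close>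

lemma separating_add:
  assumes X: "real_curve n X" and f: "separating n X f" and g: "separating n X g"
    and up: "\<And>p. p \<in> X \<Longrightarrow> upper_point (f p) \<longleftrightarrow> upper_point (g p)"
    and lo: "\<And>p. p \<in> X \<Longrightarrow> lower_point (f p) \<longleftrightarrow> lower_point (g p)"
    and poles: "\<And>p. p \<in> X \<Longrightarrow> \<not> (f p = circle_point 0 \<and> g p = circle_point 0)"
  shows "separating n X (\<lambda>p. add_points (f p) (g p))"
    and "\<And>C. real_part n X C \<Longrightarrow>
      sheet_number C (\<lambda>p. add_points (f p) (g p)) = sheet_number C f + sheet_number C g"
proof -
  let ?h = "\<lambda>p. add_points (f p) (g p)"
  have rf: "real_morphism n X 1 f" and rg: "real_morphism n X 1 g" using f g by (simp_all add: separating_def)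
  have main: "(\<exists>d H. local_forms n X 1 ?h d H \<and> (\<exists>i\<le>1. H i v \<noteq> 0)) \<and>
      (?h (line v) \<in> real_proj_space 1 \<longleftrightarrow> line v \<in> real_points n X) \<and>
      (?h (line v) = circle_point 0 \<longleftrightarrow> f (line v) = circle_point 0 \<or> g (line v) = circle_point 0)"
    if v: "v \<in> cone_pts n X" for v
  proof -
    obtain d F where F: "local_forms n X 1 f d F" and nzF: "\<exists>i\<le>1. F i v \<noteq> 0"
      using morphism_local_forms[OF X rf v] by blast
    obtain e G where G: "local_forms n X 1 g e G" and nzG: "\<exists>i\<le>1. G i v \<noteq> 0"
      using morphism_local_forms[OF X rg v] by blast
    have poleF: "f (line v) = circle_point 0 \<longleftrightarrow> F 1 v = 0" and poleG: "g (line v) = circle_point 0 \<longleftrightarrow> G 1 v = 0"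
      using local_forms_circle[OF F v nzF, of 0] local_forms_circle[OF G v nzG, of 0] by auto
    have np: "\<not> (F 1 v = 0 \<and> G 1 v = 0)" using poles[OF cone_line[OF v]] poleF poleG by blast
    define H where "H = (\<lambda>i::nat. if i = 0 then (\<lambda>v. F 0 v * G 1 v + F 1 v * G 0 v) else (\<lambda>v. F 1 v * G 1 v))"
    have H: "local_forms n X 1 ?h (d + e) H" unfolding H_def by (rule local_forms_add[OF F G])
    have H01: "H 0 v = F 0 v * G 1 v + F 1 v * G 0 v" "H 1 v = F 1 v * G 1 v" by (simp_all add: H_def)
    have "H 0 v \<noteq> 0 \<or> H 1 v \<noteq> 0"
      unfolding H01 using np nzF[unfolded nonvanishing_1] nzG[unfolded nonvanishing_1] by auto
    then have nzH: "\<exists>i\<le>1. H i v \<noteq> 0" unfolding nonvanishing_1 .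
    have pole: "?h (line v) = circle_point 0 \<longleftrightarrow> f (line v) = circle_point 0 \<or> g (line v) = circle_point 0"
    proof -
      have "?h (line v) = circle_point 0 \<longleftrightarrow> H 1 v = 0" using local_forms_circle[OF H v nzH, of 0] by auto
      then show ?thesis unfolding poleF poleG H01 by simp
    qed
    note LF = local_forms_1[OF F v nzF] and LG = local_forms_1[OF G v nzG]
    have im: "Im (H 0 v * cnj (H 1 v)) =
        (norm (G 1 v))\<^sup>2 * Im (F 0 v * cnj (F 1 v)) + (norm (F 1 v))\<^sup>2 * Im (G 0 v * cnj (G 1 v))"
      unfolding H01 by (rule Im_add_fractions)
    have "Im (H 0 v * cnj (H 1 v)) = 0 \<longleftrightarrow> line v \<in> real_points n X"
    proof
      assume "line v \<in> real_points n X"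
      then have "Im (F 0 v * cnj (F 1 v)) = 0" "Im (G 0 v * cnj (G 1 v)) = 0"
        using f g LF(3) LG(3) cone_line[OF v] by (auto simp: separating_def)
      then show "Im (H 0 v * cnj (H 1 v)) = 0" unfolding im by simp
    next
      assume z: "Im (H 0 v * cnj (H 1 v)) = 0"
      show "line v \<in> real_points n X"
      proof (rule ccontr)
        assume "line v \<notin> real_points n X"
        then have "f (line v) \<notin> real_proj_space 1"
          using f cone_line[OF v] by (auto simp: separating_def)
        then have nF: "Im (F 0 v * cnj (F 1 v)) \<noteq> 0" using LF(3) by simp
        then have "F 1 v \<noteq> 0" by auto
        have sg: "Im (F 0 v * cnj (F 1 v)) > 0 \<longleftrightarrow> Im (G 0 v * cnj (G 1 v)) > 0"
          "Im (F 0 v * cnj (F 1 v)) < 0 \<longleftrightarrow> Im (G 0 v * cnj (G 1 v)) < 0"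
          using LF(1,2) LG(1,2) up lo cone_line[OF v] by blast+
        consider "Im (F 0 v * cnj (F 1 v)) > 0" | "Im (F 0 v * cnj (F 1 v)) < 0" using nF by linarith
        then show False
        proof cases
          case 1
          then have "(norm (F 1 v))\<^sup>2 * Im (G 0 v * cnj (G 1 v)) > 0"
            using sg(1) \<open>F 1 v \<noteq> 0\<close> by (intro mult_pos_pos) auto
          moreover have "(norm (G 1 v))\<^sup>2 * Im (F 0 v * cnj (F 1 v)) \<ge> 0"
            using 1 by (intro mult_nonneg_nonneg) auto
          ultimately show False using z unfolding im by linarith
        next
          case 2
          then have "(norm (F 1 v))\<^sup>2 * Im (G 0 v * cnj (G 1 v)) < 0"
            using sg(2) \<open>F 1 v \<noteq> 0\<close> by (intro mult_pos_neg) auto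
          moreover have "(norm (G 1 v))\<^sup>2 * Im (F 0 v * cnj (F 1 v)) \<le> 0"
            using 2 by (intro mult_nonneg_nonpos) auto
          ultimately show False using z unfolding im by linarith
        qed
      qed
    qed
    then have "?h (line v) \<in> real_proj_space 1 \<longleftrightarrow> line v \<in> real_points n X"
      using local_forms_1(3)[OF H v nzH] by blast
    then show ?thesis using H nzH pole by blast
  qed
  have rh: "real_morphism n X 1 ?h"
    unfolding real_morphism_iff[OF real_curve_subset[OF X]] using main by blast
  have hX: "(?h p \<in> real_proj_space 1 \<longleftrightarrow> p \<in> real_points n X) \<and>
      (?h p = circle_point 0 \<longleftrightarrow> f p = circle_point 0 \<or> g p = circle_point 0)" if p: "p \<in> X" for p
  proof -
    obtain v where v: "v \<in> cone_pts n X" "p = line v" using curve_point_cases[OF X p] by blast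
    show ?thesis unfolding v(2) using main[OF v(1)] by blast
  qed
  show sep: "separating n X ?h"
    unfolding separating_def using rh hX by (auto simp: real_points_def)
  fix C assume C: "real_part n X C"
  then have CX: "C \<subseteq> X" by (auto simp: real_part_def real_points_def)
  have c0: "circle_point 0 \<in> real_proj_space 1" using real_proj_space_1_circle by blast
  have "{p \<in> C. ?h p = circle_point 0} = {p \<in> C. f p = circle_point 0} \<union> {p \<in> C. g p = circle_point 0}"
    using hX CX by blast
  moreover have "{p \<in> C. f p = circle_point 0} \<inter> {p \<in> C. g p = circle_point 0} = {}"
    using poles CX by blast
  ultimately show "sheet_number C ?h = sheet_number C f + sheet_number C g"
    using sheet_number_card[OF X sep C c0] sheet_number_card[OF X f C c0] sheet_number_card[OF X g C c0]
    by (simp add: card_Un_disjoint)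
qed

text \<open>A component is closed in the real points, which are closed in projective space, and its
  maximality absorbs every connected set that meets it.\<close>

lemma real_part_component:
  assumes X: "real_curve n X" and C: "C \<in> proj_components n (real_points n X)"
  shows "real_part n X C" "C \<noteq> {}"
proof -
  let ?T = "subtopology (proj_topology n) (real_points n X)"
  have C': "C \<in> connected_components_of ?T" using C by (simp add: proj_components_def)
  have "C \<subseteq> topspace ?T" using C' by (rule connected_components_of_subset)
  then have "C \<subseteq> real_points n X" by (simp add: topspace_subtopology)
  moreover have "closedin ?T C" using C' by (rule closedin_connected_components_of)
  then have "closedin (proj_topology n) C" using closedin_real_points[OF X] by (rule closedin_trans_full)
  moreover have "S \<subseteq> C" if "connectedin ?T S" "S \<inter> C \<noteq> {}" for S
    using connected_components_of_maximal[OF C' that(1)] that(2) by (auto simp: disjnt_def)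
  ultimately show "real_part n X C" unfolding real_part_def by blast
  show "C \<noteq> {}" using C' by (rule nonempty_connected_components_of)
qed

lemma sheet_number_positive:
  assumes X: "real_curve n X" and f: "separating n X f" and C: "real_part n X C" "C \<noteq> {}"
  shows "sheet_number C f > 0"
proof -
  obtain p where p: "p \<in> C" using C(2) by blast
  then have "p \<in> real_points n X" using C(1) by (auto simp: real_part_def)
  then have "f p \<in> real_proj_space 1" using f by (auto simp: separating_def)
  note S = sheet_number_card[OF X f C(1) this]
  have "{q \<in> C. f q = f p} \<noteq> {}" using p by blast
  then show ?thesis using S card_gt_0_iff by metis
qed

section \<open>Segre embeddings\<close>

text \<open>The tensor product of \<open>w \<in> cspace m\<close> with a vector \<open>u \<in> cspace 1\<close>; its two columns
  are recovered by \<open>segre_col\<close>.\<close>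

definition segre :: "nat \<Rightarrow> cvec \<Rightarrow> cvec \<Rightarrow> cvec" where
  "segre m u w = (\<lambda>i. if i \<le> m then u 0 * w i else if i \<le> 2 * m + 1 then u 1 * w (i - (m + 1)) else 0)"

definition segre_col :: "nat \<Rightarrow> nat \<Rightarrow> cvec \<Rightarrow> cvec" where
  "segre_col m j z = (\<lambda>i. if i \<le> m then z (i + j * (m + 1)) else 0)"

lemma segre_cspace: "segre m u w \<in> cspace (2 * m + 1)"
  by (simp add: segre_def cspace_def)

lemma segre_col_cspace: "segre_col m j z \<in> cspace m"
  by (simp add: segre_col_def cspace_def)

lemma segre_col_segre:
  assumes "w \<in> cspace m" "j \<le> 1"
  shows "segre_col m j (segre m u w) = (\<lambda>i. u j * w i)"
proof
  fix i
  have "j = 0 \<or> j = 1" using assms(2) by linarith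
  then show "segre_col m j (segre m u w) i = u j * w i"
    using assms(1) by (auto simp: segre_col_def segre_def cspace_def)
qed

lemma segre_eqI:
  assumes "z \<in> cspace (2 * m + 1)" "w \<in> cspace m"
    and "segre_col m 0 z = (\<lambda>i. u 0 * w i)" "segre_col m 1 z = (\<lambda>i. u 1 * w i)"
  shows "z = segre m u w"
proof
  fix i
  consider "i \<le> m" | "m < i" "i \<le> 2 * m + 1" | "2 * m + 1 < i" by linarith
  then show "z i = segre m u w i"
  proof cases
    case 1
    then have "segre_col m 0 z i = z i" by (simp add: segre_col_def)
    then show ?thesis using assms(3) 1 by (simp add: segre_def)
  next
    case 2
    then have "segre_col m 1 z (i - (m + 1)) = z i" by (simp add: segre_col_def)
    moreover have "segre_col m 1 z (i - (m + 1)) = u 1 * w (i - (m + 1))" using assms(4) by simp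
    ultimately show ?thesis using 2 by (simp add: segre_def)
  next
    case 3
    then show ?thesis using assms(1) by (simp add: segre_def cspace_def)
  qed
qed

lemma segre_col_scale: "segre_col m j (\<lambda>i. c * z i) = (\<lambda>i. c * segre_col m j z i)"
  by (auto simp: segre_col_def fun_eq_iff)

lemma segre_scale_left: "segre m (\<lambda>i. c * u i) w = (\<lambda>i. c * segre m u w i)"
  and segre_scale_right: "segre m u (\<lambda>i. c * w i) = (\<lambda>i. c * segre m u w i)"
  by (auto simp: segre_def fun_eq_iff)

lemma segre_nonzero:
  assumes "u 0 \<noteq> 0 \<or> u 1 \<noteq> 0" "w \<in> cspace m" "w \<noteq> 0"
  shows "segre m u w \<noteq> 0"
proof
  assume z: "segre m u w = 0"
  obtain i where "w i \<noteq> 0" using exists_nonzero_coord assms(2,3) by blast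
  have "u j * w i = 0" if "j \<le> 1" for j
  proof -
    have "u j * w i = segre_col m j (segre m u w) i" unfolding segre_col_segre[OF assms(2) that] ..
    then show ?thesis by (simp add: z segre_col_def)
  qed
  from this[of 0] this[of 1] have "u 0 * w i = 0" "u 1 * w i = 0" by simp_all
  then show False using assms(1) \<open>w i \<noteq> 0\<close> by simp
qed

lemma hform_segre_col:
  assumes "hform \<real> m d P" "j \<le> 1"
  shows "hform \<real> (2 * m + 1) d (\<lambda>z. P (segre_col m j z))"
proof -
  have "hform \<real> (2 * m + 1) 1 (\<lambda>z. z (i + j * (m + 1)))" if "i \<le> m" for i
  proof (rule hform_var)
    have "j = 0 \<or> j = 1" using assms(2) by linarith
    then show "i + j * (m + 1) \<le> 2 * m + 1" using that by auto
  qed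
  from hform_subst[OF assms(1), of "2 * m + 1" 1 "\<lambda>i z. z (i + j * (m + 1))", OF this]
  show ?thesis by (simp add: segre_col_def)
qed

definition segre_point :: "nat \<Rightarrow> cpoint \<Rightarrow> cpoint \<Rightarrow> cpoint" where
  "segre_point m p q = (let u = SOME u. u \<in> p - {0}; w = SOME w. w \<in> q - {0} in line (segre m u w))"

lemma segre_point_line:
  assumes "u \<noteq> 0" "w \<noteq> 0"
  shows "segre_point m (line u) (line w) = line (segre m u w)"
proof -
  obtain c where c: "c \<noteq> 0" "(SOME x. x \<in> line u - {0}) = (\<lambda>i. c * u i)"
    using some_in_line[OF assms(1)] by blast
  obtain d where d: "d \<noteq> 0" "(SOME x. x \<in> line w - {0}) = (\<lambda>i. d * w i)"
    using some_in_line[OF assms(2)] by blast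
  show ?thesis
    unfolding segre_point_def Let_def c(2) d(2) segre_scale_left segre_scale_right
    using line_scale[OF c(1)] line_scale[OF d(1)] by metis
qed

lemma morphism_point:
  assumes X: "X \<subseteq> proj_space n" and f: "real_morphism n X m f" and p: "p \<in> X"
  obtains w where "w \<in> cspace m" "w \<noteq> 0" "f p = line w"
proof -
  obtain v where v: "v \<in> cone_pts n X" "p = line v" using in_points_cone[OF X p] by blast
  obtain d F where F: "local_forms n X m f d F" "\<exists>i\<le>m. F i v \<noteq> 0"
    using f v(1) real_morphism_iff[OF X] by blast
  have "f p = line (vec_upto m F v)" using F v by (simp add: local_forms_def)
  then show thesis using that[OF vec_upto_cspace[of m F v] vec_upto_nonzero[of m F v, OF F(2)]] by blast
qed

lemma real_zariski_closed_subset: assumes "real_zariski_closed n X" shows "X \<subseteq> proj_space n"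
proof -
  obtain S where S: "X = form_locus n S" using assms[unfolded real_zariski_closed_iff] by (elim exE conjE)
  show ?thesis unfolding S by (rule form_locus_subset)
qed

text \<open>The setting for the map \<open>(g, \<phi>)\<close> followed by the Segre map, where
  \<open>\<phi>\<close> is an embedding. Its inverse \<open>\<kappa>\<close> is kept explicit
  because the equations of the image are pulled back along it.\<close>

locale segre_setup =
  fixes n m :: nat and X :: "cpoint set" and g \<phi> \<kappa> :: "cpoint \<Rightarrow> cpoint"
  assumes XP: "X \<subseteq> proj_space n" and g: "real_morphism n X 1 g"
    and \<phi>: "real_morphism n X m \<phi>" "real_zariski_closed m (\<phi> ` X)"
    and \<kappa>: "real_morphism m (\<phi> ` X) n \<kappa>" "\<And>p. p \<in> X \<Longrightarrow> \<kappa> (\<phi> p) = p"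
begin

abbreviation \<Phi> :: "cpoint \<Rightarrow> cpoint" where
  "\<Phi> p \<equiv> segre_point m (g p) (\<phi> p)"

lemma \<phi>XP: "\<phi> ` X \<subseteq> proj_space m"
  using \<phi>(2) by (rule real_zariski_closed_subset)

lemma point_data:
  assumes "p \<in> X"
  obtains u w where "u \<in> cspace 1" "u 0 \<noteq> 0 \<or> u 1 \<noteq> 0" "g p = line u" "w \<in> cspace m" "w \<noteq> 0" "\<phi> p = line w"
    "\<Phi> p = line (segre m u w)"
proof -
  obtain u where u: "u \<in> cspace 1" "u \<noteq> 0" "g p = line u" using morphism_point[OF XP g assms] by blast
  obtain w where w: "w \<in> cspace m" "w \<noteq> 0" "\<phi> p = line w" using morphism_point[OF XP \<phi>(1) assms] by blast
  have "u 0 \<noteq> 0 \<or> u 1 \<noteq> 0"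
    using cspace_1_eqI[OF u(1), of 0] u(2) by (auto simp: cspace_def)
  then show thesis using that[OF u(1) _ u(3) w] segre_point_line[OF u(2) w(2)] u(3) w(3) by simp
qed

lemma morphism_\<Phi>: "real_morphism n X (2 * m + 1) \<Phi>"
  unfolding real_morphism_iff[OF XP]
proof
  fix v assume v: "v \<in> cone_pts n X"
  obtain d F where F: "local_forms n X m \<phi> d F" "\<exists>i\<le>m. F i v \<noteq> 0"
    using \<phi>(1) v real_morphism_iff[OF XP] by blast
  obtain e G where G: "local_forms n X 1 g e G" "\<exists>i\<le>1. G i v \<noteq> 0"
    using g v real_morphism_iff[OF XP] by blast
  define H where "H i = (\<lambda>v. segre m (pair_vec (G 0 v) (G 1 v)) (vec_upto m F v) i)" for i
  have Hvec: "vec_upto (2 * m + 1) H x = segre m (pair_vec (G 0 x) (G 1 x)) (vec_upto m F x)" for x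
    using segre_cspace[of m "pair_vec (G 0 x) (G 1 x)" "vec_upto m F x"]
    by (auto simp: H_def fun_eq_iff cspace_def)
  have nzH: "\<exists>i\<le>2 * m + 1. H i x \<noteq> 0" if "\<exists>i\<le>m. F i x \<noteq> 0" "G 0 x \<noteq> 0 \<or> G 1 x \<noteq> 0" for x
  proof -
    have "segre m (pair_vec (G 0 x) (G 1 x)) (vec_upto m F x) \<noteq> 0"
      using that(2) vec_upto_nonzero[of m F x, OF that(1)] vec_upto_cspace by (intro segre_nonzero) auto
    from exists_nonzero_coord[OF segre_cspace this] show ?thesis by (simp add: H_def)
  qed
  have "local_forms n X (2 * m + 1) \<Phi> (e + d) H"
    unfolding local_forms_def
  proof (intro conjI allI ballI impI)
    fix i assume i: "i \<le> 2 * m + 1"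
    have hF: "\<And>i. i \<le> m \<Longrightarrow> hform \<real> n d (F i)" using F(1) by (simp add: local_forms_def)
    show "hform \<real> n (e + d) (H i)"
    proof (cases "i \<le> m")
      case True
      then have "H i = (\<lambda>v. G 0 v * F i v)" by (simp add: H_def segre_def)
      then show ?thesis using hform_mult[OF local_formsD(1)[OF G(1)] hF[OF True]] by simp
    next
      case False
      then have "i - (m + 1) \<le> m" using i by linarith
      moreover have "H i = (\<lambda>v. G 1 v * F (i - (m + 1)) v)"
        using False i calculation by (simp add: H_def segre_def)
      ultimately show ?thesis using hform_mult[OF local_formsD(2)[OF G(1)] hF] by simp
    qed
  next
    fix x assume x: "x \<in> cone_pts n X" "\<exists>i\<le>2 * m + 1. H i x \<noteq> 0"
    then obtain i where "i \<le> 2 * m + 1" "H i x \<noteq> 0" by blast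
    then have nzF: "\<exists>i\<le>m. F i x \<noteq> 0" and nzG: "G 0 x \<noteq> 0 \<or> G 1 x \<noteq> 0"
      by (auto simp: H_def segre_def split: if_splits)
    have "\<phi> (line x) = line (vec_upto m F x)" using F(1) x(1) nzF by (simp add: local_forms_def)
    moreover have "g (line x) = line (pair_vec (G 0 x) (G 1 x))" by (rule local_formsD(3)[OF G(1) x(1) nzG])
    ultimately show "\<Phi> (line x) = line (vec_upto (2 * m + 1) H x)"
      unfolding Hvec using segre_point_line[OF _ vec_upto_nonzero[of m F x, OF nzF]] nzG by (simp add: pair_vec_nonzero)
  qed
  then show "\<exists>d F. local_forms n X (2 * m + 1) \<Phi> d F \<and> (\<exists>i\<le>2 * m + 1. F i v \<noteq> 0)"
    using nzH[OF F(2) G(2)[unfolded nonvanishing_1]] by blast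
qed

text \<open>The vector of local forms may vanish, so only membership in the line is claimed.\<close>

lemma inverse_in_line:
  assumes F: "local_forms m (\<phi> ` X) n \<kappa> d F" and w: "w \<in> cone_pts m (\<phi> ` X)" and p: "p \<in> X" "\<phi> p = line w"
  shows "vec_upto n F w \<in> p"
proof (cases "\<exists>i\<le>n. F i w \<noteq> 0")
  case True
  then have "\<kappa> (line w) = line (vec_upto n F w)" using F w by (simp add: local_forms_def)
  then have "p = line (vec_upto n F w)" using \<kappa>(2)[OF p(1)] p(2) by simp
  then show ?thesis by simp
next
  case False
  then have "vec_upto n F w = (\<lambda>_. 0)" by (auto simp: fun_eq_iff)
  moreover obtain v where "p = line v" using p(1) XP by (auto simp: proj_space_def)
  ultimately show ?thesis by (auto simp: in_line intro!: exI[of _ 0])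
qed

text \<open>Three families: the 2x2 minors, which make the columns proportional; the equations of
  the image of \<open>\<phi>\<close> on each column; and the graph of \<open>g\<close>, comparing
  the tensor factor with \<open>g\<close> at the preimage under \<open>\<phi>\<close>, which local
  forms of \<open>\<kappa>\<close> compute from a column. Either column may vanish, so the
  conditions on a column are imposed on both.\<close>

definition segre_eqs :: "(cvec \<Rightarrow> complex) set \<Rightarrow> (cvec \<Rightarrow> complex) set" where
  "segre_eqs S =
    {(\<lambda>z. z i * z (m + 1 + j) - z j * z (m + 1 + i)) | i j. i \<le> m \<and> j \<le> m} \<union>
    {(\<lambda>z. P (segre_col m c z)) | P c. P \<in> S \<and> c \<le> 1} \<union>
    {(\<lambda>z. z i * G 1 (vec_upto n F (segre_col m c z)) - z (m + 1 + i) * G 0 (vec_upto n F (segre_col m c z))) | i c d F e G.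
       i \<le> m \<and> c \<le> 1 \<and> local_forms m (\<phi> ` X) n \<kappa> d F \<and> local_forms n X 1 g e G}"

lemma segre_eqs_forms:
  assumes S: "\<forall>P\<in>S. \<exists>d. hform \<real> m d P" and P: "P \<in> segre_eqs S"
  shows "\<exists>d. hform \<real> (2 * m + 1) d P"
proof -
  have var: "hform \<real> (2 * m + 1) 1 (\<lambda>z. z i)" if "i \<le> 2 * m + 1" for i using that by (rule hform_var)
  from P consider (minor) i j where "P = (\<lambda>z. z i * z (m + 1 + j) - z j * z (m + 1 + i))" "i \<le> m" "j \<le> m"
    | (col) Q c where "P = (\<lambda>z. Q (segre_col m c z))" "Q \<in> S" "c \<le> 1"
    | (graph) i c d F e G where "P = (\<lambda>z. z i * G 1 (vec_upto n F (segre_col m c z)) - z (m + 1 + i) * G 0 (vec_upto n F (segre_col m c z)))"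
      "i \<le> m" "c \<le> 1" "local_forms m (\<phi> ` X) n \<kappa> d F" "local_forms n X 1 g e G"
    unfolding segre_eqs_def by blast
  then show ?thesis
  proof cases
    case minor
    have "hform \<real> (2 * m + 1) (1 + 1) P"
      unfolding minor(1) using minor(2,3) by (intro hform_diff hform_mult var) auto
    then show ?thesis by blast
  next
    case col
    then obtain d where "hform \<real> m d Q" using S by blast
    then show ?thesis unfolding col(1) using hform_segre_col[OF _ col(3)] by blast
  next
    case graph
    have hF: "hform \<real> (2 * m + 1) d (\<lambda>z. F k (segre_col m c z))" if "k \<le> n" for k
      using graph(4) that by (intro hform_segre_col graph(3)) (simp add: local_forms_def)
    have hG: "hform \<real> (2 * m + 1) (e * d) (\<lambda>z. Q (vec_upto n F (segre_col m c z)))" if "hform \<real> n e Q" for Q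
      using hform_subst[OF that, of "2 * m + 1" d "\<lambda>k z. F k (segre_col m c z)"] hF by simp
    have "hform \<real> (2 * m + 1) (1 + e * d) P"
      unfolding graph(1) using graph(2) local_formsD(1,2)[OF graph(5)]
      by (intro hform_diff hform_mult var hG) auto
    then show ?thesis by blast
  qed
qed

text \<open>For the converse inclusion, a nonzero column is a representative \<open>w\<close> of a
  point of the image of \<open>\<phi>\<close>, the minors write \<open>z\<close> as the tensor
  product of some \<open>u\<close> with \<open>w\<close>, and the graph equation for local forms
  that do not vanish there identifies \<open>u\<close> with the value of \<open>g\<close>.\<close>

lemma image_\<Phi>:
  assumes S: "\<forall>P\<in>S. \<exists>d. hform \<real> m d P" "\<phi> ` X = form_locus m S"
  shows "\<Phi> ` X = form_locus (2 * m + 1) (segre_eqs S)"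
proof -
  have exS: "\<forall>P\<in>S. \<exists>K d. hform K m d P" using S(1) by blast
  have exE: "\<forall>P\<in>segre_eqs S. \<exists>K d. hform K (2 * m + 1) d P" using segre_eqs_forms[OF S(1)] by blast
  show ?thesis
  proof
    show "\<Phi> ` X \<subseteq> form_locus (2 * m + 1) (segre_eqs S)"
    proof
      fix q assume "q \<in> \<Phi> ` X"
      then obtain p where p: "p \<in> X" "q = \<Phi> p" by blast
      obtain u w where u: "u \<in> cspace 1" "u 0 \<noteq> 0 \<or> u 1 \<noteq> 0" "g p = line u"
        and w: "w \<in> cspace m" "w \<noteq> 0" "\<phi> p = line w" and \<Phi>p: "\<Phi> p = line (segre m u w)"
        by (rule point_data[OF p(1)])
      define z where "z = segre m u w"
      have z: "z \<in> cspace (2 * m + 1)" "z \<noteq> 0"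
        using segre_cspace segre_nonzero[OF u(2) w(1,2)] by (simp_all add: z_def)
      have col: "segre_col m c z = (\<lambda>i. u c * w i)" if "c \<le> 1" for c
        unfolding z_def using segre_col_segre[OF w(1) that] .
      have zi: "z i = u 0 * w i" "z (m + 1 + i) = u 1 * w i" if "i \<le> m" for i
        using that by (simp_all add: z_def segre_def)
      have wX: "w \<in> cone_pts m (\<phi> ` X)"
        unfolding cone_pts_def using w(1,2) p(1) w(3) by auto
      have "P z = 0" if P: "P \<in> segre_eqs S" for P
      proof -
        from P consider (minor) i j where "P = (\<lambda>z. z i * z (m + 1 + j) - z j * z (m + 1 + i))" "i \<le> m" "j \<le> m"
          | (col) Q c where "P = (\<lambda>z. Q (segre_col m c z))" "Q \<in> S" "c \<le> 1"
          | (graph) i c d F e G where "P = (\<lambda>z. z i * G 1 (vec_upto n F (segre_col m c z)) - z (m + 1 + i) * G 0 (vec_upto n F (segre_col m c z)))"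
            "i \<le> m" "c \<le> 1" "local_forms m (\<phi> ` X) n \<kappa> d F" "local_forms n X 1 g e G"
          unfolding segre_eqs_def by blast
        then show ?thesis
        proof cases
          case minor
          show ?thesis unfolding minor(1) zi[OF minor(2)] zi[OF minor(3)] by (simp add: mult_ac)
        next
          case col
          obtain d where d: "hform \<real> m d Q" using S(1) col(2) by blast
          have "line w \<in> form_locus m S" using cone_line[OF wX] S(2) by simp
          then have "Q w = 0" using line_in_form_locus[OF exS w(1,2)] col(2) by blast
          then show ?thesis
            unfolding col(1) \<open>\<And>c. c \<le> 1 \<Longrightarrow> segre_col m c z = (\<lambda>i. u c * w i)\<close>[OF col(3)] hform_scale[OF d] by simp
        next
          case graph
          have hF: "hform \<real> m d (F k)" if "k \<le> n" for k using graph(4) that by (simp add: local_forms_def)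
          obtain x where x: "x \<in> cone_pts n X" "p = line x" using in_points_cone[OF XP p(1)] by blast
          have "vec_upto n F w \<in> line x"
            using inverse_in_line[OF graph(4) wX p(1) w(3)] x(2) by simp
          then obtain c' where c': "vec_upto n F w = (\<lambda>i. c' * x i)" unfolding in_line by blast
          \<comment> \<open>The factor is allowed to be 0, as the column or the local forms of
            \<open>\<kappa>\<close> may vanish here.\<close>
          have "vec_upto n F (segre_col m c z) = (\<lambda>i. (u c ^ d * c') * x i)"
          proof
            fix k
            have "vec_upto n F (\<lambda>i. u c * w i) k = u c ^ d * vec_upto n F w k"
              using hform_scale[OF hF] by simp
            then show "vec_upto n F (segre_col m c z) k = (u c ^ d * c') * x k"
              unfolding col[OF graph(3)] fun_cong[OF c', of k] by (simp add: mult.assoc)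
          qed
          note vec = this
          \<comment> \<open>\<open>u\<close> and the local forms of \<open>g\<close> represent the
            same point; where these forms vanish together, the equation holds trivially.\<close>
          have Gx: "u 0 * G 1 x = u 1 * G 0 x"
          proof (cases "G 0 x \<noteq> 0 \<or> G 1 x \<noteq> 0")
            case True
            then have "line (pair_vec (G 0 x) (G 1 x)) = line u"
              using local_formsD(3)[OF graph(5) x(1)] u(3) x(2) by simp
            moreover have "pair_vec (G 0 x) (G 1 x) \<noteq> 0" "u \<noteq> 0"
              using True u(2) by (auto simp: pair_vec_nonzero)
            ultimately obtain k where "u = (\<lambda>i. k * pair_vec (G 0 x) (G 1 x) i)" using line_eq_iff by blast
            then have "u 0 = k * G 0 x" "u 1 = k * G 1 x" by simp_all
            then show ?thesis by (simp add: mult_ac)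
          qed auto
          note hG = local_formsD(1,2)[OF graph(5)]
          have "u 0 * w i * (r * G 1 x) - u 1 * w i * (r * G 0 x) = w i * r * (u 0 * G 1 x - u 1 * G 0 x)" for r
            by (simp add: algebra_simps)
          then show ?thesis
            unfolding graph(1) zi[OF graph(2)] vec hform_scale[OF hG(1)] hform_scale[OF hG(2)] using Gx by simp
        qed
      qed
      then show "q \<in> form_locus (2 * m + 1) (segre_eqs S)"
        unfolding p(2) \<Phi>p z_def[symmetric] using line_in_form_locus[OF exE z] by blast
    qed
    show "form_locus (2 * m + 1) (segre_eqs S) \<subseteq> \<Phi> ` X"
    proof
      fix q assume "q \<in> form_locus (2 * m + 1) (segre_eqs S)"
      then obtain z where z: "z \<in> cspace (2 * m + 1)" "z \<noteq> 0" "q = line z"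
        and eqs: "\<And>P. P \<in> segre_eqs S \<Longrightarrow> P z = 0"
        by (auto simp: form_locus_def)
      have minor: "z i * z (m + 1 + j) = z j * z (m + 1 + i)" if "i \<le> m" "j \<le> m" for i j
      proof -
        have "(\<lambda>z. z i * z (m + 1 + j) - z j * z (m + 1 + i)) \<in> segre_eqs S"
          unfolding segre_eqs_def using that by blast
        from eqs[OF this] show ?thesis by simp
      qed
      have colS: "P (segre_col m c z) = 0" if "P \<in> S" "c \<le> 1" for P c
      proof -
        have "(\<lambda>z. P (segre_col m c z)) \<in> segre_eqs S"
          unfolding segre_eqs_def using that by blast
        from eqs[OF this] show ?thesis .
      qed
      obtain k where k: "k \<le> 2 * m + 1" "z k \<noteq> 0" using exists_nonzero_coord[OF z(1,2)] by blast
      obtain c i0 where c: "c \<le> 1" "i0 \<le> m" "segre_col m c z i0 \<noteq> 0"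
      proof (cases "k \<le> m")
        case True
        then show thesis using that[of 0 k] k(2) by (simp add: segre_col_def)
      next
        case False
        then have "k - (m + 1) \<le> m" "k - (m + 1) + 1 * (m + 1) = k" using k(1) False by simp_all
        then show thesis using that[of 1 "k - (m + 1)"] k(2) by (simp add: segre_col_def)
      qed
      define w where "w = segre_col m c z"
      have w: "w \<in> cspace m" "w \<noteq> 0" using c(3) segre_col_cspace by (auto simp: w_def)
      have "line w \<in> \<phi> ` X"
        unfolding S(2) using line_in_form_locus[OF exS w] colS[OF _ c(1)] by (simp add: w_def)
      then obtain p where p: "p \<in> X" "\<phi> p = line w" by force
      have wX: "w \<in> cone_pts m (\<phi> ` X)" using w \<open>line w \<in> \<phi> ` X\<close> by (simp add: cone_pts_def)
      \<comment> \<open>The tensor factor is read off at the nonzero entry \<open>i0\<close> and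
        normalised such that \<open>u c = 1\<close>.\<close>
      define u where "u = pair_vec (segre_col m 0 z i0 / w i0) (segre_col m 1 z i0 / w i0)"
      have w0: "w i0 \<noteq> 0" using c(3) by (simp add: w_def)
      have cc: "c = 0 \<or> c = 1" using c(1) by linarith
      have col_eq: "segre_col m j z = (\<lambda>i. u j * w i)" if "j \<le> 1" for j
      proof
        fix i
        have jj: "j = 0 \<or> j = 1" using that by linarith
        show "segre_col m j z i = u j * w i"
        proof (cases "i \<le> m")
          case True
          have cz: "segre_col m 0 z i = z i" "segre_col m 1 z i = z (m + 1 + i)" "segre_col m 0 z i0 = z i0" "segre_col m 1 z i0 = z (m + 1 + i0)"
            using True c(2) by (simp_all add: segre_col_def add.commute)
          have "segre_col m j z i * w i0 = segre_col m j z i0 * w i"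
            using jj cc minor[OF True c(2)] unfolding w_def
            by (elim disjE) (simp_all add: cz[simplified] mult_ac)
          then have "segre_col m j z i = segre_col m j z i0 / w i0 * w i" using w0 by (simp add: field_simps)
          then show ?thesis using jj by (auto simp: u_def)
        next
          case False
          then show ?thesis using w(1) by (simp add: segre_col_def cspace_def)
        qed
      qed
      have zs: "z = segre m u w" using z(1) w(1) col_eq[of 0] col_eq[of 1] by (intro segre_eqI) auto
      have "u c = 1" using w0 cc by (auto simp: u_def w_def)
      then have u0: "u \<noteq> 0" using cc by auto
      have uc: "u \<in> cspace 1" unfolding u_def by (rule pair_vec_cspace)
      obtain d F where F: "local_forms m (\<phi> ` X) n \<kappa> d F" "\<exists>i\<le>n. F i w \<noteq> 0"
        using \<kappa>(1) wX real_morphism_iff[OF \<phi>XP] by blast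
      define x where "x = vec_upto n F w"
      have "\<kappa> (line w) = line x" using F wX by (simp add: local_forms_def x_def)
      then have px: "p = line x" using \<kappa>(2)[OF p(1)] p(2) by simp
      then have xX: "x \<in> cone_pts n X"
        using p(1) vec_upto_cspace vec_upto_nonzero[of n F w, OF F(2)] by (simp add: cone_pts_def x_def)
      obtain e G where G: "local_forms n X 1 g e G" "\<exists>i\<le>1. G i x \<noteq> 0"
        using g xX real_morphism_iff[OF XP] by blast
      have "(\<lambda>z. z i0 * G 1 (vec_upto n F (segre_col m c z)) - z (m + 1 + i0) * G 0 (vec_upto n F (segre_col m c z))) \<in> segre_eqs S"
        unfolding segre_eqs_def using c(1,2) F(1) G(1) by blast
      from eqs[OF this] have "z i0 * G 1 x = z (m + 1 + i0) * G 0 x"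
        unfolding x_def w_def by (simp only: right_minus_eq)
      moreover have "z i0 = u 0 * w i0" "z (m + 1 + i0) = u 1 * w i0"
        using c(2) unfolding zs by (simp_all add: segre_def)
      ultimately have ueq: "u 0 * G 1 x = u 1 * G 0 x" using w0 by simp
      have gx: "g p = line (pair_vec (G 0 x) (G 1 x))"
        unfolding px by (rule local_formsD(3)[OF G(1) xX G(2)[unfolded nonvanishing_1]])
      have "\<exists>k. u = (\<lambda>i. k * pair_vec (G 0 x) (G 1 x) i)"
      proof (cases "G 0 x = 0")
        case True
        then have "G 1 x \<noteq> 0" using G(2)[unfolded nonvanishing_1] by simp
        then have "u 0 = 0" using ueq True by simp
        then show ?thesis using \<open>G 1 x \<noteq> 0\<close> True
          by (intro exI[of _ "u 1 / G 1 x"] cspace_1_eqI[OF uc cspace_scale[OF pair_vec_cspace]]) auto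
      next
        case False
        then have "u 1 = u 0 / G 0 x * G 1 x" using ueq by (simp add: field_simps)
        then show ?thesis using False
          by (intro exI[of _ "u 0 / G 0 x"] cspace_1_eqI[OF uc cspace_scale[OF pair_vec_cspace]]) auto
      qed
      then have "u \<in> line (pair_vec (G 0 x) (G 1 x))" unfolding in_line .
      then have "g p = line u" using line_eqD[OF _ u0] gx by simp
      then have "\<Phi> p = q" using segre_point_line[OF u0 w(2)] p(2) zs z(3) by simp
      then show "q \<in> \<Phi> ` X" using p(1) by blast
    qed
  qed
qed

lemma closed_\<Phi>: "real_zariski_closed (2 * m + 1) (\<Phi> ` X)"
proof -
  obtain S where S: "\<forall>P\<in>S. \<exists>d. hform \<real> m d P" "\<phi> ` X = form_locus m S"
    using \<phi>(2)[unfolded real_zariski_closed_iff] by (elim exE conjE)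
  show ?thesis
    unfolding real_zariski_closed_iff image_\<Phi>[OF S] using segre_eqs_forms[OF S(1)] by blast
qed

text \<open>A nonzero column of the Segre vector represents \<open>\<phi> p\<close>, from which
  \<open>\<kappa>\<close> recovers \<open>p\<close>.\<close>

lemma inj_\<Phi>: "inj_on \<Phi> X"
proof (rule inj_onI)
  fix p p' assume p: "p \<in> X" "p' \<in> X" "\<Phi> p = \<Phi> p'"
  obtain u w where "u \<in> cspace 1" and u: "u 0 \<noteq> 0 \<or> u 1 \<noteq> 0" and "g p = line u"
    and w: "w \<in> cspace m" "w \<noteq> 0" "\<phi> p = line w" and \<Phi>p: "\<Phi> p = line (segre m u w)"
    by (rule point_data[OF p(1)])
  obtain u' w' where "u' \<in> cspace 1" and u': "u' 0 \<noteq> 0 \<or> u' 1 \<noteq> 0" and "g p' = line u'"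
    and w': "w' \<in> cspace m" "w' \<noteq> 0" "\<phi> p' = line w'" and \<Phi>p': "\<Phi> p' = line (segre m u' w')"
    by (rule point_data[OF p(2)])
  have "line (segre m u w) = line (segre m u' w')" using p(3) \<Phi>p \<Phi>p' by simp
  then obtain k where k: "k \<noteq> 0" "segre m u' w' = (\<lambda>i. k * segre m u w i)"
    using line_eq_iff[OF segre_nonzero[OF u w(1,2)] segre_nonzero[OF u' w'(1,2)]] by blast
  obtain c where c: "c \<le> (1::nat)" "u' c \<noteq> 0" using u' by (elim disjE) (simp_all add: that[of 0] that[of 1])
  have eq: "(\<lambda>i. u' c * w' i) = (\<lambda>i. k * (u c * w i))"
    using segre_col_segre[OF w'(1) c(1), of u'] segre_col_segre[OF w(1) c(1), of u] segre_col_scale[of m c k "segre m u w"] k(2)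
    by simp
  have "w' = (\<lambda>i. (k * u c / u' c) * w i)"
  proof
    fix i
    have "u' c * w' i = k * (u c * w i)" using eq by (rule fun_cong)
    then show "w' i = (k * u c / u' c) * w i" using c(2) by (simp add: field_simps)
  qed
  then have "w' \<in> line w" unfolding in_line by (rule exI)
  then have "\<phi> p' = \<phi> p" using line_eqD[OF _ w'(2)] w(3) w'(3) by simp
  then show "p = p'" using \<kappa>(2) p(1,2) by metis
qed

text \<open>A column that is nonzero at the given point represents the value of
  \<open>\<phi>\<close>, and local forms of \<open>\<kappa>\<close> are applied to it. The same
  column may vanish at other points, but wherever \<open>local_forms\<close> demands anything the
  scale factor \<open>u' c ^ d\<close> is nonzero.\<close>

lemma morphism_inverse: "real_morphism (2 * m + 1) (\<Phi> ` X) n (inv_into X \<Phi>)"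
proof -
  have P: "\<Phi> ` X \<subseteq> proj_space (2 * m + 1)"
    using closed_\<Phi> by (rule real_zariski_closed_subset)
  have data: "\<exists>p u w. p \<in> X \<and> w \<in> cone_pts m (\<phi> ` X) \<and> \<phi> p = line w \<and> inv_into X \<Phi> (line z) = p \<and>
      (u 0 \<noteq> 0 \<or> u 1 \<noteq> 0) \<and> (\<forall>c\<le>1. segre_col m c z = (\<lambda>i. u c * w i))" if z: "z \<in> cone_pts (2 * m + 1) (\<Phi> ` X)" for z
  proof -
    obtain p where p: "p \<in> X" "line z = \<Phi> p" using cone_line[OF z] by blast
    obtain u w where "u \<in> cspace 1" and u: "u 0 \<noteq> 0 \<or> u 1 \<noteq> 0" and "g p = line u"
      and w: "w \<in> cspace m" "w \<noteq> 0" "\<phi> p = line w" and \<Phi>p: "\<Phi> p = line (segre m u w)"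
      by (rule point_data[OF p(1)])
    obtain k where k: "k \<noteq> 0" "z = (\<lambda>i. k * segre m u w i)"
      using line_eq_iff[OF segre_nonzero[OF u w(1,2)] cone_nonzero[OF z]] p(2) \<Phi>p by auto
    have "segre_col m c z = (\<lambda>i. (k * u c) * w i)" if "c \<le> 1" for c
      unfolding k(2) segre_col_scale segre_col_segre[OF w(1) that] by (simp only: mult.assoc)
    moreover have "w \<in> cone_pts m (\<phi> ` X)" unfolding cone_pts_def using w p(1) by auto
    moreover have "inv_into X \<Phi> (line z) = p" unfolding p(2) using inj_\<Phi> p(1) by (rule inv_into_f_f)
    moreover have "k * u 0 \<noteq> 0 \<or> k * u 1 \<noteq> 0" using u k(1) by simp
    ultimately show ?thesis using p(1) w(3)
      by (intro exI[of _ p] exI[of _ "\<lambda>i. k * u i"] exI[of _ w]) simp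
  qed
  show ?thesis
    unfolding real_morphism_iff[OF P]
  proof
    fix z assume z: "z \<in> cone_pts (2 * m + 1) (\<Phi> ` X)"
    from data[OF z] obtain p u w where w: "w \<in> cone_pts m (\<phi> ` X)" "\<phi> p = line w"
      and u: "u 0 \<noteq> 0 \<or> u 1 \<noteq> 0" and col: "\<And>c. c \<le> 1 \<Longrightarrow> segre_col m c z = (\<lambda>i. u c * w i)" by metis
    obtain c where c: "c \<le> (1::nat)" "u c \<noteq> 0" using u by (elim disjE) (simp_all add: that[of 0] that[of 1])
    obtain d F where F: "local_forms m (\<phi> ` X) n \<kappa> d F" "\<exists>i\<le>n. F i w \<noteq> 0"
      using \<kappa>(1) w(1) real_morphism_iff[OF \<phi>XP] by blast
    have hF: "hform \<real> m d (F k)" if "k \<le> n" for k using F(1) that by (simp add: local_forms_def)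
    define H where "H = (\<lambda>k z. F k (segre_col m c z))"
    have "local_forms (2 * m + 1) (\<Phi> ` X) n (inv_into X \<Phi>) d H"
      unfolding local_forms_def
    proof (intro conjI allI ballI impI)
      fix k assume "k \<le> n"
      then show "hform \<real> (2 * m + 1) d (H k)" unfolding H_def by (intro hform_segre_col hF c(1))
    next
      fix z' assume z': "z' \<in> cone_pts (2 * m + 1) (\<Phi> ` X)" and nz: "\<exists>k\<le>n. H k z' \<noteq> 0"
      from data[OF z'] obtain p' u' w' where p': "p' \<in> X" "inv_into X \<Phi> (line z') = p'"
        and w': "w' \<in> cone_pts m (\<phi> ` X)" "\<phi> p' = line w'"
        and col': "\<And>c. c \<le> 1 \<Longrightarrow> segre_col m c z' = (\<lambda>i. u' c * w' i)" by metis
      have Hk: "H k z' = u' c ^ d * F k w'" if "k \<le> n" for k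
        unfolding H_def col'[OF c(1)] by (rule hform_scale[OF hF[OF that]])
      then have nz': "\<exists>k\<le>n. F k w' \<noteq> 0" "u' c ^ d \<noteq> 0" using nz by auto
      have "vec_upto n H z' = (\<lambda>k. u' c ^ d * vec_upto n F w' k)" using Hk by auto
      then have "line (vec_upto n H z') = line (vec_upto n F w')" using line_scale[OF nz'(2)] by simp
      also have "\<dots> = \<kappa> (line w')" using F(1) w'(1) nz'(1) by (simp add: local_forms_def)
      also have "\<dots> = p'" using \<kappa>(2)[OF p'(1)] w'(2) by simp
      finally show "inv_into X \<Phi> (line z') = line (vec_upto n H z')" using p'(2) by simp
    qed
    moreover have "\<exists>k\<le>n. H k z \<noteq> 0"
      using F(2) hform_scale[OF hF, of _ "u c" w] c(2) unfolding H_def col[OF c(1)] by auto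
    ultimately show "\<exists>d F. local_forms (2 * m + 1) (\<Phi> ` X) n (inv_into X \<Phi>) d F \<and> (\<exists>i\<le>n. F i z \<noteq> 0)"
      by blast
  qed
qed

lemma embedding_\<Phi>: "real_embedding n X (2 * m + 1) \<Phi>"
  unfolding real_embedding_def
  using morphism_\<Phi> closed_\<Phi> morphism_inverse inv_into_f_f[OF inj_\<Phi>] by blast

end

section \<open>Closure under addition\<close>

lemma sum_two_blocks:
  fixes f :: "nat \<Rightarrow> complex"
  shows "(\<Sum>i\<le>2 * m + 1. f i) = (\<Sum>i\<le>m. f i) + (\<Sum>i\<le>m. f (m + 1 + i))"
proof -
  have "(\<Sum>i<k + l. f i) = (\<Sum>i<k. f i) + (\<Sum>i<l. f (k + i))" for k l
    by (induction l) (simp_all add: add.assoc)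
  from this[of "Suc m" "Suc m"] show ?thesis
    by (simp add: lessThan_Suc_atMost[symmetric] mult_2)
qed

lemma line_pair_pole: "x \<noteq> 0 \<or> y \<noteq> 0 \<Longrightarrow> line (pair_vec x y) = circle_point 0 \<longleftrightarrow> y = 0"
  using line_eq_circle_point[OF pair_vec_cspace, of x y 0] by (auto simp: pair_vec_nonzero)

text \<open>With \<open>f = (x : y)\<close> and \<open>g = (u 0 : u 1)\<close> the sum is
  \<open>(u 0 * y + u 1 * x : u 1 * y)\<close>. As \<open>x\<close> and \<open>y\<close> are linear
  in the coordinates \<open>w\<close> of \<open>\<phi>\<close>, both entries are linear forms in the
  tensor product of \<open>u\<close> and \<open>w\<close>, and they vanish together only at a common
  pole.\<close>

lemma hyperbolic_add:
  assumes X: "X \<subseteq> proj_space n" and \<phi>: "real_embedding n X m \<phi>" and ab: "lin_indep_forms m a b"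
    and center: "proj_center m a b \<inter> \<phi> ` X = {}" and f: "\<And>p. p \<in> X \<Longrightarrow> f p = lin_projection m a b (\<phi> p)"
    and g: "real_morphism n X 1 g" and poles: "\<And>p. p \<in> X \<Longrightarrow> \<not> (f p = circle_point 0 \<and> g p = circle_point 0)"
  shows "\<exists>M \<Phi> a' b'. real_embedding n X M \<Phi> \<and> lin_indep_forms M a' b' \<and> proj_center M a' b' \<inter> \<Phi> ` X = {} \<and>
    (\<forall>p\<in>X. add_points (f p) (g p) = lin_projection M a' b' (\<Phi> p))"
proof -
  obtain \<kappa> where \<kappa>: "real_morphism m (\<phi> ` X) n \<kappa>" "\<forall>p\<in>X. \<kappa> (\<phi> p) = p"
    using \<phi> unfolding real_embedding_def by (elim conjE exE)
  interpret segre_setup n m X g \<phi> \<kappa>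
    using X g \<phi> \<kappa> by unfold_locales (simp_all add: real_embedding_def)
  \<comment> \<open>The first block of Segre coordinates is \<open>u 0 * w\<close>, the second
    \<open>u 1 * w\<close>; \<open>a'\<close> reads off \<open>u 0 * y + u 1 * x\<close> and
    \<open>b'\<close> reads off \<open>u 1 * y\<close>.\<close>
  define a' where "a' = (\<lambda>i. if i \<le> m then b i else a (i - (m + 1)))"
  define b' where "b' = (\<lambda>i. if i \<le> m then 0 else b (i - (m + 1)))"
  have lin_a: "lin_form (2 * m + 1) a' (segre m u w) = u 0 * lin_form m b w + u 1 * lin_form m a w" for u w
  proof -
    have "(\<Sum>i\<le>m. of_real (a' i) * segre m u w i) = u 0 * lin_form m b w"
      unfolding lin_form_def sum_distrib_left by (intro sum.cong) (auto simp: a'_def segre_def)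
    moreover have "(\<Sum>i\<le>m. of_real (a' (m + 1 + i)) * segre m u w (m + 1 + i)) = u 1 * lin_form m a w"
      unfolding lin_form_def sum_distrib_left by (intro sum.cong) (auto simp: a'_def segre_def)
    ultimately show ?thesis unfolding lin_form_def[of "2 * m + 1"] sum_two_blocks by simp
  qed
  have lin_b: "lin_form (2 * m + 1) b' (segre m u w) = u 1 * lin_form m b w" for u w
  proof -
    have "(\<Sum>i\<le>m. of_real (b' i) * segre m u w i) = 0"
      by (intro sum.neutral) (auto simp: b'_def)
    moreover have "(\<Sum>i\<le>m. of_real (b' (m + 1 + i)) * segre m u w (m + 1 + i)) = u 1 * lin_form m b w"
      unfolding lin_form_def sum_distrib_left by (intro sum.cong) (auto simp: b'_def segre_def)
    ultimately show ?thesis unfolding lin_form_def[of "2 * m + 1"] sum_two_blocks by simp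
  qed
  \<comment> \<open>On the second block the new coefficient vectors restrict to \<open>a\<close> and
    \<open>b\<close>.\<close>
  have indep: "lin_indep_forms (2 * m + 1) a' b'"
    unfolding lin_indep_forms_def
  proof (intro allI impI)
    fix s t :: real assume st: "\<forall>i\<le>2 * m + 1. s * a' i + t * b' i = 0"
    have "s * a i + t * b i = 0" if "i \<le> m" for i
    proof -
      have "s * a' (m + 1 + i) + t * b' (m + 1 + i) = 0" using st that by simp
      then show ?thesis by (simp add: a'_def b'_def)
    qed
    then show "s = 0 \<and> t = 0" using ab unfolding lin_indep_forms_def by blast
  qed
  have main: "add_points (f p) (g p) = lin_projection (2 * m + 1) a' b' (\<Phi> p) \<and> \<Phi> p \<notin> proj_center (2 * m + 1) a' b'"
    if p: "p \<in> X" for p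
  proof -
    obtain u w where u: "u \<in> cspace 1" "u 0 \<noteq> 0 \<or> u 1 \<noteq> 0" "g p = line u"
      and w: "w \<in> cspace m" "w \<noteq> 0" "\<phi> p = line w" and \<Phi>p: "\<Phi> p = line (segre m u w)"
      by (rule point_data[OF p])
    define x y where "x = lin_form m a w" and "y = lin_form m b w"
    have fp: "f p = line (pair_vec x y)"
      unfolding f[OF p] w(3) lin_projection_line[OF w(2)] x_def y_def ..
    have xy: "x \<noteq> 0 \<or> y \<noteq> 0"
    proof (rule ccontr)
      assume "\<not> ?thesis"
      then have "lin_form m a v = 0 \<and> lin_form m b v = 0" if "v \<in> line w" for v
        using that by (auto simp: in_line lin_form_scale x_def y_def)
      then have "\<phi> p \<in> proj_center m a b"
        unfolding proj_center_def w(3) using w(1,2) by (auto simp: proj_space_def)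
      then show False using center p by blast
    qed
    have u_eq: "u = pair_vec (u 0) (u 1)" by (intro cspace_1_eqI u(1) pair_vec_cspace) simp_all
    have np: "\<not> (y = 0 \<and> u 1 = 0)"
      using poles[OF p] line_pair_pole[OF xy] line_pair_pole[OF u(2)] fp u(3) u_eq by simp
    have nz: "u 0 \<noteq> 0 \<or> u 1 \<noteq> 0" "u \<noteq> 0" "segre m u w \<noteq> 0"
      using u(2) segre_nonzero[OF u(2) w(1,2)] by auto
    have "add_points (f p) (g p) = line (pair_vec (u 0 * y + u 1 * x) (u 1 * y))"
      unfolding fp u(3) using add_points_line[of "pair_vec x y" u] xy nz(2)
      by (simp add: pair_vec_nonzero mult.commute add.commute)
    moreover have "lin_projection (2 * m + 1) a' b' (\<Phi> p) = line (pair_vec (u 0 * y + u 1 * x) (u 1 * y))"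
      unfolding \<Phi>p lin_projection_line[OF nz(3)] lin_a lin_b x_def y_def ..
    moreover have "\<Phi> p \<notin> proj_center (2 * m + 1) a' b'"
    proof
      assume "\<Phi> p \<in> proj_center (2 * m + 1) a' b'"
      then have "lin_form (2 * m + 1) a' (segre m u w) = 0" "lin_form (2 * m + 1) b' (segre m u w) = 0"
        unfolding proj_center_def \<Phi>p by auto
      then have "u 0 * y + u 1 * x = 0" "u 1 * y = 0"
        unfolding lin_a lin_b x_def[symmetric] y_def[symmetric] by simp_all
      then show False using np xy u(2) by auto
    qed
    ultimately show ?thesis by simp
  qed
  then have "proj_center (2 * m + 1) a' b' \<inter> \<Phi> ` X = {}" by blast
  then show ?thesis using embedding_\<Phi> indep main by blast
qed

text \<open>The transformed morphism \<open>g'\<close> is exposed along with the sum, because the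
  Segre embedding is built from \<open>g'\<close> and its projection needs the absence of common
  poles.\<close>

lemma degree_tuple_add:
  assumes X: "real_curve n X" "dividing_type n X"
    and C: "\<forall>i\<in>{1..r}. C i \<in> proj_components n (real_points n X)"
    and f: "separating n X f" and g: "separating n X g"
  shows "\<exists>g'. real_morphism n X 1 g' \<and> separating n X (\<lambda>p. add_points (f p) (g' p)) \<and>
    (\<forall>p\<in>X. \<not> (f p = circle_point 0 \<and> g' p = circle_point 0)) \<and>
    degree_tuple r C (\<lambda>p. add_points (f p) (g' p)) =
      (\<lambda>i\<in>{1..r}. degree_tuple r C f i + degree_tuple r C g i)"
proof -
  obtain a b where det: "a 0 * b 1 - a 1 * b 0 \<noteq> (0::real)"
    and up: "\<And>p. p \<in> X \<Longrightarrow> upper_point (f p) \<longleftrightarrow> upper_point (lin_projection 1 a b (g p))"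
    and lo: "\<And>p. p \<in> X \<Longrightarrow> lower_point (f p) \<longleftrightarrow> lower_point (lin_projection 1 a b (g p))"
    and poles: "\<And>p. p \<in> X \<Longrightarrow> \<not> (f p = circle_point 0 \<and> lin_projection 1 a b (g p) = circle_point 0)"
    and deg: "\<And>C. real_part n X C \<Longrightarrow> sheet_number C (\<lambda>p. lin_projection 1 a b (g p)) = sheet_number C g"
    by (rule exists_moebius[OF X f g]) blast
  note g' = separating_moebius[where a = a and b = b, OF X(1) g det]
  have sep: "separating n X (\<lambda>p. add_points (f p) (lin_projection 1 a b (g p)))"
    by (rule separating_add(1)[OF X(1) f g']) (use up lo poles in blast)+
  have sheets: "sheet_number D (\<lambda>p. add_points (f p) (lin_projection 1 a b (g p))) =
      sheet_number D f + sheet_number D g" if D: "real_part n X D" for D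
    unfolding deg[OF D, symmetric]
    by (rule separating_add(2)[OF X(1) f g' _ _ _ D]) (use up lo poles in blast)+
  have "degree_tuple r C (\<lambda>p. add_points (f p) (lin_projection 1 a b (g p))) =
      (\<lambda>i\<in>{1..r}. degree_tuple r C f i + degree_tuple r C g i)"
    unfolding degree_tuple_def
  proof (rule restrict_ext)
    fix i assume i: "i \<in> {1..r}"
    show "sheet_number (C i) (\<lambda>p. add_points (f p) (lin_projection 1 a b (g p))) =
        (\<lambda>i\<in>{1..r}. sheet_number (C i) f) i + (\<lambda>i\<in>{1..r}. sheet_number (C i) g) i"
      unfolding sheets[OF real_part_component(1)[OF X(1) bspec[OF C i]]] using i by simp
  qed
  moreover have "real_morphism n X 1 (\<lambda>p. lin_projection 1 a b (g p))" using g' by (simp add: separating_def)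
  ultimately show ?thesis
    using sep poles by (intro exI[of _ "\<lambda>p. lin_projection 1 a b (g p)"]) blast
qed

theorem proposition2p1:
  fixes n r :: nat and X :: "cpoint set" and C :: "nat \<Rightarrow> cpoint set"
  assumes "real_curve n X"
    and "dividing_type n X"
    and "bij_betw C {1..r} (proj_components n (real_points n X))"
  shows "is_subsemigroup r (Sep n X r C) \<and> is_subsemigroup r (Hyp n X r C)"
proof -
  note X = assms(1,2)
  have C: "\<forall>i\<in>{1..r}. C i \<in> proj_components n (real_points n X)"
    using assms(3) by (rule bij_betwE)
  have pos: "Sep n X r C \<subseteq> pos_tuples r"
  proof
    fix d assume "d \<in> Sep n X r C"
    then obtain f where f: "separating n X f" "d = degree_tuple r C f" by (auto simp: Sep_def)
    have "sheet_number (C i) f > 0" if "i \<in> {1..r}" for i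
      using real_part_component[OF X(1) bspec[OF C that]] by (rule sheet_number_positive[OF X(1) f(1)])
    then show "d \<in> pos_tuples r"
      unfolding f(2) degree_tuple_def pos_tuples_def by (intro restrict_PiE_iff[THEN iffD2]) simp
  qed
  have sep: "(\<lambda>i\<in>{1..r}. d i + e i) \<in> Sep n X r C" if de: "d \<in> Sep n X r C" "e \<in> Sep n X r C" for d e
  proof -
    obtain f g where f: "separating n X f" "d = degree_tuple r C f" and g: "separating n X g" "e = degree_tuple r C g"
      using de by (auto simp: Sep_def)
    obtain g' where h: "separating n X (\<lambda>p. add_points (f p) (g' p))"
      and deg: "degree_tuple r C (\<lambda>p. add_points (f p) (g' p)) = (\<lambda>i\<in>{1..r}. d i + e i)"
      using degree_tuple_add[OF X C f(1) g(1)] unfolding f(2) g(2) by (elim exE conjE)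
    show ?thesis unfolding Sep_def deg[symmetric] using h by blast
  qed
  have hyp: "(\<lambda>i\<in>{1..r}. d i + e i) \<in> Hyp n X r C" if de: "d \<in> Hyp n X r C" "e \<in> Hyp n X r C" for d e
  proof -
    from de(1)[unfolded Hyp_def mem_Collect_eq] obtain f m \<phi> a b where f: "separating n X f" "d = degree_tuple r C f"
      and \<phi>: "real_embedding n X m \<phi>" "lin_indep_forms m a b" "proj_center m a b \<inter> \<phi> ` X = {}"
        "\<forall>p\<in>X. f p = lin_projection m a b (\<phi> p)"
      by (elim exE conjE)
    have S: "d \<in> Sep n X r C" "e \<in> Sep n X r C" using de by (auto simp: Hyp_def)
    then obtain g where g: "separating n X g" "e = degree_tuple r C g" by (auto simp: Sep_def)
    obtain g' where g': "real_morphism n X 1 g'" and h: "separating n X (\<lambda>p. add_points (f p) (g' p))"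
      and poles: "\<forall>p\<in>X. \<not> (f p = circle_point 0 \<and> g' p = circle_point 0)"
      and deg: "degree_tuple r C (\<lambda>p. add_points (f p) (g' p)) = (\<lambda>i\<in>{1..r}. d i + e i)"
      using degree_tuple_add[OF X C f(1) g(1)] unfolding f(2) g(2) by (elim exE conjE)
    \<comment> \<open>The embedding belonging to \<open>f\<close> and the transformed morphism
      \<open>g'\<close> are the two factors of the Segre map.\<close>
    have "\<exists>M \<Phi> a' b'. real_embedding n X M \<Phi> \<and> lin_indep_forms M a' b' \<and> proj_center M a' b' \<inter> \<Phi> ` X = {} \<and>
        (\<forall>p\<in>X. add_points (f p) (g' p) = lin_projection M a' b' (\<Phi> p))"
      using \<phi>(4) poles by (intro hyperbolic_add[OF real_curve_subset[OF X(1)] \<phi>(1-3) _ g']) simp_all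
    then show ?thesis
      unfolding Hyp_def using sep[OF S] h deg[symmetric]
      by (intro CollectI conjI exI[of _ "\<lambda>p. add_points (f p) (g' p)"]) simp_all
  qed
  have "Hyp n X r C \<subseteq> Sep n X r C" by (auto simp: Hyp_def)
  then show ?thesis unfolding is_subsemigroup_def using pos sep hyp by blast
qed

end
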